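(* Let $n$ be a positive integer, let $(\mathcal{C},\mathbb{E},\mathfrak{s})$ be a Krull-Schmidt $n$-exangulated category with enough projectives and enough injectives, and let $\mathcal{A}$ be an $n$-extension closed subcategory of $\mathcal{C}$. Suppose that $\mathcal{C}(\Sigma\mathcal{A},\mathcal{A})=0$ and $\mathcal{C}(\mathcal{A},\Omega\mathcal{A})=0$, i.e. $\mathcal{C}(S,A)=0$ for all $S\in\Sigma\mathcal{A}$, $A\in\mathcal{A}$, and $\mathcal{C}(A,T)=0$ for all $A\in\mathcal{A}$, $T\in\Omega\mathcal{A}$. Let $\mathcal{E}_{\mathcal{A}}$ be the class of all $\mathfrak{t}$-conflations in $\mathcal{A}$. Then $(\mathcal{A},\mathcal{E}_{\mathcal{A}})$ is an $n$-exact category (in the sense of Jasso).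
   Context: **Extensions.** Let $\mathcal{C}$ be an additive category with an additive bifunctor $\mathbb{E}:\mathcal{C}^{\mathrm{op}}\times\mathcal{C}\to\mathrm{Ab}$. Elements $\delta\in\mathbb{E}(C,A)$ are called ($\mathbb{E}$-)extensions. For $a\in\mathcal{C}(A,A')$ and $c\in\mathcal{C}(C',C)$ write $a_*\delta=\mathbb{E}(C,a)(\delta)\in\mathbb{E}(C,A')$ and $c^*\delta=\mathbb{E}(c,A)(\delta)\in\mathbb{E}(C',A)$. A morphism of extensions from $\delta\in\mathbb{E}(C,A)$ to $\delta'\in\mathbb{E}(C',A')$ is a pair $(a,c)$, $a:A\to A'$, $c:C\to C'$, with $a_*\delta=c^*\delta'$. **Complexes.** $\mathbf{C}^{n+2}_{\mathcal{C}}$ is the category of complexes $X_\bullet: X_0\xrightarrow{d_0^X}X_1\to\cdots\to X_n\xrightarrow{d_n^X}X_{n+1}$ in $\mathcal{C}$ (zero in degrees outside $\{0,\dots,n+1\}$) and chain maps $f_\bullet=(f_0,\dots,f_{n+1})$. For objects $A,C$, $\mathbf{C}^{n+2}_{(\mathcal{C};A,C)}$ is the subcategory of complexes with $X_0=A$, $X_{n+1}=C$ and chain maps with $f_0=\mathrm{id}_A$, $f_{n+1}=\mathrm{id}_C$; $[X_\bullet]$ denotes the homotopy equivalence class of $X_\bullet$ in this category, with respect to the usual chain homotopy relation. **$n$-exangles.** A pair $\langle X_\bullet,\delta\rangle$ with $X_\bullet\in\mathbf{C}^{n+2}_{\mathcal{C}}$ and $\delta\in\mathbb{E}(X_{n+1},X_0)$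 is an $n$-exangle if both sequences of functors $\mathcal{C}(-,X_0)\to\cdots\to\mathcal{C}(-,X_{n+1})\to\mathbb{E}(-,X_0)$ (last map $f\mapsto f^*\delta$) and $\mathcal{C}(X_{n+1},-)\to\cdots\to\mathcal{C}(X_0,-)\to\mathbb{E}(X_{n+1},-)$ (last map $g\mapsto g_*\delta$) are exact. **Exact realization.** $\mathfrak{s}$ assigns to each $\delta\in\mathbb{E}(C,A)$ a homotopy equivalence class $\mathfrak{s}(\delta)=[X_\bullet]$ in $\mathbf{C}^{n+2}_{(\mathcal{C};A,C)}$. It is an exact realization if: (R0) for $\mathfrak{s}(\delta)=[X_\bullet]$, $\mathfrak{s}(\rho)=[Y_\bullet]$ and any morphism of extensions $(a,c):\delta\to\rho$, there is a chain map $f_\bullet=(a,f_1,\dots,f_n,c):X_\bullet\to Y_\bullet$ (a lift of $(a,c)$); (R1) if $\mathfrak{s}(\delta)=[X_\bullet]$ then $\langle X_\bullet,\delta\rangle$ is an $n$-exangle; (R2) for every $A\in\mathcal{C}$, the zero element of $\mathbb{E}(0,A)$ is realized by $[A\xrightarrow{\mathrm{id}}A\to0\to\cdots\to0]$ and the zero element of $\mathbb{E}(A,0)$ by $[0\to\cdots\to0\to A\xrightarrow{\mathrm{id}}A]$. If $\mathfrak{s}(\delta)=[X_\bullet]$, then $\langle X_\bullet,\delta\rangle$ is called an ($\mathfrak{s}$-)distinguished $n$-exangle and $X_\bullet$ an $\mathfrak{s}$-conflation; $d_0^X$ is then an $\mathfrak{s}$-inflation and $d_n^X$ an $\mathfrak{s}$-deflation.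 A distinguished $n$-exangle is displayed as $X_0\to X_1\to\cdots\to X_{n+1}\overset{\delta}{\dashrightarrow}$. **$n$-exangulated category.** A triplet $(\mathcal{C},\mathbb{E},\mathfrak{s})$ with $\mathfrak{s}$ an exact realization of $\mathbb{E}$ such that: (EA1) inflations are closed under composition, and deflations are closed under composition; (EA2) for $\rho\in\mathbb{E}(D,A)$, $c\in\mathcal{C}(C,D)$ and distinguished $n$-exangles $\langle X_\bullet,c^*\rho\rangle$ (from $A$ to $C$) and $\langle Y_\bullet,\rho\rangle$ (from $A$ to $D$), $(\mathrm{id}_A,c)$ has a lift $f_\bullet$ whose mapping cone $M^f_\bullet: X_1\to X_2\oplus Y_1\to X_3\oplus Y_2\to\cdots\to X_{n+1}\oplus Y_n\to Y_{n+1}$, with differentials $d_0=\begin{bmatrix}-d_1^X\\ f_1\end{bmatrix}$, $d_i=\begin{bmatrix}-d_{i+1}^X&0\\ f_{i+1}&d_i^Y\end{bmatrix}$ ($1\le i\le n-1$), $d_n=[f_{n+1}\ \ d_n^Y]$, gives a distinguished $n$-exangle $\langle M^f_\bullet,(d_0^X)_*\rho\rangle$; (EA2$^{\mathrm{op}}$) the dual of (EA2): for $\rho\in\mathbb{E}(C,A)$, $a\in\mathcal{C}(A,B)$ and distinguished $\langle X_\bullet,\rho\rangle$, $\langle Y_\bullet,a_*\rho\rangle$, $(a,\mathrm{id}_C)$ has a lift $f_\bullet$ whose mapping cocone $N^f_\bullet:X_0\to X_1\oplus Y_0\to\cdots\to X_n\oplus Y_{n-1}\to Y_n$, with differentials $\begin{bmatrix}-d_0^X\\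 f_0\end{bmatrix}$, $\begin{bmatrix}-d_i^X&0\\ f_i&d_{i-1}^Y\end{bmatrix}$ ($1\le i\le n-1$), $[f_n\ \ d_{n-1}^Y]$, gives a distinguished $n$-exangle $\langle N^f_\bullet,(d_n^Y)^*\rho\rangle$. **Krull-Schmidt.** An additive category in which every object is a finite direct sum of objects with local endomorphism rings. **Subcategories.** A subcategory $\mathcal{A}$ of $\mathcal{C}$ is always assumed to be full and closed under isomorphisms, direct sums and direct summands. It is $n$-extension closed if for all $A,C\in\mathcal{A}$ and every $\delta\in\mathbb{E}(C,A)$ there is a distinguished $n$-exangle $\langle X_\bullet,\delta\rangle$ with $X_0=A$, $X_{n+1}=C$ and $X_i\in\mathcal{A}$ for $i=1,\dots,n$. In that case let $\mathbb{E}_{\mathcal{A}}$ be the restriction of $\mathbb{E}$ to $\mathcal{A}^{\mathrm{op}}\times\mathcal{A}$, and for $\delta\in\mathbb{E}_{\mathcal{A}}(C,A)$ put $\mathfrak{t}(\delta)=[X_\bullet]$ for such an $X_\bullet$, the homotopy equivalence class being taken in $\mathbf{C}^{n+2}_{(\mathcal{A};A,C)}$. A $\mathfrak{t}$-conflation is a complex $X_\bullet$ in $\mathcal{A}$ with $\mathfrak{t}(\delta)=[X_\bullet]$ for some $\delta\in\mathbb{E}_{\mathcal{A}}(X_{n+1},X_0)$. **Projectives and injectives.** $P\in\mathcal{C}$ is projective if for every distinguished $n$-exangle $A_0\to A_1\to\cdots\to A_n\xrightarrow{\alpha_n}A_{n+1}\dashrightarrow$ and every $c:P\to A_{n+1}$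 there is $b:P\to A_n$ with $\alpha_n b=c$. Injective objects are defined dually. $\mathcal{P}$ and $\mathcal{I}$ are the full subcategories of projective and injective objects of $\mathcal{C}$. $\mathcal{C}$ has enough projectives if for each $C\in\mathcal{C}$ there is a distinguished $n$-exangle $B\to P_1\to\cdots\to P_n\to C\dashrightarrow$ with all $P_i\in\mathcal{P}$; enough injectives is dual. **$\Omega$ and $\Sigma$.** $\Omega\mathcal{A}$ is the class of objects $B\in\mathcal{C}$ for which there is a distinguished $n$-exangle $B\to P_1\to\cdots\to P_n\to A\dashrightarrow$ with $P_1,\dots,P_n\in\mathcal{P}$ and $A\in\mathcal{A}$. $\Sigma\mathcal{A}$ is the class of objects $C'\in\mathcal{C}$ for which there is a distinguished $n$-exangle $A\to I_1\to\cdots\to I_n\to C'\dashrightarrow$ with $I_1,\dots,I_n\in\mathcal{I}$ and $A\in\mathcal{A}$. **$n$-exact categories (Jasso).** In an additive category $\mathcal{A}$, an $n$-exact sequence is a complex $X_0\to X_1\to\cdots\to X_{n+1}$ such that $0\to\mathcal{A}(Z,X_0)\to\cdots\to\mathcal{A}(Z,X_{n+1})$ and $0\to\mathcal{A}(X_{n+1},Z)\to\cdots\to\mathcal{A}(X_0,Z)$ are exact for all $Z\in\mathcal{A}$. A chain map $f_\bullet$ between $n$-exact sequences is a weak isomorphism if $f_k$ and $f_{k+1}$ are isomorphisms for some $k\in\{0,\dots,n+1\}$, where $f_{n+2}:=f_0$. An $n$-pushout of $X_0\to X_1\to\cdots\to X_n$ along $f_0:X_0\to Y_0$ is a complex $Y_0\to\cdots\to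 Y_n$ with a chain map $(f_0,\dots,f_n)$ such that the mapping cone $X_0\to X_1\oplus Y_0\to\cdots\to X_n\oplus Y_{n-1}\to Y_n$ (differentials as in the mapping cocone above) satisfies: $0\to\mathcal{A}(Y_n,Z)\to\mathcal{A}(X_n\oplus Y_{n-1},Z)\to\cdots\to\mathcal{A}(X_1\oplus Y_0,Z)\to\mathcal{A}(X_0,Z)$ is exact for all $Z$. $n$-pullbacks are dual. An $n$-exact category is a pair $(\mathcal{A},\mathcal{X})$ where $\mathcal{X}$ is a class of $n$-exact sequences in $\mathcal{A}$, closed under weak isomorphisms, such that (calling members of $\mathcal{X}$ admissible, their first morphisms admissible monomorphisms and their last morphisms admissible epimorphisms): (E0) $0\to0\to\cdots\to0$ is admissible; (E1) admissible monomorphisms are closed under composition; (E1$^{\mathrm{op}}$) admissible epimorphisms are closed under composition; (E2) for each admissible $X_0\to\cdots\to X_{n+1}$ and each $f:X_0\to Y_0$ there is an $n$-pushout $Y_0\to\cdots\to Y_n$ of $X_0\to\cdots\to X_n$ along $f$ with $Y_0\to Y_1$ an admissible monomorphism; (E2$^{\mathrm{op}}$) the dual of (E2). *)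

theory Defs
  imports "HOL-Algebra.Ideal" "HOL-Algebra.Coset"
begin

section \<open>Additive categories\<close>

text \<open>
  Abelian groups are HOL-Algebra commutative groups, so the group operation
  of \<open>Mor C A B\<close> (and of \<open>Ext E K A\<close> below), which is thought of
  additively, is the \<open>mult\<close> of a monoid record, and its zero is \<open>one\<close>.
  Hom sets for different pairs of objects need not be disjoint: a morphism is always used
  together with a source and a target.
\<close>

record ('o, 'm) cat =
  Ob :: "'o set"
  Mor :: "'o \<Rightarrow> 'o \<Rightarrow> 'm monoid"
  idt :: "'o \<Rightarrow> 'm"
  cmp :: "'m \<Rightarrow> 'm \<Rightarrow> 'm"  (infixl "\<bullet>\<index>" 70)

abbreviation arr :: "('o, 'm) cat \<Rightarrow> 'o \<Rightarrow> 'o \<Rightarrow> 'm set" where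
  "arr C A B \<equiv> carrier (Mor C A B)"

abbreviation addm :: "('o, 'm) cat \<Rightarrow> 'o \<Rightarrow> 'o \<Rightarrow> 'm \<Rightarrow> 'm \<Rightarrow> 'm" where
  "addm C A B f g \<equiv> f \<otimes>\<^bsub>Mor C A B\<^esub> g"

abbreviation zerom :: "('o, 'm) cat \<Rightarrow> 'o \<Rightarrow> 'o \<Rightarrow> 'm" where
  "zerom C A B \<equiv> \<one>\<^bsub>Mor C A B\<^esub>"

abbreviation negm :: "('o, 'm) cat \<Rightarrow> 'o \<Rightarrow> 'o \<Rightarrow> 'm \<Rightarrow> 'm" where
  "negm C A B f \<equiv> inv\<^bsub>Mor C A B\<^esub> f"

locale preadditive_category =
  fixes C :: "('o, 'm) cat"
  assumes id_arr: "A \<in> Ob C \<Longrightarrow> idt C A \<in> arr C A A"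
    and cmp_arr: "\<lbrakk>A \<in> Ob C; B \<in> Ob C; D \<in> Ob C; f \<in> arr C A B; g \<in> arr C B D\<rbrakk>
      \<Longrightarrow> g \<bullet>\<^bsub>C\<^esub> f \<in> arr C A D"
    and cmp_assoc: "\<lbrakk>A \<in> Ob C; B \<in> Ob C; D \<in> Ob C; F \<in> Ob C;
        f \<in> arr C A B; g \<in> arr C B D; h \<in> arr C D F\<rbrakk>
      \<Longrightarrow> h \<bullet>\<^bsub>C\<^esub> g \<bullet>\<^bsub>C\<^esub> f = h \<bullet>\<^bsub>C\<^esub> (g \<bullet>\<^bsub>C\<^esub> f)"
    and id_left: "\<lbrakk>A \<in> Ob C; B \<in> Ob C; f \<in> arr C A B\<rbrakk> \<Longrightarrow> idt C B \<bullet>\<^bsub>C\<^esub> f = f"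
    and id_right: "\<lbrakk>A \<in> Ob C; B \<in> Ob C; f \<in> arr C A B\<rbrakk> \<Longrightarrow> f \<bullet>\<^bsub>C\<^esub> idt C A = f"
    and Mor_group: "\<lbrakk>A \<in> Ob C; B \<in> Ob C\<rbrakk> \<Longrightarrow> comm_group (Mor C A B)"
    and cmp_add_left: "\<lbrakk>A \<in> Ob C; B \<in> Ob C; D \<in> Ob C; f \<in> arr C A B; g \<in> arr C B D; g' \<in> arr C B D\<rbrakk>
      \<Longrightarrow> addm C B D g g' \<bullet>\<^bsub>C\<^esub> f = addm C A D (g \<bullet>\<^bsub>C\<^esub> f) (g' \<bullet>\<^bsub>C\<^esub> f)"
    and cmp_add_right: "\<lbrakk>A \<in> Ob C; B \<in> Ob C; D \<in> Ob C; f \<in> arr C A B; f' \<in> arr C A B; g \<in> arr C B D\<rbrakk>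
      \<Longrightarrow> g \<bullet>\<^bsub>C\<^esub> addm C A B f f' = addm C A D (g \<bullet>\<^bsub>C\<^esub> f) (g \<bullet>\<^bsub>C\<^esub> f')"

definition zero_object :: "('o, 'm) cat \<Rightarrow> 'o \<Rightarrow> bool" where
  "zero_object C Z \<longleftrightarrow> Z \<in> Ob C \<and>
     (\<forall>X\<in>Ob C. (\<exists>!f. f \<in> arr C X Z) \<and> (\<exists>!f. f \<in> arr C Z X))"

definition is_iso :: "('o, 'm) cat \<Rightarrow> 'o \<Rightarrow> 'o \<Rightarrow> 'm \<Rightarrow> bool" where
  "is_iso C A B f \<longleftrightarrow> f \<in> arr C A B \<and>
     (\<exists>g\<in>arr C B A. g \<bullet>\<^bsub>C\<^esub> f = idt C A \<and> f \<bullet>\<^bsub>C\<^esub> g = idt C B)"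

record ('o, 'm) biproduct =
  sumob :: 'o
  in1 :: 'm
  in2 :: 'm
  pr1 :: 'm
  pr2 :: 'm

definition is_biproduct :: "('o, 'm) cat \<Rightarrow> 'o \<Rightarrow> 'o \<Rightarrow> ('o, 'm) biproduct \<Rightarrow> bool" where
  "is_biproduct C A B S \<longleftrightarrow>
     sumob S \<in> Ob C \<and>
     in1 S \<in> arr C A (sumob S) \<and> in2 S \<in> arr C B (sumob S) \<and>
     pr1 S \<in> arr C (sumob S) A \<and> pr2 S \<in> arr C (sumob S) B \<and>
     pr1 S \<bullet>\<^bsub>C\<^esub> in1 S = idt C A \<and> pr2 S \<bullet>\<^bsub>C\<^esub> in2 S = idt C B \<and>
     pr1 S \<bullet>\<^bsub>C\<^esub> in2 S = zerom C B A \<and> pr2 S \<bullet>\<^bsub>C\<^esub> in1 S = zerom C A B \<and>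
     addm C (sumob S) (sumob S) (in1 S \<bullet>\<^bsub>C\<^esub> pr1 S) (in2 S \<bullet>\<^bsub>C\<^esub> pr2 S) = idt C (sumob S)"

locale additive_category = preadditive_category C
  for C :: "('o, 'm) cat" +
  assumes ex_zero_object: "\<exists>Z. zero_object C Z"
    and ex_biproduct: "\<lbrakk>A \<in> Ob C; B \<in> Ob C\<rbrakk> \<Longrightarrow> \<exists>S. is_biproduct C A B S"

text \<open>A chosen direct sum of two objects, and morphisms into, out of and between
  chosen direct sums given by matrices.\<close>

definition bip :: "('o, 'm) cat \<Rightarrow> 'o \<Rightarrow> 'o \<Rightarrow> ('o, 'm) biproduct" where
  "bip C A B = (SOME S. is_biproduct C A B S)"

definition dsum :: "('o, 'm) cat \<Rightarrow> 'o \<Rightarrow> 'o \<Rightarrow> 'o" where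
  "dsum C A B = sumob (bip C A B)"

text \<open>The column with entries \<open>a : D \<rightarrow> A\<close> and \<open>b : D \<rightarrow> B\<close>.\<close>
definition colm :: "('o, 'm) cat \<Rightarrow> 'o \<Rightarrow> 'o \<Rightarrow> 'o \<Rightarrow> 'm \<Rightarrow> 'm \<Rightarrow> 'm" where
  "colm C D A B a b =
     addm C D (dsum C A B) (in1 (bip C A B) \<bullet>\<^bsub>C\<^esub> a) (in2 (bip C A B) \<bullet>\<^bsub>C\<^esub> b)"

text \<open>The row with entries \<open>a : A \<rightarrow> D\<close> and \<open>b : B \<rightarrow> D\<close>.\<close>
definition rowm :: "('o, 'm) cat \<Rightarrow> 'o \<Rightarrow> 'o \<Rightarrow> 'o \<Rightarrow> 'm \<Rightarrow> 'm \<Rightarrow> 'm" where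
  "rowm C A B D a b =
     addm C (dsum C A B) D (a \<bullet>\<^bsub>C\<^esub> pr1 (bip C A B)) (b \<bullet>\<^bsub>C\<^esub> pr2 (bip C A B))"

text \<open>The matrix with first row \<open>a : A \<rightarrow> A'\<close>, \<open>b : B \<rightarrow> A'\<close> and second row
  \<open>c : A \<rightarrow> B'\<close>, \<open>d : B \<rightarrow> B'\<close>.\<close>
definition matm :: "('o, 'm) cat \<Rightarrow> 'o \<Rightarrow> 'o \<Rightarrow> 'o \<Rightarrow> 'o \<Rightarrow> 'm \<Rightarrow> 'm \<Rightarrow> 'm \<Rightarrow> 'm \<Rightarrow> 'm" where
  "matm C A B A' B' a b c d =
     colm C (dsum C A B) A' B' (rowm C A B A' a b) (rowm C A B B' c d)"

definition End_ring :: "('o, 'm) cat \<Rightarrow> 'o \<Rightarrow> 'm ring" where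
  "End_ring C A = \<lparr>carrier = arr C A A, mult = cmp C, one = idt C A,
     zero = zerom C A A, add = addm C A A\<rparr>"

text \<open>Local rings, not necessarily commutative: the non-units form a two-sided ideal.
  This forces \<open>1 \<noteq> 0\<close>, since an ideal contains zero.\<close>
definition local_ring :: "'a ring \<Rightarrow> bool" where
  "local_ring R \<longleftrightarrow> ring R \<and> ideal (carrier R - Units R) R"

text \<open>\<open>X\<close> is a direct sum of \<open>B 0, \<dots>, B (k - 1)\<close>; for \<open>k = 0\<close>
  this says that \<open>X\<close> is a zero object.\<close>
definition is_direct_sum :: "('o, 'm) cat \<Rightarrow> nat \<Rightarrow> (nat \<Rightarrow> 'o) \<Rightarrow> 'o \<Rightarrow> bool" where
  "is_direct_sum C k B X \<longleftrightarrow> X \<in> Ob C \<and> (\<forall>j<k. B j \<in> Ob C) \<and>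
     (\<exists>i p. (\<forall>j<k. i j \<in> arr C (B j) X \<and> p j \<in> arr C X (B j)) \<and>
        (\<forall>j<k. \<forall>l<k. p l \<bullet>\<^bsub>C\<^esub> i j = (if l = j then idt C (B j) else zerom C (B j) (B l))) \<and>
        (\<Otimes>\<^bsub>Mor C X X\<^esub>j\<in>{..<k}. i j \<bullet>\<^bsub>C\<^esub> p j) = idt C X)"

definition krull_schmidt :: "('o, 'm) cat \<Rightarrow> bool" where
  "krull_schmidt C \<longleftrightarrow> additive_category C \<and>
     (\<forall>X\<in>Ob C. \<exists>k B. is_direct_sum C k B X \<and> (\<forall>j<k. local_ring (End_ring C (B j))))"

definition full_sub :: "('o, 'm) cat \<Rightarrow> 'o set \<Rightarrow> ('o, 'm) cat" where
  "full_sub C S = C\<lparr>Ob := S\<rparr>"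

text \<open>Full subcategories are given by their objects. Closure under finite direct sums
  includes the empty one.\<close>
definition subcategory :: "('o, 'm) cat \<Rightarrow> 'o set \<Rightarrow> bool" where
  "subcategory C S \<longleftrightarrow> S \<subseteq> Ob C \<and>
     (\<forall>A\<in>S. \<forall>B\<in>Ob C. (\<exists>f. is_iso C A B f) \<longrightarrow> B \<in> S) \<and>
     (\<forall>Z. zero_object C Z \<longrightarrow> Z \<in> S) \<and>
     (\<forall>A\<in>S. \<forall>B\<in>S. \<forall>D. is_biproduct C A B D \<longrightarrow> sumob D \<in> S) \<and>
     (\<forall>A\<in>Ob C. \<forall>B\<in>Ob C. \<forall>D. is_biproduct C A B D \<and> sumob D \<in> S \<longrightarrow> A \<in> S \<and> B \<in> S)"

section \<open>Complexes\<close>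

text \<open>
  A complex concentrated in degrees \<open>a, \<dots>, b\<close> is stored as functions on all of
  \<open>nat\<close>, but nothing below depends on \<open>obj X i\<close> for \<open>i\<close> outside
  \<open>{a..b}\<close> or on \<open>diff X i\<close> for \<open>i\<close> outside \<open>{a..<b}\<close>.
\<close>

record ('o, 'm) cpx =
  obj :: "nat \<Rightarrow> 'o"
  diff :: "nat \<Rightarrow> 'm"

definition complex_on :: "('o, 'm) cat \<Rightarrow> nat \<Rightarrow> nat \<Rightarrow> ('o, 'm) cpx \<Rightarrow> bool" where
  "complex_on C a b X \<longleftrightarrow>
     (\<forall>i\<in>{a..b}. obj X i \<in> Ob C) \<and>
     (\<forall>i\<in>{a..<b}. diff X i \<in> arr C (obj X i) (obj X (Suc i))) \<and>
     (\<forall>i. a \<le> i \<and> Suc i < b \<longrightarrow>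
        diff X (Suc i) \<bullet>\<^bsub>C\<^esub> diff X i = zerom C (obj X i) (obj X (Suc (Suc i))))"

definition chain_map_on ::
  "('o, 'm) cat \<Rightarrow> nat \<Rightarrow> nat \<Rightarrow> ('o, 'm) cpx \<Rightarrow> ('o, 'm) cpx \<Rightarrow> (nat \<Rightarrow> 'm) \<Rightarrow> bool" where
  "chain_map_on C a b X Y f \<longleftrightarrow>
     (\<forall>i\<in>{a..b}. f i \<in> arr C (obj X i) (obj Y i)) \<and>
     (\<forall>i\<in>{a..<b}. f (Suc i) \<bullet>\<^bsub>C\<^esub> diff X i = diff Y i \<bullet>\<^bsub>C\<^esub> f i)"

text \<open>Chain homotopy in degrees \<open>0, \<dots>, n + 1\<close>; here \<open>h i\<close> is the component
  \<open>X\<^sub>i\<^sub>+\<^sub>1 \<rightarrow> Y\<^sub>i\<close>.\<close>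
definition homotopic ::
  "('o, 'm) cat \<Rightarrow> nat \<Rightarrow> ('o, 'm) cpx \<Rightarrow> ('o, 'm) cpx \<Rightarrow> (nat \<Rightarrow> 'm) \<Rightarrow> (nat \<Rightarrow> 'm) \<Rightarrow> bool" where
  "homotopic C n X Y f g \<longleftrightarrow>
     (\<exists>h. (\<forall>i\<le>n. h i \<in> arr C (obj X (Suc i)) (obj Y i)) \<and>
        f 0 = addm C (obj X 0) (obj Y 0) (g 0) (h 0 \<bullet>\<^bsub>C\<^esub> diff X 0) \<and>
        (\<forall>i<n. f (Suc i) = addm C (obj X (Suc i)) (obj Y (Suc i)) (g (Suc i))
           (addm C (obj X (Suc i)) (obj Y (Suc i))
              (diff Y i \<bullet>\<^bsub>C\<^esub> h i) (h (Suc i) \<bullet>\<^bsub>C\<^esub> diff X (Suc i)))) \<and>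
        f (Suc n) = addm C (obj X (Suc n)) (obj Y (Suc n)) (g (Suc n)) (diff Y n \<bullet>\<^bsub>C\<^esub> h n))"

text \<open>Morphisms in the category of complexes with fixed end terms.\<close>
definition end_fixing_map ::
  "('o, 'm) cat \<Rightarrow> nat \<Rightarrow> ('o, 'm) cpx \<Rightarrow> ('o, 'm) cpx \<Rightarrow> (nat \<Rightarrow> 'm) \<Rightarrow> bool" where
  "end_fixing_map C n X Y f \<longleftrightarrow> chain_map_on C 0 (Suc n) X Y f \<and>
     obj X 0 = obj Y 0 \<and> obj X (Suc n) = obj Y (Suc n) \<and>
     f 0 = idt C (obj X 0) \<and> f (Suc n) = idt C (obj X (Suc n))"

definition hequiv :: "('o, 'm) cat \<Rightarrow> nat \<Rightarrow> ('o, 'm) cpx \<Rightarrow> ('o, 'm) cpx \<Rightarrow> bool" where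
  "hequiv C n X Y \<longleftrightarrow>
     (\<exists>f g. end_fixing_map C n X Y f \<and> end_fixing_map C n Y X g \<and>
        homotopic C n X X (\<lambda>i. g i \<bullet>\<^bsub>C\<^esub> f i) (\<lambda>i. idt C (obj X i)) \<and>
        homotopic C n Y Y (\<lambda>i. f i \<bullet>\<^bsub>C\<^esub> g i) (\<lambda>i. idt C (obj Y i)))"

definition hclass :: "('o, 'm) cat \<Rightarrow> nat \<Rightarrow> ('o, 'm) cpx \<Rightarrow> ('o, 'm) cpx set" where
  "hclass C n X = {Y. complex_on C 0 (Suc n) Y \<and> hequiv C n X Y}"

text \<open>Exactness at \<open>X\<^sub>i\<^sub>+\<^sub>1\<close> of the sequences obtained by applying
  \<open>\<C>(T,-)\<close> and \<open>\<C>(-,T)\<close>.\<close>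

definition cov_exact_at :: "('o, 'm) cat \<Rightarrow> ('o, 'm) cpx \<Rightarrow> 'o \<Rightarrow> nat \<Rightarrow> bool" where
  "cov_exact_at C X T i \<longleftrightarrow>
     (\<lambda>f. diff X i \<bullet>\<^bsub>C\<^esub> f) ` arr C T (obj X i) =
     kernel (Mor C T (obj X (Suc i))) (Mor C T (obj X (Suc (Suc i))))
       (\<lambda>f. diff X (Suc i) \<bullet>\<^bsub>C\<^esub> f)"

definition con_exact_at :: "('o, 'm) cat \<Rightarrow> ('o, 'm) cpx \<Rightarrow> 'o \<Rightarrow> nat \<Rightarrow> bool" where
  "con_exact_at C X T i \<longleftrightarrow>
     (\<lambda>g. g \<bullet>\<^bsub>C\<^esub> diff X (Suc i)) ` arr C (obj X (Suc (Suc i))) T =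
     kernel (Mor C (obj X (Suc i)) T) (Mor C (obj X i) T) (\<lambda>g. g \<bullet>\<^bsub>C\<^esub> diff X i)"

definition mapping_cone ::
  "('o, 'm) cat \<Rightarrow> nat \<Rightarrow> ('o, 'm) cpx \<Rightarrow> ('o, 'm) cpx \<Rightarrow> (nat \<Rightarrow> 'm) \<Rightarrow> ('o, 'm) cpx" where
  "mapping_cone C n X Y f = \<lparr>
     obj = (\<lambda>i. if i = 0 then obj X 1
                else if i \<le> n then dsum C (obj X (i + 1)) (obj Y i)
                else obj Y (n + 1)),
     diff = (\<lambda>i. if i = 0 then
                   colm C (obj X 1) (obj X 2) (obj Y 1)
                     (negm C (obj X 1) (obj X 2) (diff X 1)) (f 1)
                 else if i < n then
                   matm C (obj X (i + 1)) (obj Y i) (obj X (i + 2)) (obj Y (i + 1))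
                     (negm C (obj X (i + 1)) (obj X (i + 2)) (diff X (i + 1)))
                     (zerom C (obj Y i) (obj X (i + 2)))
                     (f (i + 1)) (diff Y i)
                 else
                   rowm C (obj X (n + 1)) (obj Y n) (obj Y (n + 1)) (f (n + 1)) (diff Y n))\<rparr>"

definition mapping_cocone ::
  "('o, 'm) cat \<Rightarrow> nat \<Rightarrow> ('o, 'm) cpx \<Rightarrow> ('o, 'm) cpx \<Rightarrow> (nat \<Rightarrow> 'm) \<Rightarrow> ('o, 'm) cpx" where
  "mapping_cocone C n X Y f = \<lparr>
     obj = (\<lambda>i. if i = 0 then obj X 0
                else if i \<le> n then dsum C (obj X i) (obj Y (i - 1))
                else obj Y n),
     diff = (\<lambda>i. if i = 0 then
                   colm C (obj X 0) (obj X 1) (obj Y 0)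
                     (negm C (obj X 0) (obj X 1) (diff X 0)) (f 0)
                 else if i < n then
                   matm C (obj X i) (obj Y (i - 1)) (obj X (i + 1)) (obj Y i)
                     (negm C (obj X i) (obj X (i + 1)) (diff X i))
                     (zerom C (obj Y (i - 1)) (obj X (i + 1)))
                     (f i) (diff Y (i - 1))
                 else
                   rowm C (obj X n) (obj Y (n - 1)) (obj Y n) (f n) (diff Y (n - 1)))\<rparr>"

section \<open>\<open>n\<close>-exangulated categories\<close>

text \<open>\<open>Ext E K A\<close> is the group \<open>\<E>(K, A)\<close>, \<open>push E a\<close> is
  \<open>a\<^sub>*\<close> and \<open>pull E c\<close> is \<open>c\<^sup>*\<close>.\<close>

record ('o, 'm, 'e) bifunctor =
  Ext :: "'o \<Rightarrow> 'o \<Rightarrow> 'e monoid"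
  push :: "'m \<Rightarrow> 'e \<Rightarrow> 'e"
  pull :: "'m \<Rightarrow> 'e \<Rightarrow> 'e"

locale additive_bifunctor =
  fixes C :: "('o, 'm) cat" and E :: "('o, 'm, 'e) bifunctor"
  assumes Ext_group: "\<lbrakk>K \<in> Ob C; A \<in> Ob C\<rbrakk> \<Longrightarrow> comm_group (Ext E K A)"
    and push_hom: "\<lbrakk>K \<in> Ob C; A \<in> Ob C; A' \<in> Ob C; a \<in> arr C A A'\<rbrakk>
      \<Longrightarrow> push E a \<in> hom (Ext E K A) (Ext E K A')"
    and pull_hom: "\<lbrakk>K \<in> Ob C; K' \<in> Ob C; A \<in> Ob C; c \<in> arr C K' K\<rbrakk>
      \<Longrightarrow> pull E c \<in> hom (Ext E K A) (Ext E K' A)"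
    and push_id: "\<lbrakk>K \<in> Ob C; A \<in> Ob C; \<delta> \<in> carrier (Ext E K A)\<rbrakk> \<Longrightarrow> push E (idt C A) \<delta> = \<delta>"
    and pull_id: "\<lbrakk>K \<in> Ob C; A \<in> Ob C; \<delta> \<in> carrier (Ext E K A)\<rbrakk> \<Longrightarrow> pull E (idt C K) \<delta> = \<delta>"
    and push_cmp: "\<lbrakk>K \<in> Ob C; A \<in> Ob C; A' \<in> Ob C; A'' \<in> Ob C;
        a \<in> arr C A A'; a' \<in> arr C A' A''; \<delta> \<in> carrier (Ext E K A)\<rbrakk>
      \<Longrightarrow> push E (a' \<bullet>\<^bsub>C\<^esub> a) \<delta> = push E a' (push E a \<delta>)"
    and pull_cmp: "\<lbrakk>K \<in> Ob C; K' \<in> Ob C; K'' \<in> Ob C; A \<in> Ob C;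
        c \<in> arr C K' K; c' \<in> arr C K'' K'; \<delta> \<in> carrier (Ext E K A)\<rbrakk>
      \<Longrightarrow> pull E (c \<bullet>\<^bsub>C\<^esub> c') \<delta> = pull E c' (pull E c \<delta>)"
    and push_pull: "\<lbrakk>K \<in> Ob C; K' \<in> Ob C; A \<in> Ob C; A' \<in> Ob C;
        a \<in> arr C A A'; c \<in> arr C K' K; \<delta> \<in> carrier (Ext E K A)\<rbrakk>
      \<Longrightarrow> push E a (pull E c \<delta>) = pull E c (push E a \<delta>)"
    and push_add: "\<lbrakk>K \<in> Ob C; A \<in> Ob C; A' \<in> Ob C;
        a \<in> arr C A A'; b \<in> arr C A A'; \<delta> \<in> carrier (Ext E K A)\<rbrakk>
      \<Longrightarrow> push E (addm C A A' a b) \<delta> = push E a \<delta> \<otimes>\<^bsub>Ext E K A'\<^esub> push E b \<delta>"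
    and pull_add: "\<lbrakk>K \<in> Ob C; K' \<in> Ob C; A \<in> Ob C;
        c \<in> arr C K' K; d \<in> arr C K' K; \<delta> \<in> carrier (Ext E K A)\<rbrakk>
      \<Longrightarrow> pull E (addm C K' K c d) \<delta> = pull E c \<delta> \<otimes>\<^bsub>Ext E K' A\<^esub> pull E d \<delta>"

definition n_exangle ::
  "('o, 'm) cat \<Rightarrow> ('o, 'm, 'e) bifunctor \<Rightarrow> nat \<Rightarrow> ('o, 'm) cpx \<Rightarrow> 'e \<Rightarrow> bool" where
  "n_exangle C E n X \<delta> \<longleftrightarrow>
     complex_on C 0 (Suc n) X \<and>
     \<delta> \<in> carrier (Ext E (obj X (Suc n)) (obj X 0)) \<and>
     (\<forall>T\<in>Ob C.
        (\<forall>i<n. cov_exact_at C X T i) \<and>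
        (\<lambda>f. diff X n \<bullet>\<^bsub>C\<^esub> f) ` arr C T (obj X n) =
          kernel (Mor C T (obj X (Suc n))) (Ext E T (obj X 0)) (\<lambda>f. pull E f \<delta>)) \<and>
     (\<forall>T\<in>Ob C.
        (\<forall>i<n. con_exact_at C X T i) \<and>
        (\<lambda>g. g \<bullet>\<^bsub>C\<^esub> diff X 0) ` arr C (obj X 1) T =
          kernel (Mor C (obj X 0) T) (Ext E (obj X (Suc n)) T) (\<lambda>g. push E g \<delta>))"

text \<open>\<open>s K A \<delta>\<close> is the homotopy class \<open>\<s>(\<delta>)\<close> for \<open>\<delta> \<in> \<E>(K, A)\<close>.\<close>

type_synonym ('o, 'm, 'e) realization = "'o \<Rightarrow> 'o \<Rightarrow> 'e \<Rightarrow> ('o, 'm) cpx set"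

text \<open>\<open>X\<close> is a complex, \<open>\<delta>\<close> is an extension between its end terms and
  \<open>\<s>(\<delta>) = [X]\<close>.\<close>
definition distinguished ::
  "('o, 'm) cat \<Rightarrow> ('o, 'm, 'e) bifunctor \<Rightarrow> nat \<Rightarrow> ('o, 'm, 'e) realization
     \<Rightarrow> ('o, 'm) cpx \<Rightarrow> 'e \<Rightarrow> bool" where
  "distinguished C E n s X \<delta> \<longleftrightarrow>
     complex_on C 0 (Suc n) X \<and>
     \<delta> \<in> carrier (Ext E (obj X (Suc n)) (obj X 0)) \<and>
     s (obj X (Suc n)) (obj X 0) \<delta> = hclass C n X"

definition left_id_cpx :: "('o, 'm) cat \<Rightarrow> 'o \<Rightarrow> 'o \<Rightarrow> ('o, 'm) cpx" where
  "left_id_cpx C A Z = (let ob = (\<lambda>i. if i \<le> 1 then A else Z) in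
     \<lparr>obj = ob, diff = (\<lambda>i. if i = 0 then idt C A else zerom C (ob i) (ob (Suc i)))\<rparr>)"

definition right_id_cpx :: "('o, 'm) cat \<Rightarrow> nat \<Rightarrow> 'o \<Rightarrow> 'o \<Rightarrow> ('o, 'm) cpx" where
  "right_id_cpx C n A Z = (let ob = (\<lambda>i. if i < n then Z else A) in
     \<lparr>obj = ob, diff = (\<lambda>i. if i = n then idt C A else zerom C (ob i) (ob (Suc i)))\<rparr>)"

locale exact_realization =
  fixes C :: "('o, 'm) cat" and E :: "('o, 'm, 'e) bifunctor" and n :: nat
    and s :: "('o, 'm, 'e) realization"
  assumes is_class: "\<lbrakk>K \<in> Ob C; A \<in> Ob C; \<delta> \<in> carrier (Ext E K A)\<rbrakk>
      \<Longrightarrow> \<exists>X. obj X 0 = A \<and> obj X (Suc n) = K \<and> distinguished C E n s X \<delta>"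
    and R0: "\<lbrakk>distinguished C E n s X \<delta>; distinguished C E n s Y \<rho>;
        a \<in> arr C (obj X 0) (obj Y 0); c \<in> arr C (obj X (Suc n)) (obj Y (Suc n));
        push E a \<delta> = pull E c \<rho>\<rbrakk>
      \<Longrightarrow> \<exists>f. chain_map_on C 0 (Suc n) X Y f \<and> f 0 = a \<and> f (Suc n) = c"
    and R1: "distinguished C E n s X \<delta> \<Longrightarrow> n_exangle C E n X \<delta>"
    and R2_left: "\<lbrakk>zero_object C Z; A \<in> Ob C\<rbrakk>
      \<Longrightarrow> distinguished C E n s (left_id_cpx C A Z) \<one>\<^bsub>Ext E Z A\<^esub>"
    and R2_right: "\<lbrakk>zero_object C Z; A \<in> Ob C\<rbrakk>
      \<Longrightarrow> distinguished C E n s (right_id_cpx C n A Z) \<one>\<^bsub>Ext E A Z\<^esub>"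

definition conflations ::
  "('o, 'm) cat \<Rightarrow> ('o, 'm, 'e) bifunctor \<Rightarrow> nat \<Rightarrow> ('o, 'm, 'e) realization \<Rightarrow> ('o, 'm) cpx set" where
  "conflations C E n s = {X. \<exists>\<delta>. distinguished C E n s X \<delta>}"

text \<open>For a class of complexes: \<open>f : A \<rightarrow> B\<close> is the first, respectively last, morphism
  of one of them.\<close>

definition first_mor :: "('o, 'm) cpx set \<Rightarrow> 'o \<Rightarrow> 'o \<Rightarrow> 'm \<Rightarrow> bool" where
  "first_mor \<X> A B f \<longleftrightarrow> (\<exists>X\<in>\<X>. obj X 0 = A \<and> obj X 1 = B \<and> diff X 0 = f)"

definition last_mor :: "nat \<Rightarrow> ('o, 'm) cpx set \<Rightarrow> 'o \<Rightarrow> 'o \<Rightarrow> 'm \<Rightarrow> bool" where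
  "last_mor n \<X> A B f \<longleftrightarrow> (\<exists>X\<in>\<X>. obj X n = A \<and> obj X (Suc n) = B \<and> diff X n = f)"

abbreviation "inflation C E n s \<equiv> first_mor (conflations C E n s)"
abbreviation "deflation C E n s \<equiv> last_mor n (conflations C E n s)"

locale n_exangulated_category =
  additive_category C + additive_bifunctor C E + exact_realization C E n s
  for C :: "('o, 'm) cat" and E :: "('o, 'm, 'e) bifunctor" and n :: nat
    and s :: "('o, 'm, 'e) realization" +
  assumes EA1_inflation: "\<lbrakk>inflation C E n s A B u; inflation C E n s B D v\<rbrakk>
      \<Longrightarrow> inflation C E n s A D (v \<bullet>\<^bsub>C\<^esub> u)"
    and EA1_deflation: "\<lbrakk>deflation C E n s A B u; deflation C E n s B D v\<rbrakk>
      \<Longrightarrow> deflation C E n s A D (v \<bullet>\<^bsub>C\<^esub> u)"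
    and EA2: "\<lbrakk>distinguished C E n s Y \<rho>; c \<in> arr C (obj X (Suc n)) (obj Y (Suc n));
        obj X 0 = obj Y 0; distinguished C E n s X (pull E c \<rho>)\<rbrakk>
      \<Longrightarrow> \<exists>f. chain_map_on C 0 (Suc n) X Y f \<and> f 0 = idt C (obj X 0) \<and> f (Suc n) = c \<and>
            distinguished C E n s (mapping_cone C n X Y f) (push E (diff X 0) \<rho>)"
    and EA2_op: "\<lbrakk>distinguished C E n s X \<rho>; a \<in> arr C (obj X 0) (obj Y 0);
        obj Y (Suc n) = obj X (Suc n); distinguished C E n s Y (push E a \<rho>)\<rbrakk>
      \<Longrightarrow> \<exists>f. chain_map_on C 0 (Suc n) X Y f \<and> f 0 = a \<and> f (Suc n) = idt C (obj X (Suc n)) \<and>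
            distinguished C E n s (mapping_cocone C n X Y f) (pull E (diff Y n) \<rho>)"

definition n_extension_closed ::
  "('o, 'm) cat \<Rightarrow> ('o, 'm, 'e) bifunctor \<Rightarrow> nat \<Rightarrow> ('o, 'm, 'e) realization \<Rightarrow> 'o set \<Rightarrow> bool" where
  "n_extension_closed C E n s S \<longleftrightarrow>
     (\<forall>A\<in>S. \<forall>K\<in>S. \<forall>\<delta>\<in>carrier (Ext E K A).
        \<exists>X. distinguished C E n s X \<delta> \<and> obj X 0 = A \<and> obj X (Suc n) = K \<and>
            (\<forall>i\<in>{1..n}. obj X i \<in> S))"

text \<open>The realization \<open>\<t>\<close> on an \<open>n\<close>-extension closed subcategory; its value
  does not depend on the choice of \<open>X\<close>.\<close>
definition sub_realization ::
  "('o, 'm) cat \<Rightarrow> ('o, 'm, 'e) bifunctor \<Rightarrow> nat \<Rightarrow> ('o, 'm, 'e) realization \<Rightarrow> 'o set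
     \<Rightarrow> ('o, 'm, 'e) realization" where
  "sub_realization C E n s S K A \<delta> =
     hclass (full_sub C S) n
       (SOME X. distinguished C E n s X \<delta> \<and> obj X 0 = A \<and> obj X (Suc n) = K \<and>
                (\<forall>i\<in>{1..n}. obj X i \<in> S))"

definition sub_conflations ::
  "('o, 'm) cat \<Rightarrow> ('o, 'm, 'e) bifunctor \<Rightarrow> nat \<Rightarrow> ('o, 'm, 'e) realization \<Rightarrow> 'o set
     \<Rightarrow> ('o, 'm) cpx set" where
  "sub_conflations C E n s S = conflations (full_sub C S) E n (sub_realization C E n s S)"

definition projectives ::
  "('o, 'm) cat \<Rightarrow> ('o, 'm, 'e) bifunctor \<Rightarrow> nat \<Rightarrow> ('o, 'm, 'e) realization \<Rightarrow> 'o set" where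
  "projectives C E n s = {P\<in>Ob C. \<forall>X \<delta>. distinguished C E n s X \<delta> \<longrightarrow>
     (\<forall>c\<in>arr C P (obj X (Suc n)). \<exists>b\<in>arr C P (obj X n). diff X n \<bullet>\<^bsub>C\<^esub> b = c)}"

definition injectives ::
  "('o, 'm) cat \<Rightarrow> ('o, 'm, 'e) bifunctor \<Rightarrow> nat \<Rightarrow> ('o, 'm, 'e) realization \<Rightarrow> 'o set" where
  "injectives C E n s = {I\<in>Ob C. \<forall>X \<delta>. distinguished C E n s X \<delta> \<longrightarrow>
     (\<forall>a\<in>arr C (obj X 0) I. \<exists>b\<in>arr C (obj X 1) I. b \<bullet>\<^bsub>C\<^esub> diff X 0 = a)}"

definition enough_projectives ::
  "('o, 'm) cat \<Rightarrow> ('o, 'm, 'e) bifunctor \<Rightarrow> nat \<Rightarrow> ('o, 'm, 'e) realization \<Rightarrow> bool" where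
  "enough_projectives C E n s \<longleftrightarrow> (\<forall>K\<in>Ob C. \<exists>X \<delta>. distinguished C E n s X \<delta> \<and>
     obj X (Suc n) = K \<and> (\<forall>i\<in>{1..n}. obj X i \<in> projectives C E n s))"

definition enough_injectives ::
  "('o, 'm) cat \<Rightarrow> ('o, 'm, 'e) bifunctor \<Rightarrow> nat \<Rightarrow> ('o, 'm, 'e) realization \<Rightarrow> bool" where
  "enough_injectives C E n s \<longleftrightarrow> (\<forall>A\<in>Ob C. \<exists>X \<delta>. distinguished C E n s X \<delta> \<and>
     obj X 0 = A \<and> (\<forall>i\<in>{1..n}. obj X i \<in> injectives C E n s))"

definition Omega ::
  "('o, 'm) cat \<Rightarrow> ('o, 'm, 'e) bifunctor \<Rightarrow> nat \<Rightarrow> ('o, 'm, 'e) realization \<Rightarrow> 'o set \<Rightarrow> 'o set" where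
  "Omega C E n s S = {B. \<exists>X \<delta>. distinguished C E n s X \<delta> \<and> obj X 0 = B \<and>
     obj X (Suc n) \<in> S \<and> (\<forall>i\<in>{1..n}. obj X i \<in> projectives C E n s)}"

definition Sigma_class ::
  "('o, 'm) cat \<Rightarrow> ('o, 'm, 'e) bifunctor \<Rightarrow> nat \<Rightarrow> ('o, 'm, 'e) realization \<Rightarrow> 'o set \<Rightarrow> 'o set" where
  "Sigma_class C E n s S = {K. \<exists>X \<delta>. distinguished C E n s X \<delta> \<and> obj X (Suc n) = K \<and>
     obj X 0 \<in> S \<and> (\<forall>i\<in>{1..n}. obj X i \<in> injectives C E n s)}"

section \<open>\<open>n\<close>-exact categories\<close>

text \<open>Exactness of \<open>0 \<rightarrow> \<A>(T,X\<^sub>0) \<rightarrow> \<dots> \<rightarrow> \<A>(T,X\<^sub>n\<^sub>+\<^sub>1)\<close> and of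
  \<open>0 \<rightarrow> \<A>(X\<^sub>n\<^sub>+\<^sub>1,T) \<rightarrow> \<dots> \<rightarrow> \<A>(X\<^sub>0,T)\<close> for all \<open>T\<close>.\<close>

definition cov_left_exact :: "('o, 'm) cat \<Rightarrow> nat \<Rightarrow> ('o, 'm) cpx \<Rightarrow> bool" where
  "cov_left_exact C n X \<longleftrightarrow> (\<forall>T\<in>Ob C.
     kernel (Mor C T (obj X 0)) (Mor C T (obj X 1)) (\<lambda>f. diff X 0 \<bullet>\<^bsub>C\<^esub> f)
       = {zerom C T (obj X 0)} \<and>
     (\<forall>i<n. cov_exact_at C X T i))"

definition con_left_exact :: "('o, 'm) cat \<Rightarrow> nat \<Rightarrow> ('o, 'm) cpx \<Rightarrow> bool" where
  "con_left_exact C n X \<longleftrightarrow> (\<forall>T\<in>Ob C.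
     kernel (Mor C (obj X (Suc n)) T) (Mor C (obj X n) T) (\<lambda>g. g \<bullet>\<^bsub>C\<^esub> diff X n)
       = {zerom C (obj X (Suc n)) T} \<and>
     (\<forall>i<n. con_exact_at C X T i))"

definition n_exact_sequence :: "('o, 'm) cat \<Rightarrow> nat \<Rightarrow> ('o, 'm) cpx \<Rightarrow> bool" where
  "n_exact_sequence C n X \<longleftrightarrow>
     complex_on C 0 (Suc n) X \<and> cov_left_exact C n X \<and> con_left_exact C n X"

definition weak_isomorphism ::
  "('o, 'm) cat \<Rightarrow> nat \<Rightarrow> ('o, 'm) cpx \<Rightarrow> ('o, 'm) cpx \<Rightarrow> (nat \<Rightarrow> 'm) \<Rightarrow> bool" where
  "weak_isomorphism C n X Y f \<longleftrightarrow> chain_map_on C 0 (Suc n) X Y f \<and>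
     (\<exists>k\<le>Suc n. let l = (if k = Suc n then 0 else Suc k) in
        is_iso C (obj X k) (obj Y k) (f k) \<and> is_iso C (obj X l) (obj Y l) (f l))"

text \<open>\<open>Y\<close> in degrees \<open>0, \<dots>, n\<close> with the chain map \<open>f\<close> is an
  \<open>n\<close>-pushout of \<open>X\<close> in degrees \<open>0, \<dots>, n\<close> along \<open>f 0\<close>. The mapping
  cocone only involves these degrees.\<close>
definition n_pushout ::
  "('o, 'm) cat \<Rightarrow> nat \<Rightarrow> ('o, 'm) cpx \<Rightarrow> ('o, 'm) cpx \<Rightarrow> (nat \<Rightarrow> 'm) \<Rightarrow> bool" where
  "n_pushout C n X Y f \<longleftrightarrow> complex_on C 0 n Y \<and> chain_map_on C 0 n X Y f \<and>
     con_left_exact C n (mapping_cocone C n X Y f)"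

text \<open>\<open>X\<close> in degrees \<open>1, \<dots>, n + 1\<close> with the chain map \<open>f\<close> is an
  \<open>n\<close>-pullback of \<open>Y\<close> in degrees \<open>1, \<dots>, n + 1\<close> along \<open>f (n + 1)\<close>.\<close>
definition n_pullback ::
  "('o, 'm) cat \<Rightarrow> nat \<Rightarrow> ('o, 'm) cpx \<Rightarrow> ('o, 'm) cpx \<Rightarrow> (nat \<Rightarrow> 'm) \<Rightarrow> bool" where
  "n_pullback C n X Y f \<longleftrightarrow> complex_on C 1 (Suc n) X \<and> chain_map_on C 1 (Suc n) X Y f \<and>
     cov_left_exact C n (mapping_cone C n X Y f)"

definition zero_cpx :: "('o, 'm) cat \<Rightarrow> 'o \<Rightarrow> ('o, 'm) cpx" where
  "zero_cpx C Z = \<lparr>obj = (\<lambda>i. Z), diff = (\<lambda>i. zerom C Z Z)\<rparr>"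

text \<open>Closure under weak isomorphisms is required in both directions.\<close>
locale n_exact_category = additive_category C
  for C :: "('o, 'm) cat" and n :: nat and \<X> :: "('o, 'm) cpx set" +
  assumes n_exact: "X \<in> \<X> \<Longrightarrow> n_exact_sequence C n X"
    and weak_iso_closed: "\<lbrakk>n_exact_sequence C n X; n_exact_sequence C n Y; weak_isomorphism C n X Y f\<rbrakk>
      \<Longrightarrow> X \<in> \<X> \<longleftrightarrow> Y \<in> \<X>"
    and E0: "zero_object C Z \<Longrightarrow> zero_cpx C Z \<in> \<X>"
    and E1: "\<lbrakk>first_mor \<X> A B u; first_mor \<X> B D v\<rbrakk> \<Longrightarrow> first_mor \<X> A D (v \<bullet>\<^bsub>C\<^esub> u)"
    and E1_op: "\<lbrakk>last_mor n \<X> A B u; last_mor n \<X> B D v\<rbrakk> \<Longrightarrow> last_mor n \<X> A D (v \<bullet>\<^bsub>C\<^esub> u)"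
    and E2: "\<lbrakk>X \<in> \<X>; B \<in> Ob C; a \<in> arr C (obj X 0) B\<rbrakk>
      \<Longrightarrow> \<exists>Y f. obj Y 0 = B \<and> f 0 = a \<and> n_pushout C n X Y f \<and>
            first_mor \<X> (obj Y 0) (obj Y 1) (diff Y 0)"
    and E2_op: "\<lbrakk>Y \<in> \<X>; K \<in> Ob C; c \<in> arr C K (obj Y (Suc n))\<rbrakk>
      \<Longrightarrow> \<exists>X f. obj X (Suc n) = K \<and> f (Suc n) = c \<and> n_pullback C n X Y f \<and>
            last_mor n \<X> (obj X n) (obj X (Suc n)) (diff X n)"

end

theory Submission
  imports Defs
begin

text \<open>
  A distinguished \<open>n\<close>-exangle \<open>X\<close> with extension \<open>\<delta>\<close> and last term in \<open>\<A>\<close> can be compared with a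
  projective one \<open>P\<close> with the same last term: as \<open>\<E>(P\<^sub>n, -) = 0\<close>, \<open>\<delta>\<close> is a pushout of the extension of
  \<open>P\<close>, and (EA2op) continues \<open>X\<close> to the left by \<open>P\<^sub>0 \<in> \<Omega>\<A>\<close>. So \<open>\<C>(\<A>, \<Omega>\<A>) = 0\<close> makes inflations of \<open>\<A>\<close>
  monic in \<open>\<A>\<close>, dually deflations are epic, and \<open>\<t>\<close>-conflations are \<open>n\<close>-exact. The axioms (E2) and
  (E2op) are then (EA2op) and (EA2).

  The other axioms rest on a criterion: if \<open>X\<close> is a conflation and \<open>Y\<close> is an \<open>n\<close>-cokernel sequence in \<open>\<A>\<close>
  starting at the same object whose first morphism and that of \<open>X\<close> factor through each other, then \<open>Y\<close>
  is a conflation. Given composable inflations \<open>u\<close> and \<open>v\<close> with extensions \<open>\<delta>\<close> and \<open>\<rho>\<close>, let \<open>Z\<close> realize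
  \<open>(d\<^sub>1)\<^sub>*\<rho>\<close>. The pullback of \<open>\<rho>\<close> to \<open>Z\<^sub>n\<close> is \<open>u\<^sub>*\<epsilon>\<close> for some \<open>\<epsilon>\<close>, and the first morphism of a realization
  of \<open>(\<epsilon>, \<delta>) \<in> \<E>(Z\<^sub>n \<oplus> X\<^sub>n\<^sub>+\<^sub>1, A)\<close> and \<open>v u\<close> factor through each other; for \<open>n \<ge> 2\<close> an explicit \<open>n\<close>-cokernel
  sequence of \<open>v u\<close> is obtained from this realization, for \<open>n = 1\<close> the conflation given by (EA1) has its
  last term in \<open>\<A>\<close>. For a weak isomorphism the realization of a suitable extension plays the same role.
\<close>

text \<open>The obstacle is that nothing controls the new terms of the conflation which (EA1)
  provides for a composite: \<open>\<A>\<close> is only known to contain some realization of each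
  extension between its objects. So conflations of \<open>\<A>\<close> have to be reached from
  extensions, and a morphism is recognized as an inflation by comparison with a realization of a
  suitable one. Mutual factorization of first morphisms is enough for this, since an n-cokernel
  sequence is determined up to homotopy by its first morphism: the last terms are related by maps c
  and c' that are inverse to each other modulo maps through the last differentials, and pulling back
  along such maps gives zero. The extension is then transported along c. The extensions themselves
  come from exactness beyond the definition of an n-exangle, at E(X_{n+1}, T) and at E(T, X_1),
  together with the duals; the first rests on (EA2op), the second on (EA1) and (EA2). Composition
  and weak isomorphisms use only a self-dual list of such facts, so these arguments are made on one
  side only.\<close>

section \<open>Morphisms and matrices\<close>

text \<open>Hom sets of different pairs may overlap, and the axioms ask for objects separately.
  Membership here carries both object conditions, so one typing fact discharges all side
  conditions.\<close>

definition Hom :: "('o, 'm) cat \<Rightarrow> 'o \<Rightarrow> 'o \<Rightarrow> 'm set" where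
  "Hom C A B = {f. A \<in> Ob C \<and> B \<in> Ob C \<and> f \<in> arr C A B}"

definition subm :: "('o, 'm) cat \<Rightarrow> 'o \<Rightarrow> 'o \<Rightarrow> 'm \<Rightarrow> 'm \<Rightarrow> 'm" where
  "subm C A B f g = addm C A B f (negm C A B g)"

section \<open>Additive calculus of morphisms\<close>

context preadditive_category
begin

abbreviation H :: "'o \<Rightarrow> 'o \<Rightarrow> 'm set" where "H A B \<equiv> Hom C A B"

abbreviation cmp_here :: "'m \<Rightarrow> 'm \<Rightarrow> 'm" (infixl "\<cdot>" 70) where
  "g \<cdot> f \<equiv> g \<bullet>\<^bsub>C\<^esub> f"

abbreviation add_here ("(_ \<boxplus>\<^bsub>_,_\<^esub> _)" [65, 0, 0, 66] 65) where
  "f \<boxplus>\<^bsub>A,B\<^esub> g \<equiv> addm C A B f g"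

abbreviation sub_here ("(_ \<boxminus>\<^bsub>_,_\<^esub> _)" [65, 0, 0, 66] 65) where
  "f \<boxminus>\<^bsub>A,B\<^esub> g \<equiv> subm C A B f g"

abbreviation zero_here ("\<zero>\<^bsub>_,_\<^esub>") where
  "\<zero>\<^bsub>A,B\<^esub> \<equiv> zerom C A B"

lemma HomI: "\<lbrakk>A \<in> Ob C; B \<in> Ob C; f \<in> arr C A B\<rbrakk> \<Longrightarrow> f \<in> H A B"
  by (simp add: Hom_def)

lemma Hom_arr: "f \<in> H A B \<Longrightarrow> f \<in> arr C A B"
  and Hom_dom: "f \<in> H A B \<Longrightarrow> A \<in> Ob C"
  and Hom_cod: "f \<in> H A B \<Longrightarrow> B \<in> Ob C"
  by (simp_all add: Hom_def)

lemma Hom_iff: "\<lbrakk>A \<in> Ob C; B \<in> Ob C\<rbrakk> \<Longrightarrow> f \<in> H A B \<longleftrightarrow> f \<in> arr C A B"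
  by (simp add: Hom_def)

lemma cmp_Hom: "\<lbrakk>f \<in> H A B; g \<in> H B D\<rbrakk> \<Longrightarrow> g \<cdot> f \<in> H A D"
  by (auto simp: Hom_def intro: cmp_arr)

lemma id_Hom: "A \<in> Ob C \<Longrightarrow> idt C A \<in> H A A"
  by (simp add: Hom_def id_arr)

lemma assoc: "\<lbrakk>f \<in> H A B; g \<in> H B D; h \<in> H D F\<rbrakk> \<Longrightarrow> h \<cdot> g \<cdot> f = h \<cdot> (g \<cdot> f)"
  by (auto simp: Hom_def intro: cmp_assoc)

lemma idl: "f \<in> H A B \<Longrightarrow> idt C B \<cdot> f = f"
  and idr: "f \<in> H A B \<Longrightarrow> f \<cdot> idt C A = f"
  by (auto simp: Hom_def id_left id_right)

lemma zero_Hom: "\<lbrakk>A \<in> Ob C; B \<in> Ob C\<rbrakk> \<Longrightarrow> \<zero>\<^bsub>A,B\<^esub> \<in> H A B"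
  using Mor_group[of A B] by (simp add: Hom_def comm_group_def comm_monoid_def group_def monoid.one_closed)

lemma Hom_group: "f \<in> H A B \<Longrightarrow> comm_group (Mor C A B)"
  by (auto simp: Hom_def intro: Mor_group)

lemma add_Hom: assumes "f \<in> H A B" "g \<in> H A B" shows "f \<boxplus>\<^bsub>A,B\<^esub> g \<in> H A B"
proof -
  interpret comm_group "Mor C A B" using assms(1) by (rule Hom_group)
  show ?thesis using assms by (simp add: Hom_def)
qed

lemma neg_Hom: assumes "f \<in> H A B" shows "negm C A B f \<in> H A B"
proof -
  interpret comm_group "Mor C A B" using assms(1) by (rule Hom_group)
  show ?thesis using assms by (simp add: Hom_def)
qed

lemma sub_Hom: "\<lbrakk>f \<in> H A B; g \<in> H A B\<rbrakk> \<Longrightarrow> f \<boxminus>\<^bsub>A,B\<^esub> g \<in> H A B"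
  by (simp add: subm_def add_Hom neg_Hom)

lemma add_comm: assumes "f \<in> H A B" "g \<in> H A B"
  shows "f \<boxplus>\<^bsub>A,B\<^esub> g = g \<boxplus>\<^bsub>A,B\<^esub> f"
proof -
  interpret comm_group "Mor C A B" using assms(1) by (rule Hom_group)
  show ?thesis using assms by (simp add: Hom_def m_comm)
qed

lemma add_assoc: assumes "f \<in> H A B" "g \<in> H A B" "h \<in> H A B"
  shows "f \<boxplus>\<^bsub>A,B\<^esub> g \<boxplus>\<^bsub>A,B\<^esub> h = f \<boxplus>\<^bsub>A,B\<^esub> (g \<boxplus>\<^bsub>A,B\<^esub> h)"
proof -
  interpret comm_group "Mor C A B" using assms(1) by (rule Hom_group)
  show ?thesis using assms by (simp add: Hom_def m_assoc)
qed

lemma add_zero: assumes "f \<in> H A B"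
  shows "f \<boxplus>\<^bsub>A,B\<^esub> \<zero>\<^bsub>A,B\<^esub> = f" "\<zero>\<^bsub>A,B\<^esub> \<boxplus>\<^bsub>A,B\<^esub> f = f" "f \<boxminus>\<^bsub>A,B\<^esub> \<zero>\<^bsub>A,B\<^esub> = f"
proof -
  interpret comm_group "Mor C A B" using assms(1) by (rule Hom_group)
  show "f \<boxplus>\<^bsub>A,B\<^esub> \<zero>\<^bsub>A,B\<^esub> = f" "\<zero>\<^bsub>A,B\<^esub> \<boxplus>\<^bsub>A,B\<^esub> f = f" "f \<boxminus>\<^bsub>A,B\<^esub> \<zero>\<^bsub>A,B\<^esub> = f"
    using assms by (simp_all add: Hom_def subm_def)
qed

lemma sub_self: assumes "f \<in> H A B" shows "f \<boxminus>\<^bsub>A,B\<^esub> f = \<zero>\<^bsub>A,B\<^esub>"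
proof -
  interpret comm_group "Mor C A B" using assms(1) by (rule Hom_group)
  show ?thesis using assms by (simp add: Hom_def subm_def)
qed

lemma add_sub: assumes "f \<in> H A B" "g \<in> H A B"
  shows "f \<boxplus>\<^bsub>A,B\<^esub> g \<boxminus>\<^bsub>A,B\<^esub> g = f" "g \<boxplus>\<^bsub>A,B\<^esub> f \<boxminus>\<^bsub>A,B\<^esub> g = f"
    "g \<boxplus>\<^bsub>A,B\<^esub> (f \<boxminus>\<^bsub>A,B\<^esub> g) = f" "f \<boxminus>\<^bsub>A,B\<^esub> g \<boxplus>\<^bsub>A,B\<^esub> g = f"
proof -
  interpret comm_group "Mor C A B" using assms(1) by (rule Hom_group)
  have fg: "f \<in> arr C A B" "g \<in> arr C A B" using assms by (simp_all add: Hom_def)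
  show 1: "f \<boxplus>\<^bsub>A,B\<^esub> g \<boxminus>\<^bsub>A,B\<^esub> g = f" using fg by (simp add: subm_def m_assoc)
  show "g \<boxplus>\<^bsub>A,B\<^esub> f \<boxminus>\<^bsub>A,B\<^esub> g = f" using 1 fg by (simp add: m_comm)
  show 2: "f \<boxminus>\<^bsub>A,B\<^esub> g \<boxplus>\<^bsub>A,B\<^esub> g = f" using fg by (simp add: subm_def m_assoc)
  show "g \<boxplus>\<^bsub>A,B\<^esub> (f \<boxminus>\<^bsub>A,B\<^esub> g) = f" using 2 fg by (simp add: subm_def m_comm)
qed

lemma sub_sub_self: assumes "f \<in> H A B" "g \<in> H A B"
  shows "f \<boxminus>\<^bsub>A,B\<^esub> (f \<boxminus>\<^bsub>A,B\<^esub> g) = g"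
  using assms add_sub(1)[of g A B "f \<boxminus>\<^bsub>A,B\<^esub> g"] by (simp add: add_sub sub_Hom)

lemma sub_eq_zero: assumes "f \<in> H A B" "g \<in> H A B"
  shows "f \<boxminus>\<^bsub>A,B\<^esub> g = \<zero>\<^bsub>A,B\<^esub> \<longleftrightarrow> f = g"
  using add_sub(4)[OF assms] add_zero(2)[OF assms(2)] sub_self[OF assms(1)] by auto

lemma eq_add_iff: assumes "f \<in> H A B" "g \<in> H A B" "h \<in> H A B"
  shows "f = g \<boxplus>\<^bsub>A,B\<^esub> h \<longleftrightarrow> f \<boxminus>\<^bsub>A,B\<^esub> g = h"
  using add_sub[of f A B g] add_sub[of h A B g] assms by metis

lemma add_add_swap: assumes "f \<in> H A B" "f' \<in> H A B" "g \<in> H A B" "g' \<in> H A B"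
  shows "(f \<boxplus>\<^bsub>A,B\<^esub> f') \<boxplus>\<^bsub>A,B\<^esub> (g \<boxplus>\<^bsub>A,B\<^esub> g') = (f \<boxplus>\<^bsub>A,B\<^esub> g) \<boxplus>\<^bsub>A,B\<^esub> (f' \<boxplus>\<^bsub>A,B\<^esub> g')"
proof -
  interpret comm_group "Mor C A B" using assms(1) by (rule Hom_group)
  show ?thesis using assms by (simp add: Hom_def m_ac)
qed

lemma distl: "\<lbrakk>f \<in> H A B; g \<in> H B D; g' \<in> H B D\<rbrakk>
    \<Longrightarrow> (g \<boxplus>\<^bsub>B,D\<^esub> g') \<cdot> f = g \<cdot> f \<boxplus>\<^bsub>A,D\<^esub> g' \<cdot> f"
  and distr: "\<lbrakk>f \<in> H A B; f' \<in> H A B; g \<in> H B D\<rbrakk>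
    \<Longrightarrow> g \<cdot> (f \<boxplus>\<^bsub>A,B\<^esub> f') = g \<cdot> f \<boxplus>\<^bsub>A,D\<^esub> g \<cdot> f'"
  by (simp_all add: Hom_def cmp_add_left cmp_add_right)

lemma cmp_zero: assumes "g \<in> H B D" "A \<in> Ob C" shows "g \<cdot> \<zero>\<^bsub>A,B\<^esub> = \<zero>\<^bsub>A,D\<^esub>"
proof -
  have z: "\<zero>\<^bsub>A,B\<^esub> \<in> H A B" using assms Hom_dom zero_Hom by blast
  have "g \<cdot> \<zero>\<^bsub>A,B\<^esub> \<boxplus>\<^bsub>A,D\<^esub> g \<cdot> \<zero>\<^bsub>A,B\<^esub> = g \<cdot> \<zero>\<^bsub>A,B\<^esub>"
    using distr[OF z z assms(1)] add_zero(1)[OF z] by simp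
  thus ?thesis using cmp_Hom[OF z assms(1)] add_sub(1) sub_self by metis
qed

lemma zero_cmp: assumes "f \<in> H A B" "D \<in> Ob C" shows "\<zero>\<^bsub>B,D\<^esub> \<cdot> f = \<zero>\<^bsub>A,D\<^esub>"
proof -
  have z: "\<zero>\<^bsub>B,D\<^esub> \<in> H B D" using assms Hom_cod zero_Hom by blast
  have "\<zero>\<^bsub>B,D\<^esub> \<cdot> f \<boxplus>\<^bsub>A,D\<^esub> \<zero>\<^bsub>B,D\<^esub> \<cdot> f = \<zero>\<^bsub>B,D\<^esub> \<cdot> f"
    using distl[OF assms(1) z z] add_zero(1)[OF z] by simp
  thus ?thesis using cmp_Hom[OF assms(1) z] add_sub(1) sub_self by metis
qed

lemma sub_distl: assumes "f \<in> H A B" "g \<in> H B D" "g' \<in> H B D"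
  shows "(g \<boxminus>\<^bsub>B,D\<^esub> g') \<cdot> f = g \<cdot> f \<boxminus>\<^bsub>A,D\<^esub> g' \<cdot> f"
proof -
  have "(g \<boxminus>\<^bsub>B,D\<^esub> g') \<cdot> f \<boxplus>\<^bsub>A,D\<^esub> g' \<cdot> f = g \<cdot> f"
    using distl[OF assms(1) sub_Hom[OF assms(2,3)] assms(3)] add_sub(4)[OF assms(2,3)] by simp
  thus ?thesis using assms by (metis add_sub(1) cmp_Hom sub_Hom)
qed

lemma sub_distr: assumes "f \<in> H A B" "f' \<in> H A B" "g \<in> H B D"
  shows "g \<cdot> (f \<boxminus>\<^bsub>A,B\<^esub> f') = g \<cdot> f \<boxminus>\<^bsub>A,D\<^esub> g \<cdot> f'"
proof -
  have "g \<cdot> (f \<boxminus>\<^bsub>A,B\<^esub> f') \<boxplus>\<^bsub>A,D\<^esub> g \<cdot> f' = g \<cdot> f"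
    using distr[OF sub_Hom[OF assms(1,2)] assms(2,3)] add_sub(4)[OF assms(1,2)] by simp
  thus ?thesis using assms by (metis add_sub(1) cmp_Hom sub_Hom)
qed

lemma neg_eq_sub: assumes "f \<in> H A B" shows "negm C A B f = \<zero>\<^bsub>A,B\<^esub> \<boxminus>\<^bsub>A,B\<^esub> f"
proof -
  interpret comm_group "Mor C A B" using assms(1) by (rule Hom_group)
  show ?thesis using assms by (simp add: Hom_def subm_def)
qed

lemma neg_cmp: assumes "f \<in> H A B" "g \<in> H B D" shows "negm C B D g \<cdot> f = negm C A D (g \<cdot> f)"
  using sub_distl[OF assms(1) zero_Hom[OF Hom_dom[OF assms(2)] Hom_cod[OF assms(2)]] assms(2)]
    zero_cmp[OF assms(1) Hom_cod[OF assms(2)]] neg_eq_sub[OF assms(2)] neg_eq_sub[OF cmp_Hom[OF assms]] by simp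

lemma cmp_neg: assumes "f \<in> H A B" "g \<in> H B D" shows "g \<cdot> negm C A B f = negm C A D (g \<cdot> f)"
  using sub_distr[OF zero_Hom[OF Hom_dom[OF assms(1)] Hom_cod[OF assms(1)]] assms]
    cmp_zero[OF assms(2) Hom_dom[OF assms(1)]] neg_eq_sub[OF assms(1)] neg_eq_sub[OF cmp_Hom[OF assms]] by simp

lemma neg_zero: assumes "A \<in> Ob C" "B \<in> Ob C"
  shows "negm C A B \<zero>\<^bsub>A,B\<^esub> = \<zero>\<^bsub>A,B\<^esub>"
  using assms by (metis neg_eq_sub sub_self zero_Hom)

lemma add_neg: assumes "f \<in> H A B" "g \<in> H A B"
  shows "f \<boxplus>\<^bsub>A,B\<^esub> negm C A B g = f \<boxminus>\<^bsub>A,B\<^esub> g" "negm C A B g \<boxplus>\<^bsub>A,B\<^esub> f = f \<boxminus>\<^bsub>A,B\<^esub> g"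
  using assms by (simp_all add: subm_def add_comm neg_Hom)

end

section \<open>Matrices between direct sums\<close>

context additive_category
begin

lemma bip: assumes "A \<in> Ob C" "B \<in> Ob C" shows "is_biproduct C A B (bip C A B)"
  using someI_ex[OF ex_biproduct[OF assms]] by (simp add: bip_def)

lemma dsum_Ob: "\<lbrakk>A \<in> Ob C; B \<in> Ob C\<rbrakk> \<Longrightarrow> dsum C A B \<in> Ob C"
  using bip[of A B] by (simp add: is_biproduct_def dsum_def)

abbreviation "i1 A B \<equiv> in1 (bip C A B)"
abbreviation "i2 A B \<equiv> in2 (bip C A B)"
abbreviation "p1 A B \<equiv> pr1 (bip C A B)"
abbreviation "p2 A B \<equiv> pr2 (bip C A B)"

lemma bip_Hom: assumes "A \<in> Ob C" "B \<in> Ob C"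
  shows "i1 A B \<in> H A (dsum C A B)" "i2 A B \<in> H B (dsum C A B)"
    "p1 A B \<in> H (dsum C A B) A" "p2 A B \<in> H (dsum C A B) B"
  using bip[OF assms] assms by (simp_all add: is_biproduct_def dsum_def Hom_def)

lemma bip_eq: assumes "A \<in> Ob C" "B \<in> Ob C"
  shows "p1 A B \<cdot> i1 A B = idt C A" "p2 A B \<cdot> i2 A B = idt C B"
    "p1 A B \<cdot> i2 A B = \<zero>\<^bsub>B,A\<^esub>" "p2 A B \<cdot> i1 A B = \<zero>\<^bsub>A,B\<^esub>"
    "i1 A B \<cdot> p1 A B \<boxplus>\<^bsub>dsum C A B,dsum C A B\<^esub> i2 A B \<cdot> p2 A B = idt C (dsum C A B)"
  using bip[OF assms] by (simp_all add: is_biproduct_def dsum_def)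

lemma colm_Hom: assumes "a \<in> H D A" "b \<in> H D B" shows "colm C D A B a b \<in> H D (dsum C A B)"
  using assms by (auto simp: colm_def intro!: add_Hom cmp_Hom bip_Hom dest: Hom_cod)

lemma rowm_Hom: assumes "a \<in> H A D" "b \<in> H B D" shows "rowm C A B D a b \<in> H (dsum C A B) D"
  using assms by (auto simp: rowm_def intro!: add_Hom cmp_Hom bip_Hom dest: Hom_dom)

lemma matm_Hom: assumes "a \<in> H A A'" "b \<in> H B A'" "c \<in> H A B'" "d \<in> H B B'"
  shows "matm C A B A' B' a b c d \<in> H (dsum C A B) (dsum C A' B')"
  using assms by (auto simp: matm_def intro!: rowm_Hom colm_Hom)

lemma pr_colm: assumes "a \<in> H D A" "b \<in> H D B"
  shows "p1 A B \<cdot> colm C D A B a b = a" "p2 A B \<cdot> colm C D A B a b = b"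
proof -
  note O = Hom_cod[OF assms(1)] Hom_cod[OF assms(2)]
  note B = bip_Hom[OF O] and ia = cmp_Hom[OF assms(1) bip_Hom(1)[OF O]] and ib = cmp_Hom[OF assms(2) bip_Hom(2)[OF O]]
  have "p1 A B \<cdot> colm C D A B a b = idt C A \<cdot> a \<boxplus>\<^bsub>D,A\<^esub> \<zero>\<^bsub>B,A\<^esub> \<cdot> b"
    unfolding colm_def using distr[OF ia ib B(3)] assoc[OF assms(1) B(1,3)] assoc[OF assms(2) B(2,3)] bip_eq[OF O] by simp
  thus "p1 A B \<cdot> colm C D A B a b = a"
    using idl[OF assms(1)] zero_cmp[OF assms(2) O(1)] add_zero[OF assms(1)] by simp
  have "p2 A B \<cdot> colm C D A B a b = \<zero>\<^bsub>A,B\<^esub> \<cdot> a \<boxplus>\<^bsub>D,B\<^esub> idt C B \<cdot> b"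
    unfolding colm_def using distr[OF ia ib B(4)] assoc[OF assms(1) B(1,4)] assoc[OF assms(2) B(2,4)] bip_eq[OF O] by simp
  thus "p2 A B \<cdot> colm C D A B a b = b"
    using idl[OF assms(2)] zero_cmp[OF assms(1) O(2)] add_zero[OF assms(2)] by simp
qed

lemma rowm_in: assumes "a \<in> H A D" "b \<in> H B D"
  shows "rowm C A B D a b \<cdot> i1 A B = a" "rowm C A B D a b \<cdot> i2 A B = b"
proof -
  note O = Hom_dom[OF assms(1)] Hom_dom[OF assms(2)]
  note B = bip_Hom[OF O] and ia = cmp_Hom[OF bip_Hom(3)[OF O] assms(1)] and ib = cmp_Hom[OF bip_Hom(4)[OF O] assms(2)]
  have "rowm C A B D a b \<cdot> i1 A B = a \<cdot> idt C A \<boxplus>\<^bsub>A,D\<^esub> b \<cdot> \<zero>\<^bsub>A,B\<^esub>"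
    unfolding rowm_def using distl[OF B(1) ia ib] assoc[OF B(1,3) assms(1)] assoc[OF B(1,4) assms(2)] bip_eq[OF O] by simp
  thus "rowm C A B D a b \<cdot> i1 A B = a"
    using idr[OF assms(1)] cmp_zero[OF assms(2) O(1)] add_zero[OF assms(1)] by simp
  have "rowm C A B D a b \<cdot> i2 A B = a \<cdot> \<zero>\<^bsub>B,A\<^esub> \<boxplus>\<^bsub>B,D\<^esub> b \<cdot> idt C B"
    unfolding rowm_def using distl[OF B(2) ia ib] assoc[OF B(2,3) assms(1)] assoc[OF B(2,4) assms(2)] bip_eq[OF O] by simp
  thus "rowm C A B D a b \<cdot> i2 A B = b"
    using idr[OF assms(2)] cmp_zero[OF assms(1) O(2)] add_zero[OF assms(2)] by simp
qed

lemma colm_cmp: assumes "a \<in> H D A" "b \<in> H D B" "f \<in> H F D"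
  shows "colm C D A B a b \<cdot> f = colm C F A B (a \<cdot> f) (b \<cdot> f)"
proof -
  note O = Hom_cod[OF assms(1)] Hom_cod[OF assms(2)]
  note B = bip_Hom[OF O]
  show ?thesis unfolding colm_def
    using distl[OF assms(3) cmp_Hom[OF assms(1) B(1)] cmp_Hom[OF assms(2) B(2)]]
      assoc[OF assms(3,1) B(1)] assoc[OF assms(3,2) B(2)] by simp
qed

lemma cmp_rowm: assumes "a \<in> H A D" "b \<in> H B D" "f \<in> H D F"
  shows "f \<cdot> rowm C A B D a b = rowm C A B F (f \<cdot> a) (f \<cdot> b)"
proof -
  note O = Hom_dom[OF assms(1)] Hom_dom[OF assms(2)]
  note B = bip_Hom[OF O]
  show ?thesis unfolding rowm_def
    using distr[OF cmp_Hom[OF B(3) assms(1)] cmp_Hom[OF B(4) assms(2)] assms(3)]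
      assoc[OF B(3) assms(1,3)] assoc[OF B(4) assms(2,3)] by simp
qed

lemma rowm_eta: assumes "A \<in> Ob C" "B \<in> Ob C" "f \<in> H (dsum C A B) D"
  shows "rowm C A B D (f \<cdot> i1 A B) (f \<cdot> i2 A B) = f"
proof -
  note B = bip_Hom[OF assms(1,2)]
  show ?thesis unfolding rowm_def
    using distr[OF cmp_Hom[OF B(3,1)] cmp_Hom[OF B(4,2)] assms(3)]
      assoc[OF B(3,1) assms(3)] assoc[OF B(4,2) assms(3)] bip_eq(5)[OF assms(1,2)] idr[OF assms(3)] by simp
qed

lemma colm_eta: assumes "A \<in> Ob C" "B \<in> Ob C" "f \<in> H D (dsum C A B)"
  shows "colm C D A B (p1 A B \<cdot> f) (p2 A B \<cdot> f) = f"
proof -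
  note B = bip_Hom[OF assms(1,2)]
  show ?thesis unfolding colm_def
    using distl[OF assms(3) cmp_Hom[OF B(3,1)] cmp_Hom[OF B(4,2)]]
      assoc[OF assms(3) B(3,1)] assoc[OF assms(3) B(4,2)] bip_eq(5)[OF assms(1,2)] idl[OF assms(3)] by simp
qed

lemma rowm_obtain: assumes "A \<in> Ob C" "B \<in> Ob C" "f \<in> H (dsum C A B) D"
  obtains a b where "a \<in> H A D" "b \<in> H B D" "f = rowm C A B D a b"
  using rowm_eta[OF assms] cmp_Hom[OF bip_Hom(1)[OF assms(1,2)] assms(3)]
    cmp_Hom[OF bip_Hom(2)[OF assms(1,2)] assms(3)] by metis

lemma colm_obtain: assumes "A \<in> Ob C" "B \<in> Ob C" "f \<in> H D (dsum C A B)"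
  obtains a b where "a \<in> H D A" "b \<in> H D B" "f = colm C D A B a b"
  using colm_eta[OF assms] cmp_Hom[OF assms(3) bip_Hom(3)[OF assms(1,2)]]
    cmp_Hom[OF assms(3) bip_Hom(4)[OF assms(1,2)]] by metis

lemma rowm_colm: assumes "a \<in> H A D" "b \<in> H B D" "c \<in> H F A" "d \<in> H F B"
  shows "rowm C A B D a b \<cdot> colm C F A B c d = a \<cdot> c \<boxplus>\<^bsub>F,D\<^esub> b \<cdot> d"
proof -
  note O = Hom_dom[OF assms(1)] Hom_dom[OF assms(2)]
  note B = bip_Hom[OF O]
  have "rowm C A B D a b \<cdot> colm C F A B c d
      = (a \<cdot> p1 A B) \<cdot> colm C F A B c d \<boxplus>\<^bsub>F,D\<^esub> (b \<cdot> p2 A B) \<cdot> colm C F A B c d"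
    unfolding rowm_def
    by (rule distl[OF colm_Hom[OF assms(3,4)] cmp_Hom[OF B(3) assms(1)] cmp_Hom[OF B(4) assms(2)]])
  thus ?thesis
    using assoc[OF colm_Hom[OF assms(3,4)] B(3) assms(1)] assoc[OF colm_Hom[OF assms(3,4)] B(4) assms(2)]
      pr_colm[OF assms(3,4)] by simp
qed

lemma matm_colm: assumes "a \<in> H A A'" "b \<in> H B A'" "c \<in> H A B'" "d \<in> H B B'" "u \<in> H F A" "v \<in> H F B"
  shows "matm C A B A' B' a b c d \<cdot> colm C F A B u v
    = colm C F A' B' (a \<cdot> u \<boxplus>\<^bsub>F,A'\<^esub> b \<cdot> v) (c \<cdot> u \<boxplus>\<^bsub>F,B'\<^esub> d \<cdot> v)"
  unfolding matm_def
  using colm_cmp[OF rowm_Hom[OF assms(1,2)] rowm_Hom[OF assms(3,4)] colm_Hom[OF assms(5,6)]]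
    rowm_colm[OF assms(1,2,5,6)] rowm_colm[OF assms(3,4,5,6)] by simp

lemma rowm_add: assumes "a \<in> H A D" "b \<in> H B D" "a' \<in> H A D" "b' \<in> H B D"
  shows "rowm C A B D a b \<boxplus>\<^bsub>dsum C A B,D\<^esub> rowm C A B D a' b'
    = rowm C A B D (a \<boxplus>\<^bsub>A,D\<^esub> a') (b \<boxplus>\<^bsub>B,D\<^esub> b')"
proof -
  note O = Hom_dom[OF assms(1)] Hom_dom[OF assms(2)]
  note B = bip_Hom[OF O]
  show ?thesis unfolding rowm_def
    using add_add_swap[OF cmp_Hom[OF B(3) assms(1)] cmp_Hom[OF B(4) assms(2)]
        cmp_Hom[OF B(3) assms(3)] cmp_Hom[OF B(4) assms(4)]]
      distl[OF B(3) assms(1,3)] distl[OF B(4) assms(2,4)] by simp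
qed

lemma rowm_matm: assumes "a \<in> H A A'" "b \<in> H B A'" "c \<in> H A B'" "d \<in> H B B'" "u \<in> H A' F" "v \<in> H B' F"
  shows "rowm C A' B' F u v \<cdot> matm C A B A' B' a b c d
    = rowm C A B F (u \<cdot> a \<boxplus>\<^bsub>A,F\<^esub> v \<cdot> c) (u \<cdot> b \<boxplus>\<^bsub>B,F\<^esub> v \<cdot> d)"
  unfolding matm_def
  using rowm_colm[OF assms(5,6) rowm_Hom[OF assms(1,2)] rowm_Hom[OF assms(3,4)]]
    cmp_rowm[OF assms(1,2,5)] cmp_rowm[OF assms(3,4,6)]
    rowm_add[OF cmp_Hom[OF assms(1,5)] cmp_Hom[OF assms(2,5)] cmp_Hom[OF assms(3,6)] cmp_Hom[OF assms(4,6)]]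
  by simp

lemma colm_inject: assumes "a \<in> H D A" "b \<in> H D B" "a' \<in> H D A" "b' \<in> H D B"
  shows "colm C D A B a b = colm C D A B a' b' \<longleftrightarrow> a = a' \<and> b = b'"
  using pr_colm[OF assms(1,2)] pr_colm[OF assms(3,4)] by auto

lemma rowm_inject: assumes "a \<in> H A D" "b \<in> H B D" "a' \<in> H A D" "b' \<in> H B D"
  shows "rowm C A B D a b = rowm C A B D a' b' \<longleftrightarrow> a = a' \<and> b = b'"
  using rowm_in[OF assms(1,2)] rowm_in[OF assms(3,4)] by auto

lemma colm_zero: "\<lbrakk>D \<in> Ob C; A \<in> Ob C; B \<in> Ob C\<rbrakk>
    \<Longrightarrow> colm C D A B \<zero>\<^bsub>D,A\<^esub> \<zero>\<^bsub>D,B\<^esub> = \<zero>\<^bsub>D,dsum C A B\<^esub>"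
  using colm_eta[of A B "\<zero>\<^bsub>D,dsum C A B\<^esub>" D] by (simp add: zero_Hom dsum_Ob bip_Hom cmp_zero[OF bip_Hom(3)] cmp_zero[OF bip_Hom(4)])

lemma rowm_zero: "\<lbrakk>D \<in> Ob C; A \<in> Ob C; B \<in> Ob C\<rbrakk>
    \<Longrightarrow> rowm C A B D \<zero>\<^bsub>A,D\<^esub> \<zero>\<^bsub>B,D\<^esub> = \<zero>\<^bsub>dsum C A B,D\<^esub>"
  using rowm_eta[of A B "\<zero>\<^bsub>dsum C A B,D\<^esub>" D] by (simp add: zero_Hom dsum_Ob bip_Hom zero_cmp[OF bip_Hom(1)] zero_cmp[OF bip_Hom(2)])

end

section \<open>Complexes and homotopies\<close>

text \<open>Only the inclusion of kernels in images is recorded, the other one being part of the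
  complex condition. In other words, the later differentials form an n-cokernel of
  \<open>diff X 0\<close>.\<close>

definition con_exact :: "('o, 'm) cat \<Rightarrow> nat \<Rightarrow> ('o, 'm) cpx \<Rightarrow> bool" where
  "con_exact C n X \<longleftrightarrow> complex_on C 0 (Suc n) X \<and> (\<forall>T\<in>Ob C.
     (\<forall>g\<in>Hom C (obj X (Suc n)) T. g \<bullet>\<^bsub>C\<^esub> diff X n = zerom C (obj X n) T \<longrightarrow>
        g = zerom C (obj X (Suc n)) T) \<and>
     (\<forall>i<n. \<forall>g\<in>Hom C (obj X (Suc i)) T. g \<bullet>\<^bsub>C\<^esub> diff X i = zerom C (obj X i) T \<longrightarrow>
        (\<exists>k\<in>Hom C (obj X (Suc (Suc i))) T. g = k \<bullet>\<^bsub>C\<^esub> diff X (Suc i))))"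

definition cov_exact :: "('o, 'm) cat \<Rightarrow> nat \<Rightarrow> ('o, 'm) cpx \<Rightarrow> bool" where
  "cov_exact C n X \<longleftrightarrow> complex_on C 0 (Suc n) X \<and> (\<forall>T\<in>Ob C.
     (\<forall>g\<in>Hom C T (obj X 0). diff X 0 \<bullet>\<^bsub>C\<^esub> g = zerom C T (obj X 1) \<longrightarrow>
        g = zerom C T (obj X 0)) \<and>
     (\<forall>i<n. \<forall>g\<in>Hom C T (obj X (Suc i)). diff X (Suc i) \<bullet>\<^bsub>C\<^esub> g = zerom C T (obj X (Suc (Suc i))) \<longrightarrow>
        (\<exists>k\<in>Hom C T (obj X i). g = diff X i \<bullet>\<^bsub>C\<^esub> k)))"

text \<open>The value dh + hd with the summands that leave the range 0, ..., n + 1 dropped, so that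
  the three clauses of \<open>homotopic\<close> become one equation per degree.\<close>

definition homotopy_term ::
  "('o, 'm) cat \<Rightarrow> nat \<Rightarrow> ('o, 'm) cpx \<Rightarrow> ('o, 'm) cpx \<Rightarrow> (nat \<Rightarrow> 'm) \<Rightarrow> nat \<Rightarrow> 'm" where
  "homotopy_term C n X Y h i =
     (if i = 0 then h 0 \<bullet>\<^bsub>C\<^esub> diff X 0
      else if i = Suc n then diff Y n \<bullet>\<^bsub>C\<^esub> h n
      else addm C (obj X i) (obj Y i) (diff Y (i - 1) \<bullet>\<^bsub>C\<^esub> h (i - 1)) (h i \<bullet>\<^bsub>C\<^esub> diff X i))"

section \<open>Exact complexes and comparison maps\<close>

context preadditive_category
begin

lemma complex_obj: "\<lbrakk>complex_on C 0 (Suc n) X; i \<le> Suc n\<rbrakk> \<Longrightarrow> obj X i \<in> Ob C"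
  by (simp add: complex_on_def)

lemma complex_diff: "\<lbrakk>complex_on C 0 (Suc n) X; i \<le> n\<rbrakk> \<Longrightarrow> diff X i \<in> H (obj X i) (obj X (Suc i))"
  by (simp add: complex_on_def Hom_def)

lemma complex_dd: "\<lbrakk>complex_on C 0 (Suc n) X; i < n\<rbrakk>
    \<Longrightarrow> diff X (Suc i) \<cdot> diff X i = \<zero>\<^bsub>obj X i,obj X (Suc (Suc i))\<^esub>"
  by (simp add: complex_on_def)

lemma complexI:
  assumes "\<And>i. i \<le> n \<Longrightarrow> diff X i \<in> H (obj X i) (obj X (Suc i))"
    and "\<And>i. i < n \<Longrightarrow> diff X (Suc i) \<cdot> diff X i = \<zero>\<^bsub>obj X i,obj X (Suc (Suc i))\<^esub>"
  shows "complex_on C 0 (Suc n) X"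
proof -
  have "obj X i \<in> Ob C" if "i \<le> Suc n" for i
    using that assms(1)[of i] assms(1)[of n] by (cases "i = Suc n") (auto simp: Hom_def)
  thus ?thesis using assms by (auto simp: complex_on_def Hom_def)
qed

lemma chain_map_Hom: "\<lbrakk>chain_map_on C 0 (Suc n) X Y f; complex_on C 0 (Suc n) X; complex_on C 0 (Suc n) Y; i \<le> Suc n\<rbrakk>
    \<Longrightarrow> f i \<in> H (obj X i) (obj Y i)"
  by (simp add: complex_on_def chain_map_on_def Hom_def)

lemma chain_map_comm: "\<lbrakk>chain_map_on C 0 (Suc n) X Y f; i \<le> n\<rbrakk> \<Longrightarrow> f (Suc i) \<cdot> diff X i = diff Y i \<cdot> f i"
  by (simp add: chain_map_on_def)

lemma chain_mapI: "\<lbrakk>\<And>i. i \<le> Suc n \<Longrightarrow> f i \<in> H (obj X i) (obj Y i);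
    \<And>i. i \<le> n \<Longrightarrow> f (Suc i) \<cdot> diff X i = diff Y i \<cdot> f i\<rbrakk> \<Longrightarrow> chain_map_on C 0 (Suc n) X Y f"
  by (simp add: complex_on_def chain_map_on_def Hom_def)

lemma chain_map_id: assumes "complex_on C 0 (Suc n) X"
  shows "chain_map_on C 0 (Suc n) X X (\<lambda>i. idt C (obj X i))"
  using assms by (intro chain_mapI)
    (simp_all add: complex_obj id_Hom idl[OF complex_diff] idr[OF complex_diff])

lemma chain_map_cmp:
  assumes f: "chain_map_on C 0 (Suc n) X Y f" and g: "chain_map_on C 0 (Suc n) Y Z g"
    and X: "complex_on C 0 (Suc n) X" and Y: "complex_on C 0 (Suc n) Y" and Z: "complex_on C 0 (Suc n) Z"
  shows "chain_map_on C 0 (Suc n) X Z (\<lambda>i. g i \<cdot> f i)"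
proof (rule chain_mapI)
  fix i assume i: "i \<le> n"
  note fH = chain_map_Hom[OF f X Y] and gH = chain_map_Hom[OF g Y Z]
  have "g (Suc i) \<cdot> f (Suc i) \<cdot> diff X i = g (Suc i) \<cdot> (diff Y i \<cdot> f i)"
    using assoc[OF complex_diff[OF X] fH gH, of i] chain_map_comm[OF f] i by simp
  also have "\<dots> = diff Z i \<cdot> g i \<cdot> f i"
    using assoc[OF fH complex_diff[OF Y] gH, of i] chain_map_comm[OF g] i by simp
  finally show "g (Suc i) \<cdot> f (Suc i) \<cdot> diff X i = diff Z i \<cdot> (g i \<cdot> f i)"
    using assoc[OF fH gH complex_diff[OF Z], of i] i by simp
qed (use assms cmp_Hom chain_map_Hom in blast)

lemma con_exactD: assumes "con_exact C n X"
  shows con_exact_complex: "complex_on C 0 (Suc n) X"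
    and con_exact_factor: "\<lbrakk>i < n; g \<in> H (obj X (Suc i)) T; g \<cdot> diff X i = \<zero>\<^bsub>obj X i,T\<^esub>\<rbrakk>
      \<Longrightarrow> \<exists>k\<in>H (obj X (Suc (Suc i))) T. g = k \<cdot> diff X (Suc i)"
    and con_exact_epi: "\<lbrakk>g \<in> H (obj X (Suc n)) T; g \<cdot> diff X n = \<zero>\<^bsub>obj X n,T\<^esub>\<rbrakk>
      \<Longrightarrow> g = \<zero>\<^bsub>obj X (Suc n),T\<^esub>"
  using assms Hom_cod unfolding con_exact_def by blast+

lemma cov_exactD: assumes "cov_exact C n X"
  shows cov_exact_complex: "complex_on C 0 (Suc n) X"
    and cov_exact_factor: "\<lbrakk>i < n; g \<in> H T (obj X (Suc i)); diff X (Suc i) \<cdot> g = \<zero>\<^bsub>T,obj X (Suc (Suc i))\<^esub>\<rbrakk>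
      \<Longrightarrow> \<exists>k\<in>H T (obj X i). g = diff X i \<cdot> k"
    and cov_exact_mono: "\<lbrakk>g \<in> H T (obj X 0); diff X 0 \<cdot> g = \<zero>\<^bsub>T,obj X 1\<^esub>\<rbrakk>
      \<Longrightarrow> g = \<zero>\<^bsub>T,obj X 0\<^esub>"
  using assms Hom_dom unfolding cov_exact_def by blast+

lemma con_exact_iff: "con_exact C n X \<longleftrightarrow> complex_on C 0 (Suc n) X \<and> con_left_exact C n X"
proof (cases "complex_on C 0 (Suc n) X")
  case X: True
  have arr: "f \<in> arr C (obj X i) T \<longleftrightarrow> f \<in> H (obj X i) T" if "i \<le> Suc n" "T \<in> Ob C" for f i T
    using that complex_obj[OF X] by (simp add: Hom_def)
  have im: "(\<lambda>g. g \<cdot> diff X (Suc i)) ` arr C (obj X (Suc (Suc i))) T \<subseteq>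
      kernel (Mor C (obj X (Suc i)) T) (Mor C (obj X i) T) (\<lambda>g. g \<cdot> diff X i)"
    if it: "i < n" "T \<in> Ob C" for i T
  proof
    fix g assume "g \<in> (\<lambda>g. g \<cdot> diff X (Suc i)) ` arr C (obj X (Suc (Suc i))) T"
    then obtain k where k: "k \<in> H (obj X (Suc (Suc i))) T" "g = k \<cdot> diff X (Suc i)" using it arr[of "Suc (Suc i)" T] by auto
    note d = complex_diff[OF X, of i] complex_diff[OF X, of "Suc i"]
    have "k \<cdot> diff X (Suc i) \<cdot> diff X i = \<zero>\<^bsub>obj X i,T\<^esub>"
      using assoc[OF d k(1)] complex_dd[OF X, of i] that cmp_zero[OF k(1)] complex_obj[OF X, of i] by simp
    moreover have "k \<cdot> diff X (Suc i) \<in> H (obj X (Suc i)) T" using cmp_Hom[OF d(2) k(1)] that by simp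
    ultimately show "g \<in> kernel (Mor C (obj X (Suc i)) T) (Mor C (obj X i) T) (\<lambda>g. g \<cdot> diff X i)"
      using k(2) by (simp add: kernel_def Hom_def)
  qed
  have 1: "con_exact_at C X T i \<longleftrightarrow> (\<forall>g\<in>H (obj X (Suc i)) T. g \<cdot> diff X i = \<zero>\<^bsub>obj X i,T\<^esub> \<longrightarrow>
      (\<exists>k\<in>H (obj X (Suc (Suc i))) T. g = k \<cdot> diff X (Suc i)))" if "i < n" "T \<in> Ob C" for i T
  proof -
    have "con_exact_at C X T i \<longleftrightarrow> kernel (Mor C (obj X (Suc i)) T) (Mor C (obj X i) T) (\<lambda>g. g \<cdot> diff X i)
        \<subseteq> (\<lambda>g. g \<cdot> diff X (Suc i)) ` arr C (obj X (Suc (Suc i))) T"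
      using im[OF that] unfolding con_exact_at_def by blast
    thus ?thesis using arr[of "Suc i" T] arr[of "Suc (Suc i)" T] that
      by (simp add: kernel_def subset_iff image_iff Bex_def Ball_def imp_conjL)
  qed
  have 2: "kernel (Mor C (obj X (Suc n)) T) (Mor C (obj X n) T) (\<lambda>g. g \<cdot> diff X n) = {\<zero>\<^bsub>obj X (Suc n),T\<^esub>} \<longleftrightarrow>
      (\<forall>g\<in>H (obj X (Suc n)) T. g \<cdot> diff X n = \<zero>\<^bsub>obj X n,T\<^esub> \<longrightarrow> g = \<zero>\<^bsub>obj X (Suc n),T\<^esub>)" if "T \<in> Ob C" for T
    using zero_cmp[OF complex_diff[OF X, of n] that] zero_Hom[OF complex_obj[OF X, of "Suc n"] that]
      arr[of "Suc n" T] that by (auto simp: kernel_def)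
  show ?thesis using 1 2 X by (simp add: con_exact_def con_left_exact_def)
qed (simp add: con_exact_def)

lemma cov_exact_iff: "cov_exact C n X \<longleftrightarrow> complex_on C 0 (Suc n) X \<and> cov_left_exact C n X"
proof (cases "complex_on C 0 (Suc n) X")
  case X: True
  have arr: "f \<in> arr C T (obj X i) \<longleftrightarrow> f \<in> H T (obj X i)" if "i \<le> Suc n" "T \<in> Ob C" for f i T
    using that complex_obj[OF X] by (simp add: Hom_def)
  have im: "(\<lambda>g. diff X i \<cdot> g) ` arr C T (obj X i) \<subseteq>
      kernel (Mor C T (obj X (Suc i))) (Mor C T (obj X (Suc (Suc i)))) (\<lambda>g. diff X (Suc i) \<cdot> g)"
    if it: "i < n" "T \<in> Ob C" for i T
  proof
    fix g assume "g \<in> (\<lambda>g. diff X i \<cdot> g) ` arr C T (obj X i)"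
    then obtain k where k: "k \<in> H T (obj X i)" "g = diff X i \<cdot> k" using it arr[of i T] by auto
    note d = complex_diff[OF X, of i] complex_diff[OF X, of "Suc i"]
    have "diff X (Suc i) \<cdot> (diff X i \<cdot> k) = \<zero>\<^bsub>T,obj X (Suc (Suc i))\<^esub>"
      using assoc[OF k(1) d] complex_dd[OF X, of i] that zero_cmp[OF k(1)] complex_obj[OF X, of "Suc (Suc i)"] by simp
    moreover have "diff X i \<cdot> k \<in> H T (obj X (Suc i))" using cmp_Hom[OF k(1) d(1)] that by simp
    ultimately show "g \<in> kernel (Mor C T (obj X (Suc i))) (Mor C T (obj X (Suc (Suc i)))) (\<lambda>g. diff X (Suc i) \<cdot> g)"
      using k(2) by (simp add: kernel_def Hom_def)
  qed
  have 1: "cov_exact_at C X T i \<longleftrightarrow> (\<forall>g\<in>H T (obj X (Suc i)). diff X (Suc i) \<cdot> g = \<zero>\<^bsub>T,obj X (Suc (Suc i))\<^esub> \<longrightarrow>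
      (\<exists>k\<in>H T (obj X i). g = diff X i \<cdot> k))" if "i < n" "T \<in> Ob C" for i T
  proof -
    have "cov_exact_at C X T i \<longleftrightarrow> kernel (Mor C T (obj X (Suc i))) (Mor C T (obj X (Suc (Suc i)))) (\<lambda>g. diff X (Suc i) \<cdot> g)
        \<subseteq> (\<lambda>g. diff X i \<cdot> g) ` arr C T (obj X i)"
      using im[OF that] unfolding cov_exact_at_def by blast
    thus ?thesis using arr[of "Suc i" T] arr[of i T] that
      by (simp add: kernel_def subset_iff image_iff Bex_def Ball_def imp_conjL)
  qed
  have 2: "kernel (Mor C T (obj X 0)) (Mor C T (obj X 1)) (\<lambda>g. diff X 0 \<cdot> g) = {\<zero>\<^bsub>T,obj X 0\<^esub>} \<longleftrightarrow>
      (\<forall>g\<in>H T (obj X 0). diff X 0 \<cdot> g = \<zero>\<^bsub>T,obj X 1\<^esub> \<longrightarrow> g = \<zero>\<^bsub>T,obj X 0\<^esub>)" if "T \<in> Ob C" for T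
    using cmp_zero[OF complex_diff[OF X, of 0] that] zero_Hom[OF that complex_obj[OF X, of 0]]
      arr[of 0 T] that by (auto simp: kernel_def)
  show ?thesis using 1 2 X by (simp add: cov_exact_def cov_left_exact_def)
qed (simp add: cov_exact_def)

lemma n_exact_sequence_iff: "n_exact_sequence C n X \<longleftrightarrow> con_exact C n X \<and> cov_exact C n X"
  by (auto simp: n_exact_sequence_def con_exact_iff cov_exact_iff)

text \<open>The composite of \<open>f (Suc m)\<close> with the next differential of Y kills
  \<open>diff X m\<close> and so factors through \<open>diff X (Suc m)\<close>; the factor is the
  next component. Exactness of the source drives the induction.\<close>

lemma con_exact_extend:
  assumes X: "con_exact C n X" and Y: "complex_on C 0 (Suc n) Y"
    and a: "a \<in> H (obj X 0) (obj Y 0)" and b: "b \<in> H (obj X 1) (obj Y 1)"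
    and ab: "b \<cdot> diff X 0 = diff Y 0 \<cdot> a"
  shows "\<exists>f. chain_map_on C 0 (Suc n) X Y f \<and> f 0 = a \<and> f 1 = b"
proof -
  note cX = con_exact_complex[OF X]
  have "\<exists>f. f 0 = a \<and> f 1 = b \<and> (\<forall>i\<le>Suc m. f i \<in> H (obj X i) (obj Y i)) \<and>
      (\<forall>i\<le>m. f (Suc i) \<cdot> diff X i = diff Y i \<cdot> f i)" if "m \<le> n" for m
    using that
  proof (induction m)
    case 0
    show ?case using a b ab by (intro exI[of _ "\<lambda>i. if i = 0 then a else b"]) (auto simp: le_Suc_eq)
  next
    case (Suc m)
    then obtain f where f: "f 0 = a" "f 1 = b" "\<forall>i\<le>Suc m. f i \<in> H (obj X i) (obj Y i)"
      "\<forall>i\<le>m. f (Suc i) \<cdot> diff X i = diff Y i \<cdot> f i" by auto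
    note dX = complex_diff[OF cX] and dY = complex_diff[OF Y]
    have fm: "f m \<in> H (obj X m) (obj Y m)" "f (Suc m) \<in> H (obj X (Suc m)) (obj Y (Suc m))"
      using f(3) by auto
    have "diff Y (Suc m) \<cdot> f (Suc m) \<cdot> diff X m = diff Y (Suc m) \<cdot> (diff Y m \<cdot> f m)"
      using assoc[OF dX fm(2) dY] f(4) Suc.prems by simp
    also have "\<dots> = \<zero>\<^bsub>obj X m,obj Y (Suc (Suc m))\<^esub>"
      using assoc[OF fm(1) dY dY] complex_dd[OF Y, of m] Suc.prems
        zero_cmp[OF fm(1)] complex_obj[OF Y, of "Suc (Suc m)"] by simp
    finally obtain k where k: "k \<in> H (obj X (Suc (Suc m))) (obj Y (Suc (Suc m)))"
      "diff Y (Suc m) \<cdot> f (Suc m) = k \<cdot> diff X (Suc m)"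
      using con_exact_factor[OF X, of m "diff Y (Suc m) \<cdot> f (Suc m)" "obj Y (Suc (Suc m))"]
        cmp_Hom[OF fm(2) dY] Suc.prems by auto
    show ?case
      using f k by (intro exI[of _ "f(Suc (Suc m) := k)"]) (auto simp: le_Suc_eq)
  qed
  from this[of n] obtain f where f: "f 0 = a" "f 1 = b" "\<forall>i\<le>Suc n. f i \<in> H (obj X i) (obj Y i)"
    "\<forall>i\<le>n. f (Suc i) \<cdot> diff X i = diff Y i \<cdot> f i" by auto
  thus ?thesis using chain_mapI[of n f X Y] by blast
qed

text \<open>The homotopy can be chosen to vanish in degree 0, and exactness at the last term
  makes the last component of the homotopy equation automatic.\<close>

lemma con_exact_homotopy:
  assumes X: "con_exact C n X" and Y: "complex_on C 0 (Suc n) Y"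
    and e: "chain_map_on C 0 (Suc n) X Y e" and e': "chain_map_on C 0 (Suc n) X Y e'"
    and e0: "e 0 = e' 0"
  obtains h where "\<And>i. i \<le> n \<Longrightarrow> h i \<in> H (obj X (Suc i)) (obj Y i)"
    and "h 0 = \<zero>\<^bsub>obj X 1,obj Y 0\<^esub>"
    and "\<And>i. i < n \<Longrightarrow> e (Suc i) = e' (Suc i) \<boxplus>\<^bsub>obj X (Suc i),obj Y (Suc i)\<^esub>
        (diff Y i \<cdot> h i \<boxplus>\<^bsub>obj X (Suc i),obj Y (Suc i)\<^esub> h (Suc i) \<cdot> diff X (Suc i))"
    and "e (Suc n) = e' (Suc n) \<boxplus>\<^bsub>obj X (Suc n),obj Y (Suc n)\<^esub> diff Y n \<cdot> h n"
proof -
  note cX = con_exact_complex[OF X]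
  note dX = complex_diff[OF cX] and dY = complex_diff[OF Y]
  note oX = complex_obj[OF cX] and oY = complex_obj[OF Y]
  note eH = chain_map_Hom[OF e cX Y] and e'H = chain_map_Hom[OF e' cX Y]
  \<comment> \<open>The defect in degree m + 1 once \<open>diff Y m\<close> after h has been taken
    off; the next component of the homotopy has to factor it through
    \<open>diff X (Suc m)\<close>.\<close>
  define \<psi> where "\<psi> m h = (e (Suc m) \<boxminus>\<^bsub>obj X (Suc m),obj Y (Suc m)\<^esub> e' (Suc m))
      \<boxminus>\<^bsub>obj X (Suc m),obj Y (Suc m)\<^esub> diff Y m \<cdot> h" for m h
  \<comment> \<open>Exactly what makes the defect vanish on \<open>diff X m\<close>. It is the
    homotopy equation in degree m composed with \<open>diff Y m\<close>, which removes the part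
    coming from the lower component. In degree 0 it holds with h = 0 because e and e' agree
    there.\<close>
  define bal where "bal m h \<longleftrightarrow> diff Y m \<cdot> (e m \<boxminus>\<^bsub>obj X m,obj Y m\<^esub> e' m) = diff Y m \<cdot> (h \<cdot> diff X m)" for m h
  have \<psi>H: "\<psi> m h \<in> H (obj X (Suc m)) (obj Y (Suc m))" if "m \<le> n" "h \<in> H (obj X (Suc m)) (obj Y m)" for m h
    unfolding \<psi>_def using that by (intro sub_Hom cmp_Hom[OF that(2)] dY eH e'H) auto
  have \<psi>d: "\<psi> m h \<cdot> diff X m = \<zero>\<^bsub>obj X m,obj Y (Suc m)\<^esub>"
    if m: "m \<le> n" and h: "h \<in> H (obj X (Suc m)) (obj Y m)" and "bal m h" for m h
  proof -
    have s: "e (Suc m) \<boxminus>\<^bsub>obj X (Suc m),obj Y (Suc m)\<^esub> e' (Suc m) \<in> H (obj X (Suc m)) (obj Y (Suc m))"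
      using m by (intro sub_Hom eH e'H) auto
    have "\<psi> m h \<cdot> diff X m = (e (Suc m) \<boxminus>\<^bsub>obj X (Suc m),obj Y (Suc m)\<^esub> e' (Suc m)) \<cdot> diff X m
        \<boxminus>\<^bsub>obj X m,obj Y (Suc m)\<^esub> diff Y m \<cdot> h \<cdot> diff X m"
      unfolding \<psi>_def by (rule sub_distl[OF dX[OF m] s cmp_Hom[OF h dY[OF m]]])
    also have "(e (Suc m) \<boxminus>\<^bsub>obj X (Suc m),obj Y (Suc m)\<^esub> e' (Suc m)) \<cdot> diff X m
        = diff Y m \<cdot> e m \<boxminus>\<^bsub>obj X m,obj Y (Suc m)\<^esub> diff Y m \<cdot> e' m"
      using sub_distl[OF dX[OF m] eH e'H] m chain_map_comm[OF e m] chain_map_comm[OF e' m] by simp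
    also have "\<dots> = diff Y m \<cdot> (e m \<boxminus>\<^bsub>obj X m,obj Y m\<^esub> e' m)"
      using sub_distr[OF eH e'H dY[OF m]] m by simp
    also have "\<dots> = diff Y m \<cdot> h \<cdot> diff X m"
      using that(3) assoc[OF dX[OF m] h dY[OF m]] by (simp add: bal_def)
    finally show ?thesis using sub_self[OF cmp_Hom[OF dX[OF m] cmp_Hom[OF h dY[OF m]]]] by simp
  qed
  have e_eq: "e (Suc m) = e' (Suc m) \<boxplus>\<^bsub>obj X (Suc m),obj Y (Suc m)\<^esub>
        (diff Y m \<cdot> h \<boxplus>\<^bsub>obj X (Suc m),obj Y (Suc m)\<^esub> \<psi> m h)"
    if m: "m \<le> n" and h: "h \<in> H (obj X (Suc m)) (obj Y m)" for m h
    unfolding \<psi>_def using m by (simp add: add_sub(3)[OF sub_Hom[OF eH e'H] cmp_Hom[OF h dY]] add_sub(3)[OF eH e'H])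
  have "\<exists>h. h 0 = \<zero>\<^bsub>obj X 1,obj Y 0\<^esub> \<and> (\<forall>i\<le>m. h i \<in> H (obj X (Suc i)) (obj Y i)) \<and>
      (\<forall>i<m. \<psi> i (h i) = h (Suc i) \<cdot> diff X (Suc i)) \<and> bal m (h m)" if "m \<le> n" for m
    using that
  proof (induction m)
    case 0
    have z: "\<zero>\<^bsub>obj X 1,obj Y 0\<^esub> \<in> H (obj X (Suc 0)) (obj Y 0)" using zero_Hom oX oY by simp
    have "diff Y 0 \<cdot> (e 0 \<boxminus>\<^bsub>obj X 0,obj Y 0\<^esub> e' 0) = diff Y 0 \<cdot> (\<zero>\<^bsub>obj X 1,obj Y 0\<^esub> \<cdot> diff X 0)"
      using e0 sub_self[OF e'H] zero_cmp[OF dX[of 0]] oY by simp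
    thus ?case using z by (intro exI[of _ "\<lambda>_. \<zero>\<^bsub>obj X 1,obj Y 0\<^esub>"]) (auto simp: bal_def)
  next
    case (Suc m)
    then obtain h where h: "h 0 = \<zero>\<^bsub>obj X 1,obj Y 0\<^esub>" "\<forall>i\<le>m. h i \<in> H (obj X (Suc i)) (obj Y i)"
      "\<forall>i<m. \<psi> i (h i) = h (Suc i) \<cdot> diff X (Suc i)" "bal m (h m)" by auto
    have m: "m \<le> n" "m < n" "Suc m \<le> n" using Suc.prems by auto
    have hm: "h m \<in> H (obj X (Suc m)) (obj Y m)" using h by auto
    obtain k where k: "k \<in> H (obj X (Suc (Suc m))) (obj Y (Suc m))" "\<psi> m (h m) = k \<cdot> diff X (Suc m)"
      using con_exact_factor[OF X m(2) \<psi>H[OF m(1) hm] \<psi>d[OF m(1) hm h(4)]] by auto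
    have s: "e (Suc m) \<boxminus>\<^bsub>obj X (Suc m),obj Y (Suc m)\<^esub> e' (Suc m) \<in> H (obj X (Suc m)) (obj Y (Suc m))"
      using m by (intro sub_Hom eH e'H) auto
    note dh = cmp_Hom[OF hm dY[OF m(1)]]
    have "diff Y (Suc m) \<cdot> (diff Y m \<cdot> h m) = \<zero>\<^bsub>obj X (Suc m),obj Y (Suc (Suc m))\<^esub>"
      using assoc[OF hm dY[OF m(1)] dY[OF m(3)]] complex_dd[OF Y m(2)] zero_cmp[OF hm oY] m by simp
    hence "diff Y (Suc m) \<cdot> \<psi> m (h m) = diff Y (Suc m) \<cdot> (e (Suc m) \<boxminus>\<^bsub>obj X (Suc m),obj Y (Suc m)\<^esub> e' (Suc m))"
      unfolding \<psi>_def using sub_distr[OF s dh dY[OF m(3)]] add_zero(3)[OF cmp_Hom[OF s dY[OF m(3)]]] by simp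
    hence "bal (Suc m) k" using k(2) by (simp add: bal_def)
    moreover have "\<forall>i<Suc m. \<psi> i ((h(Suc m := k)) i) = (h(Suc m := k)) (Suc i) \<cdot> diff X (Suc i)"
      using h(3) k(2) by (auto simp: less_Suc_eq)
    ultimately show ?case
      using h k by (intro exI[of _ "h(Suc m := k)"]) (auto simp: le_Suc_eq)
  qed
  from this[of n] obtain h where h: "h 0 = \<zero>\<^bsub>obj X 1,obj Y 0\<^esub>" "\<forall>i\<le>n. h i \<in> H (obj X (Suc i)) (obj Y i)"
      "\<forall>i<n. \<psi> i (h i) = h (Suc i) \<cdot> diff X (Suc i)" "bal n (h n)" by auto
  have "\<psi> n (h n) = \<zero>\<^bsub>obj X (Suc n),obj Y (Suc n)\<^esub>"
    using con_exact_epi[OF X \<psi>H \<psi>d] h by simp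
  hence last: "e (Suc n) = e' (Suc n) \<boxplus>\<^bsub>obj X (Suc n),obj Y (Suc n)\<^esub> diff Y n \<cdot> h n"
    using e_eq[of n "h n"] h add_zero(1)[OF cmp_Hom[OF _ dY], of "h n" "obj X (Suc n)" n] by simp
  have "e (Suc i) = e' (Suc i) \<boxplus>\<^bsub>obj X (Suc i),obj Y (Suc i)\<^esub>
        (diff Y i \<cdot> h i \<boxplus>\<^bsub>obj X (Suc i),obj Y (Suc i)\<^esub> h (Suc i) \<cdot> diff X (Suc i))"
    if "i < n" for i using e_eq[of i "h i"] h that by simp
  thus ?thesis using that[of h] h last by blast
qed

lemma con_exact_homotopic:
  assumes X: "con_exact C n X" and Y: "complex_on C 0 (Suc n) Y"
    and e: "chain_map_on C 0 (Suc n) X Y e" and e': "chain_map_on C 0 (Suc n) X Y e'"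
    and e0: "e 0 = e' 0"
  shows "homotopic C n X Y e e'"
proof -
  note cX = con_exact_complex[OF X]
  obtain h where h: "\<And>i. i \<le> n \<Longrightarrow> h i \<in> H (obj X (Suc i)) (obj Y i)" "h 0 = \<zero>\<^bsub>obj X 1,obj Y 0\<^esub>"
    "\<And>i. i < n \<Longrightarrow> e (Suc i) = e' (Suc i) \<boxplus>\<^bsub>obj X (Suc i),obj Y (Suc i)\<^esub>
        (diff Y i \<cdot> h i \<boxplus>\<^bsub>obj X (Suc i),obj Y (Suc i)\<^esub> h (Suc i) \<cdot> diff X (Suc i))"
    "e (Suc n) = e' (Suc n) \<boxplus>\<^bsub>obj X (Suc n),obj Y (Suc n)\<^esub> diff Y n \<cdot> h n"
    by (rule con_exact_homotopy[OF assms]) blast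
  have "e 0 = e' 0 \<boxplus>\<^bsub>obj X 0,obj Y 0\<^esub> h 0 \<cdot> diff X 0"
    using e0 h(2) zero_cmp[OF complex_diff[OF cX, of 0] complex_obj[OF Y, of 0]]
      add_zero(1)[OF chain_map_Hom[OF e' cX Y, of 0]] by simp
  thus ?thesis unfolding homotopic_def using h Hom_arr by blast
qed

section \<open>Homotopy equivalence with fixed ends as an equivalence relation\<close>

lemma homotopic_iff:
  assumes X: "complex_on C 0 (Suc n) X" and Y: "complex_on C 0 (Suc n) Y"
  shows "homotopic C n X Y f g \<longleftrightarrow> (\<exists>h. (\<forall>i\<le>n. h i \<in> H (obj X (Suc i)) (obj Y i)) \<and>
    (\<forall>i\<le>Suc n. f i = g i \<boxplus>\<^bsub>obj X i,obj Y i\<^esub> homotopy_term C n X Y h i))" (is "_ \<longleftrightarrow> (\<exists>h. ?H h \<and> ?T h)")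
proof -
  have "?T h \<longleftrightarrow> f 0 = g 0 \<boxplus>\<^bsub>obj X 0,obj Y 0\<^esub> h 0 \<cdot> diff X 0 \<and>
        (\<forall>i<n. f (Suc i) = g (Suc i) \<boxplus>\<^bsub>obj X (Suc i),obj Y (Suc i)\<^esub>
           (diff Y i \<cdot> h i \<boxplus>\<^bsub>obj X (Suc i),obj Y (Suc i)\<^esub> h (Suc i) \<cdot> diff X (Suc i))) \<and>
        f (Suc n) = g (Suc n) \<boxplus>\<^bsub>obj X (Suc n),obj Y (Suc n)\<^esub> diff Y n \<cdot> h n" (is "_ \<longleftrightarrow> ?R") for h
  proof
    assume t: "?T h"
    show ?R using t[rule_format, of 0] t[rule_format, of "Suc _"] by (auto simp: homotopy_term_def)
  next
    assume r: "?R"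
    show "?T h"
    proof (intro allI impI)
      fix i assume "i \<le> Suc n"
      then consider "i = 0" | j where "i = Suc j" "j < n" | "i = Suc n" by (cases i) (auto simp: le_less)
      thus "f i = g i \<boxplus>\<^bsub>obj X i,obj Y i\<^esub> homotopy_term C n X Y h i"
        using r by cases (auto simp: homotopy_term_def)
    qed
  qed
  moreover have "?H h \<longleftrightarrow> (\<forall>i\<le>n. h i \<in> arr C (obj X (Suc i)) (obj Y i))" for h
    using complex_obj[OF X] complex_obj[OF Y] by (simp add: Hom_def)
  ultimately show ?thesis by (simp add: homotopic_def)
qed

lemma homotopy_term_Hom:
  assumes X: "complex_on C 0 (Suc n) X" and Y: "complex_on C 0 (Suc n) Y"
    and h: "\<And>i. i \<le> n \<Longrightarrow> h i \<in> H (obj X (Suc i)) (obj Y i)" and i: "i \<le> Suc n"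
  shows "homotopy_term C n X Y h i \<in> H (obj X i) (obj Y i)"
proof -
  have d: "diff Y j \<cdot> h j \<in> H (obj X (Suc j)) (obj Y (Suc j))" "h j \<cdot> diff X j \<in> H (obj X j) (obj Y j)"
    if "j \<le> n" for j
    using that cmp_Hom[OF h complex_diff[OF Y]] cmp_Hom[OF complex_diff[OF X] h] by auto
  from i consider "i = 0" | j where "i = Suc j" "j < n" | "i = Suc n" by (cases i) (auto simp: le_less)
  thus ?thesis
  proof cases
    case 2
    thus ?thesis using add_Hom[OF d(1)[of j] d(2)[of "Suc j"]] by (simp add: homotopy_term_def)
  qed (use d(1)[of n] d(2)[of 0] in \<open>auto simp: homotopy_term_def\<close>)
qed

lemma homotopic_refl:
  assumes X: "complex_on C 0 (Suc n) X" and Y: "complex_on C 0 (Suc n) Y"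
    and f: "\<And>i. i \<le> Suc n \<Longrightarrow> f i \<in> H (obj X i) (obj Y i)"
  shows "homotopic C n X Y f f"
proof -
  let ?h = "\<lambda>i. \<zero>\<^bsub>obj X (Suc i),obj Y i\<^esub>"
  note oX = complex_obj[OF X] and oY = complex_obj[OF Y]
  have h: "?h i \<in> H (obj X (Suc i)) (obj Y i)" if "i \<le> n" for i using that by (simp add: zero_Hom oX oY)
  have "homotopy_term C n X Y ?h i = \<zero>\<^bsub>obj X i,obj Y i\<^esub>" if "i \<le> Suc n" for i
  proof -
    have d: "diff Y j \<cdot> \<zero>\<^bsub>obj X (Suc j),obj Y j\<^esub> = \<zero>\<^bsub>obj X (Suc j),obj Y (Suc j)\<^esub>"
      "\<zero>\<^bsub>obj X (Suc j),obj Y j\<^esub> \<cdot> diff X j = \<zero>\<^bsub>obj X j,obj Y j\<^esub>" if "j \<le> n" for j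
      using that cmp_zero[OF complex_diff[OF Y] oX] zero_cmp[OF complex_diff[OF X] oY] by auto
    from that consider "i = 0" | j where "i = Suc j" "j < n" | "i = Suc n" by (cases i) (auto simp: le_less)
    thus ?thesis
    proof cases
      case 2
      thus ?thesis using d(1)[of j] d(2)[of "Suc j"] add_zero(1)[OF zero_Hom[OF oX[of "Suc j"] oY[of "Suc j"]]]
        by (simp add: homotopy_term_def)
    qed (use d(1)[of n] d(2)[of 0] in \<open>auto simp: homotopy_term_def\<close>)
  qed
  thus ?thesis unfolding homotopic_iff[OF X Y] using h add_zero(1)[OF f] by (intro exI[of _ ?h]) auto
qed

lemma homotopic_trans:
  assumes X: "complex_on C 0 (Suc n) X" and Y: "complex_on C 0 (Suc n) Y"
    and k: "\<And>i. i \<le> Suc n \<Longrightarrow> k i \<in> H (obj X i) (obj Y i)"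
    and fg: "homotopic C n X Y f g" and gk: "homotopic C n X Y g k"
  shows "homotopic C n X Y f k"
proof -
  obtain h where h: "\<And>i. i \<le> n \<Longrightarrow> h i \<in> H (obj X (Suc i)) (obj Y i)"
    "\<And>i. i \<le> Suc n \<Longrightarrow> f i = g i \<boxplus>\<^bsub>obj X i,obj Y i\<^esub> homotopy_term C n X Y h i"
    using fg unfolding homotopic_iff[OF X Y] by blast
  obtain h' where h': "\<And>i. i \<le> n \<Longrightarrow> h' i \<in> H (obj X (Suc i)) (obj Y i)"
    "\<And>i. i \<le> Suc n \<Longrightarrow> g i = k i \<boxplus>\<^bsub>obj X i,obj Y i\<^esub> homotopy_term C n X Y h' i"
    using gk unfolding homotopic_iff[OF X Y] by blast
  note oX = complex_obj[OF X] and oY = complex_obj[OF Y]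
  note dX = complex_diff[OF X] and dY = complex_diff[OF Y]
  let ?k = "\<lambda>i. h' i \<boxplus>\<^bsub>obj X (Suc i),obj Y i\<^esub> h i"
  have kH: "?k i \<in> H (obj X (Suc i)) (obj Y i)" if "i \<le> n" for i using that h h' by (simp add: add_Hom)
  have kt: "homotopy_term C n X Y ?k i = homotopy_term C n X Y h' i \<boxplus>\<^bsub>obj X i,obj Y i\<^esub> homotopy_term C n X Y h i"
    if "i \<le> Suc n" for i
  proof -
    have r: "diff Y j \<cdot> ?k j = diff Y j \<cdot> h' j \<boxplus>\<^bsub>obj X (Suc j),obj Y (Suc j)\<^esub> diff Y j \<cdot> h j"
      and l: "?k j \<cdot> diff X j = h' j \<cdot> diff X j \<boxplus>\<^bsub>obj X j,obj Y j\<^esub> h j \<cdot> diff X j" if "j \<le> n" for j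
      using that distr[OF h'(1) h(1) dY] distl[OF dX h'(1) h(1)] by auto
    from that consider "i = 0" | j where "i = Suc j" "j < n" | "i = Suc n" by (cases i) (auto simp: le_less)
    thus ?thesis
    proof cases
      case 2
      have "(diff Y j \<cdot> h' j \<boxplus>\<^bsub>obj X i,obj Y i\<^esub> diff Y j \<cdot> h j) \<boxplus>\<^bsub>obj X i,obj Y i\<^esub> (h' i \<cdot> diff X i \<boxplus>\<^bsub>obj X i,obj Y i\<^esub> h i \<cdot> diff X i) =
        (diff Y j \<cdot> h' j \<boxplus>\<^bsub>obj X i,obj Y i\<^esub> h' i \<cdot> diff X i) \<boxplus>\<^bsub>obj X i,obj Y i\<^esub> (diff Y j \<cdot> h j \<boxplus>\<^bsub>obj X i,obj Y i\<^esub> h i \<cdot> diff X i)"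
        by (rule add_add_swap) (use 2 cmp_Hom[OF h(1)[of j] dY[of j]] cmp_Hom[OF h'(1)[of j] dY[of j]]
          cmp_Hom[OF dX[of i] h(1)[of i]] cmp_Hom[OF dX[of i] h'(1)[of i]] in auto)
      thus ?thesis using 2 r[of j] l[of i] by (simp add: homotopy_term_def)
    qed (use r[of n] l[of 0] in \<open>auto simp: homotopy_term_def\<close>)
  qed
  have "f i = k i \<boxplus>\<^bsub>obj X i,obj Y i\<^esub> homotopy_term C n X Y ?k i" if "i \<le> Suc n" for i
    using h(2)[OF that] h'(2)[OF that] kt[OF that]
      add_assoc[OF k[OF that] homotopy_term_Hom[OF X Y h'(1) that] homotopy_term_Hom[OF X Y h(1) that]] by simp
  thus ?thesis unfolding homotopic_iff[OF X Y] using kH by (intro exI[of _ ?k]) auto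
qed

text \<open>Composing h with v before and u after gives a homotopy, since chain maps can be moved
  past the differentials. The two-sided form is what the nested composites in transitivity
  need.\<close>

lemma homotopic_cmp:
  assumes X: "complex_on C 0 (Suc n) X" and Y: "complex_on C 0 (Suc n) Y"
    and W: "complex_on C 0 (Suc n) W" and Z: "complex_on C 0 (Suc n) Z"
    and v: "chain_map_on C 0 (Suc n) W X v" and u: "chain_map_on C 0 (Suc n) Y Z u"
    and g: "\<And>i. i \<le> Suc n \<Longrightarrow> g i \<in> H (obj X i) (obj Y i)"
    and fg: "homotopic C n X Y f g"
  shows "homotopic C n W Z (\<lambda>i. u i \<cdot> (f i \<cdot> v i)) (\<lambda>i. u i \<cdot> (g i \<cdot> v i))"
proof -
  obtain h where h: "\<And>i. i \<le> n \<Longrightarrow> h i \<in> H (obj X (Suc i)) (obj Y i)"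
    "\<And>i. i \<le> Suc n \<Longrightarrow> f i = g i \<boxplus>\<^bsub>obj X i,obj Y i\<^esub> homotopy_term C n X Y h i"
    using fg unfolding homotopic_iff[OF X Y] by blast
  note uH = chain_map_Hom[OF u Y Z] and vH = chain_map_Hom[OF v W X]
  note dX = complex_diff[OF X] and dY = complex_diff[OF Y] and dW = complex_diff[OF W] and dZ = complex_diff[OF Z]
  let ?k = "\<lambda>i. u i \<cdot> (h i \<cdot> v (Suc i))"
  note tH = homotopy_term_Hom[OF X Y h(1)]
  have kH: "?k i \<in> H (obj W (Suc i)) (obj Z i)" if "i \<le> n" for i
    using that by (intro cmp_Hom[OF cmp_Hom[OF vH h(1)] uH]) auto
  have A: "u i \<cdot> (h i \<cdot> diff X i \<cdot> v i) = ?k i \<cdot> diff W i" if "i \<le> n" for i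
  proof -
    have "?k i \<cdot> diff W i = u i \<cdot> (h i \<cdot> (v (Suc i) \<cdot> diff W i))"
      using that assoc[OF dW[of i] cmp_Hom[OF vH[of "Suc i"] h(1)[of i]] uH[of i]] assoc[OF dW[of i] vH[of "Suc i"] h(1)[of i]] by simp
    thus ?thesis using that chain_map_comm[OF v that] assoc[OF vH[of i] dX[of i] h(1)[of i]] by simp
  qed
  have B: "u (Suc i) \<cdot> (diff Y i \<cdot> h i \<cdot> v (Suc i)) = diff Z i \<cdot> ?k i" if "i \<le> n" for i
  proof -
    have "u (Suc i) \<cdot> (diff Y i \<cdot> h i \<cdot> v (Suc i)) = u (Suc i) \<cdot> diff Y i \<cdot> (h i \<cdot> v (Suc i))"
      using that assoc[OF vH[of "Suc i"] h(1)[of i] dY[of i]]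
        assoc[OF cmp_Hom[OF vH[of "Suc i"] h(1)[of i]] dY[of i] uH[of "Suc i"]] by simp
    thus ?thesis using that chain_map_comm[OF u that] assoc[OF cmp_Hom[OF vH[of "Suc i"] h(1)[of i]] uH[of i] dZ[of i]] by simp
  qed
  have kt: "homotopy_term C n W Z ?k i = u i \<cdot> (homotopy_term C n X Y h i \<cdot> v i)" if "i \<le> Suc n" for i
  proof -
    from that consider "i = 0" | j where "i = Suc j" "j < n" | "i = Suc n" by (cases i) (auto simp: le_less)
    thus ?thesis
    proof cases
      case 2
      have H1: "diff Y j \<cdot> h j \<in> H (obj X i) (obj Y i)" "h i \<cdot> diff X i \<in> H (obj X i) (obj Y i)"
        using 2 cmp_Hom[OF h(1)[of j] dY[of j]] cmp_Hom[OF dX[of i] h(1)[of i]] by auto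
      have vi: "v i \<in> H (obj W i) (obj X i)" and ui: "u i \<in> H (obj Y i) (obj Z i)" using uH vH that by auto
      have "u i \<cdot> ((diff Y j \<cdot> h j \<boxplus>\<^bsub>obj X i,obj Y i\<^esub> h i \<cdot> diff X i) \<cdot> v i) =
          u i \<cdot> (diff Y j \<cdot> h j \<cdot> v i) \<boxplus>\<^bsub>obj W i,obj Z i\<^esub> u i \<cdot> (h i \<cdot> diff X i \<cdot> v i)"
        using distl[OF vi H1] distr[OF cmp_Hom[OF vi H1(1)] cmp_Hom[OF vi H1(2)] ui] by simp
      thus ?thesis using 2 A[of i] B[of j] by (simp add: homotopy_term_def)
    qed (use A[of 0] B[of n] in \<open>auto simp: homotopy_term_def\<close>)
  qed
  have "u i \<cdot> (f i \<cdot> v i) = u i \<cdot> (g i \<cdot> v i) \<boxplus>\<^bsub>obj W i,obj Z i\<^esub> homotopy_term C n W Z ?k i"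
    if "i \<le> Suc n" for i
    using h(2)[OF that] kt[OF that] distl[OF vH[OF that] g[OF that] tH[OF _ that]]
      distr[OF cmp_Hom[OF vH[OF that] g[OF that]] cmp_Hom[OF vH[OF that] tH[OF _ that]] uH[OF that]] by simp
  thus ?thesis unfolding homotopic_iff[OF W Z] using kH by (intro exI[of _ ?k]) auto
qed

lemma homotopic_cong:
  assumes X: "complex_on C 0 (Suc n) X" and Y: "complex_on C 0 (Suc n) Y"
    and "\<And>i. i \<le> Suc n \<Longrightarrow> f i = f' i" "\<And>i. i \<le> Suc n \<Longrightarrow> g i = g' i"
  shows "homotopic C n X Y f g \<longleftrightarrow> homotopic C n X Y f' g'"
  unfolding homotopic_iff[OF X Y] using assms(3,4) by simp

lemma hequiv_refl: assumes X: "complex_on C 0 (Suc n) X" shows "hequiv C n X X"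
proof -
  have "homotopic C n X X (\<lambda>i. idt C (obj X i) \<cdot> idt C (obj X i)) (\<lambda>i. idt C (obj X i))"
    using homotopic_cong[OF X X, of "\<lambda>i. idt C (obj X i) \<cdot> idt C (obj X i)" "\<lambda>i. idt C (obj X i)"]
      homotopic_refl[OF X X, of "\<lambda>i. idt C (obj X i)"] idl[OF id_Hom] complex_obj[OF X] id_Hom by simp
  thus ?thesis unfolding hequiv_def using chain_map_id[OF X]
    by (intro exI[of _ "\<lambda>i. idt C (obj X i)"]) (auto simp: end_fixing_map_def)
qed

lemma hequiv_sym: "hequiv C n X Y \<Longrightarrow> hequiv C n Y X"
  by (auto simp: hequiv_def)

lemma hequiv_trans:
  assumes X: "complex_on C 0 (Suc n) X" and Y: "complex_on C 0 (Suc n) Y" and Z: "complex_on C 0 (Suc n) Z"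
    and XY: "hequiv C n X Y" and YZ: "hequiv C n Y Z"
  shows "hequiv C n X Z"
proof -
  \<comment> \<open>Stated for arbitrary ends because it is applied twice, once for X and once, with
    X and Z and the maps exchanged, for Z.\<close>
  have comp: "homotopic C n X X (\<lambda>i. (g i \<cdot> g' i) \<cdot> (f' i \<cdot> f i)) (\<lambda>i. idt C (obj X i))"
    if X: "complex_on C 0 (Suc n) X" and Z: "complex_on C 0 (Suc n) Z"
      and f: "chain_map_on C 0 (Suc n) X Y f" and g: "chain_map_on C 0 (Suc n) Y X g"
      and f': "chain_map_on C 0 (Suc n) Y Z f'" and g': "chain_map_on C 0 (Suc n) Z Y g'"
      and h: "homotopic C n X X (\<lambda>i. g i \<cdot> f i) (\<lambda>i. idt C (obj X i))"
      and h': "homotopic C n Y Y (\<lambda>i. g' i \<cdot> f' i) (\<lambda>i. idt C (obj Y i))" for X Z f g f' g'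
  proof -
    note fH = chain_map_Hom[OF f X Y] and gH = chain_map_Hom[OF g Y X]
    note f'H = chain_map_Hom[OF f' Y Z] and g'H = chain_map_Hom[OF g' Z Y]
    have a: "(g i \<cdot> g' i) \<cdot> (f' i \<cdot> f i) = g i \<cdot> ((g' i \<cdot> f' i) \<cdot> f i)" if "i \<le> Suc n" for i
      using assoc[OF cmp_Hom[OF fH f'H] g'H gH] assoc[OF fH f'H g'H] that by simp
    have b: "g i \<cdot> (idt C (obj Y i) \<cdot> f i) = g i \<cdot> f i" if "i \<le> Suc n" for i
      using idl[OF fH] that by simp
    have "homotopic C n X X (\<lambda>i. g i \<cdot> ((g' i \<cdot> f' i) \<cdot> f i)) (\<lambda>i. g i \<cdot> (idt C (obj Y i) \<cdot> f i))"
      by (rule homotopic_cmp[OF Y Y X X f g _ h']) (simp add: id_Hom complex_obj[OF Y])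
    hence "homotopic C n X X (\<lambda>i. (g i \<cdot> g' i) \<cdot> (f' i \<cdot> f i)) (\<lambda>i. g i \<cdot> f i)"
      using iffD2[OF homotopic_cong[OF X X, of "\<lambda>i. (g i \<cdot> g' i) \<cdot> (f' i \<cdot> f i)"
          "\<lambda>i. g i \<cdot> ((g' i \<cdot> f' i) \<cdot> f i)" "\<lambda>i. g i \<cdot> f i" "\<lambda>i. g i \<cdot> (idt C (obj Y i) \<cdot> f i)"]]
        a b[symmetric] by blast
    thus ?thesis using homotopic_trans[OF X X _ _ h] id_Hom[OF complex_obj[OF X]] by simp
  qed
  obtain f g where f: "end_fixing_map C n X Y f" and g: "end_fixing_map C n Y X g"
    and h: "homotopic C n X X (\<lambda>i. g i \<cdot> f i) (\<lambda>i. idt C (obj X i))"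
      "homotopic C n Y Y (\<lambda>i. f i \<cdot> g i) (\<lambda>i. idt C (obj Y i))" using XY unfolding hequiv_def by blast
  obtain f' g' where f': "end_fixing_map C n Y Z f'" and g': "end_fixing_map C n Z Y g'"
    and h': "homotopic C n Y Y (\<lambda>i. g' i \<cdot> f' i) (\<lambda>i. idt C (obj Y i))"
      "homotopic C n Z Z (\<lambda>i. f' i \<cdot> g' i) (\<lambda>i. idt C (obj Z i))" using YZ unfolding hequiv_def by blast
  note F = f[unfolded end_fixing_map_def] and G = g[unfolded end_fixing_map_def]
  note F' = f'[unfolded end_fixing_map_def] and G' = g'[unfolded end_fixing_map_def]
  have o: "obj Y 0 \<in> Ob C" "obj Y (Suc n) \<in> Ob C" using complex_obj[OF Y] by auto
  have "end_fixing_map C n X Z (\<lambda>i. f' i \<cdot> f i)" unfolding end_fixing_map_def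
    using F F' chain_map_cmp[of n X Y f Z f'] X Y Z idl[OF id_Hom[OF o(1)]] idl[OF id_Hom[OF o(2)]] by simp
  moreover have "end_fixing_map C n Z X (\<lambda>i. g i \<cdot> g' i)" unfolding end_fixing_map_def
    using G G' chain_map_cmp[of n Z Y g' X g] X Y Z idl[OF id_Hom[OF o(1)]] idl[OF id_Hom[OF o(2)]] by simp
  ultimately show ?thesis unfolding hequiv_def
    using comp[OF X Z, of f g f' g'] comp[OF Z X, of g' f' g f] F G F' G' h h' by blast
qed

lemma hclass_eq:
  assumes X: "complex_on C 0 (Suc n) X" and Y: "complex_on C 0 (Suc n) Y" and XY: "hequiv C n X Y"
  shows "hclass C n X = hclass C n Y"
  unfolding hclass_def using hequiv_trans[OF X Y _ XY] hequiv_trans[OF Y X _ hequiv_sym[OF XY]] by blast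

text \<open>Both composites are the identity in degree 0, and out of an n-cokernel sequence a chain
  map is determined up to homotopy by that component. So end-fixing maps in both directions are
  already inverse to each other up to homotopy.\<close>

lemma con_exact_hequiv:
  assumes X: "con_exact C n X" and Y: "con_exact C n Y"
    and f: "end_fixing_map C n X Y f" and g: "end_fixing_map C n Y X g"
  shows "hequiv C n X Y"
proof -
  have *: "homotopic C n X X (\<lambda>i. g i \<cdot> f i) (\<lambda>i. idt C (obj X i))"
    if X: "con_exact C n X" and Y: "con_exact C n Y"
      and f: "end_fixing_map C n X Y f" and g: "end_fixing_map C n Y X g" for X Y f g
  proof -
    note cX = con_exact_complex[OF X] and cY = con_exact_complex[OF Y]
    have F: "chain_map_on C 0 (Suc n) X Y f" "f 0 = idt C (obj X 0)"
      and G: "chain_map_on C 0 (Suc n) Y X g" "g 0 = idt C (obj X 0)"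
      using f g by (auto simp: end_fixing_map_def)
    show ?thesis
      by (rule con_exact_homotopic[OF X cX chain_map_cmp[OF F(1) G(1) cX cY cX] chain_map_id[OF cX]])
        (simp add: F G idl[OF id_Hom[OF complex_obj[OF cX, of 0]]])
  qed
  show ?thesis unfolding hequiv_def using f g *[OF X Y f g] *[OF Y X g f] by blast
qed

end

section \<open>Extensions and conflations in \<open>\<A>\<close>\<close>

locale extension_category = additive_category C + additive_bifunctor C E
  for C :: "('o, 'm) cat" and E :: "('o, 'm, 'e) bifunctor"
begin

abbreviation ext ("\<E>") where "\<E> K A \<equiv> carrier (Ext E K A)"

abbreviation ext_zero ("\<o>\<^bsub>_,_\<^esub>") where "\<o>\<^bsub>K,A\<^esub> \<equiv> \<one>\<^bsub>Ext E K A\<^esub>"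

lemma ext_zero_mem: assumes "K \<in> Ob C" "A \<in> Ob C" shows "\<o>\<^bsub>K,A\<^esub> \<in> \<E> K A"
proof -
  interpret comm_group "Ext E K A" by (rule Ext_group[OF assms])
  show ?thesis by simp
qed

lemma push_mem: "\<lbrakk>a \<in> H A A'; K \<in> Ob C; \<delta> \<in> \<E> K A\<rbrakk> \<Longrightarrow> push E a \<delta> \<in> \<E> K A'"
  using push_hom[of K A A' a] by (auto simp: Hom_def hom_def)

lemma pull_mem: "\<lbrakk>c \<in> H K' K; A \<in> Ob C; \<delta> \<in> \<E> K A\<rbrakk> \<Longrightarrow> pull E c \<delta> \<in> \<E> K' A"
  using pull_hom[of K K' A c] by (auto simp: Hom_def hom_def)

lemma push_mult: "\<lbrakk>a \<in> H A A'; K \<in> Ob C; \<delta> \<in> \<E> K A; \<epsilon> \<in> \<E> K A\<rbrakk>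
    \<Longrightarrow> push E a (\<delta> \<otimes>\<^bsub>Ext E K A\<^esub> \<epsilon>) = push E a \<delta> \<otimes>\<^bsub>Ext E K A'\<^esub> push E a \<epsilon>"
  using push_hom[of K A A' a] by (auto simp: Hom_def hom_def)

lemma pull_mult: "\<lbrakk>c \<in> H K' K; A \<in> Ob C; \<delta> \<in> \<E> K A; \<epsilon> \<in> \<E> K A\<rbrakk>
    \<Longrightarrow> pull E c (\<delta> \<otimes>\<^bsub>Ext E K A\<^esub> \<epsilon>) = pull E c \<delta> \<otimes>\<^bsub>Ext E K' A\<^esub> pull E c \<epsilon>"
  using pull_hom[of K K' A c] by (auto simp: Hom_def hom_def)

lemma push_one: assumes "a \<in> H A A'" "K \<in> Ob C" shows "push E a \<o>\<^bsub>K,A\<^esub> = \<o>\<^bsub>K,A'\<^esub>"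
proof -
  interpret group_hom "Ext E K A" "Ext E K A'" "push E a"
    using assms push_hom[of K A A' a] Ext_group[of K A] Ext_group[of K A']
    by (auto simp: Hom_def group_hom_def group_hom_axioms_def comm_group_def)
  show ?thesis by simp
qed

lemma pull_one: assumes "c \<in> H K' K" "A \<in> Ob C" shows "pull E c \<o>\<^bsub>K,A\<^esub> = \<o>\<^bsub>K',A\<^esub>"
proof -
  interpret group_hom "Ext E K A" "Ext E K' A" "pull E c"
    using assms pull_hom[of K K' A c] Ext_group[of K A] Ext_group[of K' A]
    by (auto simp: Hom_def group_hom_def group_hom_axioms_def comm_group_def)
  show ?thesis by simp
qed

lemma push_push: "\<lbrakk>a \<in> H A A'; a' \<in> H A' A''; K \<in> Ob C; \<delta> \<in> \<E> K A\<rbrakk>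
    \<Longrightarrow> push E a' (push E a \<delta>) = push E (a' \<cdot> a) \<delta>"
  using push_cmp[of K A A' A'' a a' \<delta>] by (auto simp: Hom_def)

lemma pull_pull: "\<lbrakk>c \<in> H K' K; c' \<in> H K'' K'; A \<in> Ob C; \<delta> \<in> \<E> K A\<rbrakk>
    \<Longrightarrow> pull E c' (pull E c \<delta>) = pull E (c \<cdot> c') \<delta>"
  using pull_cmp[of K K' K'' A c c' \<delta>] by (auto simp: Hom_def)

lemma push_pull_swap: "\<lbrakk>a \<in> H A A'; c \<in> H K' K; \<delta> \<in> \<E> K A\<rbrakk>
    \<Longrightarrow> push E a (pull E c \<delta>) = pull E c (push E a \<delta>)"
  using push_pull[of K K' A A' a c \<delta>] by (auto simp: Hom_def)

lemma push_plus: "\<lbrakk>a \<in> H A A'; b \<in> H A A'; K \<in> Ob C; \<delta> \<in> \<E> K A\<rbrakk>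
    \<Longrightarrow> push E (a \<boxplus>\<^bsub>A,A'\<^esub> b) \<delta> = push E a \<delta> \<otimes>\<^bsub>Ext E K A'\<^esub> push E b \<delta>"
  using push_add[of K A A' a b \<delta>] by (auto simp: Hom_def)

lemma pull_plus: "\<lbrakk>c \<in> H K' K; d \<in> H K' K; A \<in> Ob C; \<delta> \<in> \<E> K A\<rbrakk>
    \<Longrightarrow> pull E (c \<boxplus>\<^bsub>K',K\<^esub> d) \<delta> = pull E c \<delta> \<otimes>\<^bsub>Ext E K' A\<^esub> pull E d \<delta>"
  using pull_add[of K K' A c d \<delta>] by (auto simp: Hom_def)

lemma ext_mult_one: assumes "K \<in> Ob C" "A \<in> Ob C" "\<delta> \<in> \<E> K A"
  shows "\<delta> \<otimes>\<^bsub>Ext E K A\<^esub> \<o>\<^bsub>K,A\<^esub> = \<delta>" "\<o>\<^bsub>K,A\<^esub> \<otimes>\<^bsub>Ext E K A\<^esub> \<delta> = \<delta>"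
proof -
  interpret comm_group "Ext E K A" by (rule Ext_group[OF assms(1,2)])
  show "\<delta> \<otimes>\<^bsub>Ext E K A\<^esub> \<o>\<^bsub>K,A\<^esub> = \<delta>" "\<o>\<^bsub>K,A\<^esub> \<otimes>\<^bsub>Ext E K A\<^esub> \<delta> = \<delta>" using assms by simp_all
qed

lemma push_sub_one: assumes "a \<in> H A A'" "b \<in> H A A'" "K \<in> Ob C" "\<delta> \<in> \<E> K A"
  shows "push E (a \<boxminus>\<^bsub>A,A'\<^esub> b) \<delta> = \<o>\<^bsub>K,A'\<^esub> \<longleftrightarrow> push E a \<delta> = push E b \<delta>"
proof -
  interpret comm_group "Ext E K A'" using Ext_group assms Hom_cod by blast
  have "push E (a \<boxminus>\<^bsub>A,A'\<^esub> b) \<delta> \<otimes>\<^bsub>Ext E K A'\<^esub> push E b \<delta> = push E a \<delta>"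
    using push_plus[OF sub_Hom[OF assms(1,2)] assms(2-4)] add_sub(4)[OF assms(1,2)] by simp
  thus ?thesis
    using push_mem[OF assms(1,3,4)] push_mem[OF assms(2-4)] push_mem[OF sub_Hom[OF assms(1,2)] assms(3,4)]
    by (metis r_cancel_one)
qed

lemma push_zero: assumes "A \<in> Ob C" "A' \<in> Ob C" "K \<in> Ob C" "\<delta> \<in> \<E> K A"
  shows "push E \<zero>\<^bsub>A,A'\<^esub> \<delta> = \<o>\<^bsub>K,A'\<^esub>"
  using push_sub_one[OF zero_Hom[OF assms(1,2)] zero_Hom[OF assms(1,2)] assms(3,4)]
    sub_self[OF zero_Hom[OF assms(1,2)]] by simp

lemma pull_sub_one: assumes "c \<in> H K' K" "d \<in> H K' K" "A \<in> Ob C" "\<delta> \<in> \<E> K A"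
  shows "pull E (c \<boxminus>\<^bsub>K',K\<^esub> d) \<delta> = \<o>\<^bsub>K',A\<^esub> \<longleftrightarrow> pull E c \<delta> = pull E d \<delta>"
proof -
  interpret comm_group "Ext E K' A" using Ext_group assms Hom_dom by blast
  have "pull E (c \<boxminus>\<^bsub>K',K\<^esub> d) \<delta> \<otimes>\<^bsub>Ext E K' A\<^esub> pull E d \<delta> = pull E c \<delta>"
    using pull_plus[OF sub_Hom[OF assms(1,2)] assms(2-4)] add_sub(4)[OF assms(1,2)] by simp
  thus ?thesis
    using pull_mem[OF assms(1,3,4)] pull_mem[OF assms(2-4)] pull_mem[OF sub_Hom[OF assms(1,2)] assms(3,4)]
    by (metis r_cancel_one)
qed

lemma pull_zero: assumes "K \<in> Ob C" "K' \<in> Ob C" "A \<in> Ob C" "\<delta> \<in> \<E> K A"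
  shows "pull E \<zero>\<^bsub>K',K\<^esub> \<delta> = \<o>\<^bsub>K',A\<^esub>"
  using pull_sub_one[OF zero_Hom[OF assms(2,1)] zero_Hom[OF assms(2,1)] assms(3,4)]
    sub_self[OF zero_Hom[OF assms(2,1)]] by simp

text \<open>\<sigma> is the pair (\<epsilon>, \<delta>) under additivity of \<open>\<E>\<close> in
  the first argument, that is, the sum of the pullbacks along the projections. The last conclusion
  is the naturality in A that the applications use: a pushforward of \<sigma> vanishes once those of
  both components do.\<close>

lemma pull_dsum:
  assumes O: "K \<in> Ob C" "L \<in> Ob C" "A \<in> Ob C" and \<epsilon>: "\<epsilon> \<in> \<E> K A" and \<delta>: "\<delta> \<in> \<E> L A"
  obtains \<sigma> where "\<sigma> \<in> \<E> (dsum C K L) A" "pull E (i1 K L) \<sigma> = \<epsilon>" "pull E (i2 K L) \<sigma> = \<delta>"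
    "\<And>a T. \<lbrakk>a \<in> H A T; push E a \<epsilon> = \<o>\<^bsub>K,T\<^esub>; push E a \<delta> = \<o>\<^bsub>L,T\<^esub>\<rbrakk>
      \<Longrightarrow> push E a \<sigma> = \<o>\<^bsub>dsum C K L,T\<^esub>"
proof -
  note S = dsum_Ob[OF O(1,2)] and B = bip_Hom[OF O(1,2)] and e = bip_eq[OF O(1,2)]
  interpret G: comm_group "Ext E (dsum C K L) A" by (rule Ext_group[OF S O(3)])
  let ?\<sigma> = "pull E (p1 K L) \<epsilon> \<otimes>\<^bsub>Ext E (dsum C K L) A\<^esub> pull E (p2 K L) \<delta>"
  note m1 = pull_mem[OF B(3) O(3) \<epsilon>] and m2 = pull_mem[OF B(4) O(3) \<delta>]
  show ?thesis
  proof (rule that[of ?\<sigma>])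
    show "?\<sigma> \<in> \<E> (dsum C K L) A" using m1 m2 by simp
    show "pull E (i1 K L) ?\<sigma> = \<epsilon>"
      using pull_mult[OF B(1) O(3) m1 m2] pull_pull[OF B(3,1) O(3) \<epsilon>] pull_pull[OF B(4,1) O(3) \<delta>] e
        pull_id[OF O(1,3) \<epsilon>] pull_zero[OF O(2,1,3) \<delta>] ext_mult_one[OF O(1,3) \<epsilon>] by simp
    show "pull E (i2 K L) ?\<sigma> = \<delta>"
      using pull_mult[OF B(2) O(3) m1 m2] pull_pull[OF B(3,2) O(3) \<epsilon>] pull_pull[OF B(4,2) O(3) \<delta>] e
        pull_id[OF O(2,3) \<delta>] pull_zero[OF O(1,2,3) \<epsilon>] ext_mult_one[OF O(2,3) \<delta>] by simp
    fix a T assume a: "a \<in> H A T" "push E a \<epsilon> = \<o>\<^bsub>K,T\<^esub>" "push E a \<delta> = \<o>\<^bsub>L,T\<^esub>"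
    note T = Hom_cod[OF a(1)]
    show "push E a ?\<sigma> = \<o>\<^bsub>dsum C K L,T\<^esub>"
      using push_mult[OF a(1) S m1 m2] push_pull_swap[OF a(1) B(3) \<epsilon>] push_pull_swap[OF a(1) B(4) \<delta>] a
        pull_one[OF B(3) T] pull_one[OF B(4) T] ext_mult_one[OF S T ext_zero_mem[OF S T]] by simp
  qed
qed

lemma push_dsum:
  assumes O: "A \<in> Ob C" "B \<in> Ob C" "K \<in> Ob C" and \<epsilon>: "\<epsilon> \<in> \<E> K A" and \<delta>: "\<delta> \<in> \<E> K B"
  obtains \<sigma> where "\<sigma> \<in> \<E> K (dsum C A B)" "push E (p1 A B) \<sigma> = \<epsilon>" "push E (p2 A B) \<sigma> = \<delta>"
    "\<And>c T. \<lbrakk>c \<in> H T K; pull E c \<epsilon> = \<o>\<^bsub>T,A\<^esub>; pull E c \<delta> = \<o>\<^bsub>T,B\<^esub>\<rbrakk>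
      \<Longrightarrow> pull E c \<sigma> = \<o>\<^bsub>T,dsum C A B\<^esub>"
proof -
  note S = dsum_Ob[OF O(1,2)] and B = bip_Hom[OF O(1,2)] and e = bip_eq[OF O(1,2)]
  interpret G: comm_group "Ext E K (dsum C A B)" by (rule Ext_group[OF O(3) S])
  let ?\<sigma> = "push E (i1 A B) \<epsilon> \<otimes>\<^bsub>Ext E K (dsum C A B)\<^esub> push E (i2 A B) \<delta>"
  note m1 = push_mem[OF B(1) O(3) \<epsilon>] and m2 = push_mem[OF B(2) O(3) \<delta>]
  show ?thesis
  proof (rule that[of ?\<sigma>])
    show "?\<sigma> \<in> \<E> K (dsum C A B)" using m1 m2 by simp
    show "push E (p1 A B) ?\<sigma> = \<epsilon>"
      using push_mult[OF B(3) O(3) m1 m2] push_push[OF B(1,3) O(3) \<epsilon>] push_push[OF B(2,3) O(3) \<delta>] e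
        push_id[OF O(3,1) \<epsilon>] push_zero[OF O(2,1,3) \<delta>] ext_mult_one[OF O(3,1) \<epsilon>] by simp
    show "push E (p2 A B) ?\<sigma> = \<delta>"
      using push_mult[OF B(4) O(3) m1 m2] push_push[OF B(1,4) O(3) \<epsilon>] push_push[OF B(2,4) O(3) \<delta>] e
        push_id[OF O(3,2) \<delta>] push_zero[OF O(1,2,3) \<epsilon>] ext_mult_one[OF O(3,2) \<delta>] by simp
    fix c T assume c: "c \<in> H T K" "pull E c \<epsilon> = \<o>\<^bsub>T,A\<^esub>" "pull E c \<delta> = \<o>\<^bsub>T,B\<^esub>"
    note T = Hom_dom[OF c(1)]
    show "pull E c ?\<sigma> = \<o>\<^bsub>T,dsum C A B\<^esub>"
      using pull_mult[OF c(1) S m1 m2] push_pull_swap[OF B(1) c(1) \<epsilon>] push_pull_swap[OF B(2) c(1) \<delta>] c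
        push_one[OF B(1) T] push_one[OF B(2) T] ext_mult_one[OF T S ext_zero_mem[OF T S]] by simp
  qed
qed

end

text \<open>The self-dual part of what is needed about the conflations of \<open>\<A>\<close>: \<open>\<D> X \<delta>\<close> means
  that \<open>X\<close> realizes \<open>\<delta>\<close>. The last two assumptions replace the axiom (EA1), which for
  \<open>n \<ge> 2\<close> is a consequence of the others.\<close>

locale extension_calculus = extension_category C E
  for C :: "('o, 'm) cat" and E :: "('o, 'm, 'e) bifunctor" +
  fixes n :: nat and \<D> :: "('o, 'm) cpx \<Rightarrow> 'e \<Rightarrow> bool"
  assumes n_pos: "n > 0"
    and D_con: "\<D> X \<delta> \<Longrightarrow> con_exact C n X"
    and D_cov: "\<D> X \<delta> \<Longrightarrow> cov_exact C n X"
    and D_ext: "\<D> X \<delta> \<Longrightarrow> \<delta> \<in> carrier (Ext E (obj X (Suc n)) (obj X 0))"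
    and D_push: "\<D> X \<delta> \<Longrightarrow> push E (diff X 0) \<delta> = \<one>\<^bsub>Ext E (obj X (Suc n)) (obj X (Suc 0))\<^esub>"
    and D_pull: "\<D> X \<delta> \<Longrightarrow> pull E (diff X n) \<delta> = \<one>\<^bsub>Ext E (obj X n) (obj X 0)\<^esub>"
    and D_push_factor: "\<lbrakk>\<D> X \<delta>; g \<in> Hom C (obj X 0) T; push E g \<delta> = \<one>\<^bsub>Ext E (obj X (Suc n)) T\<^esub>\<rbrakk>
      \<Longrightarrow> \<exists>k\<in>Hom C (obj X (Suc 0)) T. g = k \<bullet>\<^bsub>C\<^esub> diff X 0"
    and D_pull_factor: "\<lbrakk>\<D> X \<delta>; g \<in> Hom C T (obj X (Suc n)); pull E g \<delta> = \<one>\<^bsub>Ext E T (obj X 0)\<^esub>\<rbrakk>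
      \<Longrightarrow> \<exists>k\<in>Hom C T (obj X n). g = diff X n \<bullet>\<^bsub>C\<^esub> k"
    and D_push_onto: "\<lbrakk>\<D> X \<delta>; T \<in> Ob C; \<eta> \<in> carrier (Ext E (obj X (Suc n)) T);
        pull E (diff X n) \<eta> = \<one>\<^bsub>Ext E (obj X n) T\<^esub>\<rbrakk> \<Longrightarrow> \<exists>g\<in>Hom C (obj X 0) T. \<eta> = push E g \<delta>"
    and D_pull_onto: "\<lbrakk>\<D> X \<delta>; T \<in> Ob C; \<eta> \<in> carrier (Ext E T (obj X 0));
        push E (diff X 0) \<eta> = \<one>\<^bsub>Ext E T (obj X (Suc 0))\<^esub>\<rbrakk> \<Longrightarrow> \<exists>g\<in>Hom C T (obj X (Suc n)). \<eta> = pull E g \<delta>"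
    and D_push_mid: "\<lbrakk>\<D> X \<delta>; T \<in> Ob C; \<eta> \<in> carrier (Ext E T (obj X (Suc 0)));
        push E (diff X (Suc 0)) \<eta> = \<one>\<^bsub>Ext E T (obj X (Suc (Suc 0)))\<^esub>\<rbrakk>
      \<Longrightarrow> \<exists>\<epsilon>\<in>carrier (Ext E T (obj X 0)). \<eta> = push E (diff X 0) \<epsilon>"
    and D_pull_mid: "\<lbrakk>\<D> X \<delta>; T \<in> Ob C; \<eta> \<in> carrier (Ext E (obj X n) T);
        pull E (diff X (n - Suc 0)) \<eta> = \<one>\<^bsub>Ext E (obj X (n - Suc 0)) T\<^esub>\<rbrakk>
      \<Longrightarrow> \<exists>\<epsilon>\<in>carrier (Ext E (obj X (Suc n)) T). \<eta> = pull E (diff X n) \<epsilon>"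
    and D_ex: "\<lbrakk>K \<in> Ob C; A \<in> Ob C; \<delta> \<in> carrier (Ext E K A)\<rbrakk>
      \<Longrightarrow> \<exists>X. \<D> X \<delta> \<and> obj X 0 = A \<and> obj X (Suc n) = K"
    and D_lift: "\<lbrakk>\<D> X \<delta>; \<D> Y \<rho>; a \<in> Hom C (obj X 0) (obj Y 0); c \<in> Hom C (obj X (Suc n)) (obj Y (Suc n));
        push E a \<delta> = pull E c \<rho>\<rbrakk> \<Longrightarrow> \<exists>f. chain_map_on C 0 (Suc n) X Y f \<and> f 0 = a \<and> f (Suc n) = c"
    and D_hequiv: "\<lbrakk>\<D> X \<delta>; complex_on C 0 (Suc n) Y; hequiv C n X Y\<rbrakk> \<Longrightarrow> \<D> Y \<delta>"
    and D_first_cmp: "\<lbrakk>n = Suc 0; \<D> X \<delta>; \<D> Y \<rho>; obj Y 0 = obj X (Suc 0); \<D> V \<sigma>; obj V 0 = obj X 0;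
        t \<in> Hom C (obj V (Suc 0)) (obj Y (Suc 0)); diff Y 0 \<bullet>\<^bsub>C\<^esub> diff X 0 = t \<bullet>\<^bsub>C\<^esub> diff V 0;
        t' \<in> Hom C (obj Y (Suc 0)) (obj V (Suc 0)); diff V 0 = t' \<bullet>\<^bsub>C\<^esub> (diff Y 0 \<bullet>\<^bsub>C\<^esub> diff X 0)\<rbrakk>
      \<Longrightarrow> \<exists>W \<omega>. \<D> W \<omega> \<and> obj W 0 = obj X 0 \<and> obj W (Suc 0) = obj Y (Suc 0) \<and>
            diff W 0 = diff Y 0 \<bullet>\<^bsub>C\<^esub> diff X 0"
    and D_last_cmp: "\<lbrakk>n = Suc 0; \<D> X \<delta>; \<D> Y \<rho>; obj Y (Suc n) = obj X n; \<D> V \<sigma>; obj V (Suc n) = obj X (Suc n);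
        t \<in> Hom C (obj Y n) (obj V n); diff X n \<bullet>\<^bsub>C\<^esub> diff Y n = diff V n \<bullet>\<^bsub>C\<^esub> t;
        t' \<in> Hom C (obj V n) (obj Y n); diff V n = diff X n \<bullet>\<^bsub>C\<^esub> diff Y n \<bullet>\<^bsub>C\<^esub> t'\<rbrakk>
      \<Longrightarrow> \<exists>W \<omega>. \<D> W \<omega> \<and> obj W (Suc n) = obj X (Suc n) \<and> obj W n = obj Y n \<and>
            diff W n = diff X n \<bullet>\<^bsub>C\<^esub> diff Y n"

section \<open>Correcting chain maps and exchanging the first morphism\<close>

context additive_category
begin

text \<open>f is changed by the null-homotopic map whose homotopy has the single component h. That
  map is h d in degree n, d h in degree n + 1 and zero below; as n > 0, the component in degree 0
  survives.\<close>

lemma adjust_last: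
  assumes n: "n > 0" and X: "complex_on C 0 (Suc n) X" and Y: "complex_on C 0 (Suc n) Y"
    and f: "chain_map_on C 0 (Suc n) X Y f"
    and c: "c \<in> H (obj X (Suc n)) (obj Y (Suc n))" and h: "h \<in> H (obj X (Suc n)) (obj Y n)"
    and eq: "f (Suc n) = c \<boxplus>\<^bsub>obj X (Suc n),obj Y (Suc n)\<^esub> diff Y n \<cdot> h"
  obtains f' where "chain_map_on C 0 (Suc n) X Y f'" "f' 0 = f 0" "f' (Suc n) = c"
proof -
  obtain m where m: "n = Suc m" using n by (cases n) auto
  note fH = chain_map_Hom[OF f X Y] and dX = complex_diff[OF X] and dY = complex_diff[OF Y]
  have fn: "f n \<in> H (obj X n) (obj Y n)" and dn: "diff X n \<in> H (obj X n) (obj X (Suc n))"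
    and dYn: "diff Y n \<in> H (obj Y n) (obj Y (Suc n))" using fH dX dY by auto
  note hd = cmp_Hom[OF dn h] and dh = cmp_Hom[OF h dYn]
  define f' where "f' i = (if i = Suc n then c else if i = n then f n \<boxminus>\<^bsub>obj X n,obj Y n\<^esub> h \<cdot> diff X n else f i)" for i
  have "chain_map_on C 0 (Suc n) X Y f'"
  proof (rule chain_mapI)
    fix i assume "i \<le> Suc n" thus "f' i \<in> H (obj X i) (obj Y i)"
      using fH c sub_Hom[OF fn hd] by (auto simp: f'_def)
  next
    fix i assume i: "i \<le> n"
    consider "i = n" | "i = m" | "i < m" using i m by linarith
    thus "f' (Suc i) \<cdot> diff X i = diff Y i \<cdot> f' i"
    proof cases
      case 1
      have "diff Y n \<cdot> (f n \<boxminus>\<^bsub>obj X n,obj Y n\<^esub> h \<cdot> diff X n)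
          = f (Suc n) \<cdot> diff X n \<boxminus>\<^bsub>obj X n,obj Y (Suc n)\<^esub> diff Y n \<cdot> h \<cdot> diff X n"
        using sub_distr[OF fn hd dYn] assoc[OF dn h dYn] chain_map_comm[OF f, of n] by simp
      also have "\<dots> = c \<cdot> diff X n"
        unfolding eq distl[OF dn c dh] by (rule add_sub(1)[OF cmp_Hom[OF dn c] cmp_Hom[OF dn dh]])
      finally show ?thesis using 1 by (simp add: f'_def)
    next
      case 2
      have dm: "diff X m \<in> H (obj X m) (obj X n)" using dX[of m] m by simp
      have "h \<cdot> diff X n \<cdot> diff X m = \<zero>\<^bsub>obj X m,obj Y n\<^esub>"
        using assoc[OF dm dn h] complex_dd[OF X, of m] m cmp_zero[OF h Hom_dom[OF dm]] by simp
      hence "(f n \<boxminus>\<^bsub>obj X n,obj Y n\<^esub> h \<cdot> diff X n) \<cdot> diff X m = f n \<cdot> diff X m"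
        using sub_distl[OF dm fn hd] add_zero(3)[OF cmp_Hom[OF dm fn]] by simp
      thus ?thesis using 2 m chain_map_comm[OF f, of m] by (simp add: f'_def)
    next
      case 3
      thus ?thesis using m chain_map_comm[OF f, of i] by (simp add: f'_def)
    qed
  qed
  thus ?thesis using that[of f'] n by (simp add: f'_def)
qed

text \<open>Factorization in the inner degrees and cancellation in the last one are merged, because
  in the exchange complex either may follow the modified degrees, depending on n.\<close>

lemma con_exact_step:
  assumes V: "con_exact C n V" and i: "i \<le> n" and g: "g \<in> H (obj V (Suc i)) T"
    and gd: "g \<cdot> diff V i = \<zero>\<^bsub>obj V i,T\<^esub>"
  shows "i < n \<and> (\<exists>k\<in>H (obj V (Suc (Suc i))) T. g = k \<cdot> diff V (Suc i)) \<or> i = n \<and> g = \<zero>\<^bsub>obj V (Suc i),T\<^esub>"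
  using con_exact_factor[OF V _ g gd] con_exact_epi[OF V, of g T] i g gd by (cases "i = n") auto

end

text \<open>If \<open>w : V\<^sub>0 \<rightarrow> D\<close> and the first differential of \<open>V\<close> factor through each other by means of
  \<open>t : V\<^sub>1 \<rightarrow> D\<close> and \<open>t' : D \<rightarrow> V\<^sub>1\<close>, and \<open>1 - t' t = r d\<^sub>1\<close>, then \<open>V\<close> is homotopy equivalent
  (not fixing the last term if \<open>n = 2\<close>) to the following complex with first differential \<open>w\<close>.\<close>

fun exchange_obj :: "('o, 'm) cat \<Rightarrow> ('o, 'm) cpx \<Rightarrow> 'o \<Rightarrow> nat \<Rightarrow> 'o" where
  "exchange_obj C V D 0 = obj V 0"
| "exchange_obj C V D (Suc 0) = D"
| "exchange_obj C V D (Suc (Suc 0)) = dsum C (obj V (Suc (Suc 0))) D"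
| "exchange_obj C V D (Suc (Suc (Suc 0))) = dsum C (obj V (Suc (Suc (Suc 0)))) (obj V (Suc 0))"
| "exchange_obj C V D (Suc (Suc (Suc (Suc i)))) = obj V (Suc (Suc (Suc (Suc i))))"

fun exchange_diff :: "('o, 'm) cat \<Rightarrow> ('o, 'm) cpx \<Rightarrow> 'o \<Rightarrow> 'm \<Rightarrow> 'm \<Rightarrow> 'm \<Rightarrow> 'm \<Rightarrow> nat \<Rightarrow> 'm" where
  "exchange_diff C V D w t t' r 0 = w"
| "exchange_diff C V D w t t' r (Suc 0) = colm C D (obj V (Suc (Suc 0))) D
     (diff V (Suc 0) \<bullet>\<^bsub>C\<^esub> t') (subm C D D (idt C D) (t \<bullet>\<^bsub>C\<^esub> t'))"
| "exchange_diff C V D w t t' r (Suc (Suc 0)) =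
     matm C (obj V (Suc (Suc 0))) D (obj V (Suc (Suc (Suc 0)))) (obj V (Suc 0))
       (diff V (Suc (Suc 0))) (zerom C D (obj V (Suc (Suc (Suc 0)))))
       (negm C (obj V (Suc (Suc 0))) (obj V (Suc 0)) r) t'"
| "exchange_diff C V D w t t' r (Suc (Suc (Suc 0))) =
     rowm C (obj V (Suc (Suc (Suc 0)))) (obj V (Suc 0)) (obj V (Suc (Suc (Suc (Suc 0)))))
       (diff V (Suc (Suc (Suc 0)))) (zerom C (obj V (Suc 0)) (obj V (Suc (Suc (Suc (Suc 0))))))"
| "exchange_diff C V D w t t' r (Suc (Suc (Suc (Suc i)))) = diff V (Suc (Suc (Suc (Suc i))))"

text \<open>The differentials are read off from maps out of D. If g kills w, then g t kills
  \<open>diff V 0\<close>, so g t = a d with d = \<open>diff V (Suc 0)\<close>, and g = a (d t') + g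
  (1 - t t'): this is the second differential. The pairs (a, b) killing it are parametrized by pairs
  (x, y), which gives the third one, and the pairs (x, y) killing that have y = 0, so from there on
  V itself continues the sequence.\<close>

lemma (in additive_category) exchange_con_exact:
  assumes V: "con_exact C n V" and n: "Suc 0 < n"
    and w: "w \<in> H (obj V 0) D" and t: "t \<in> H (obj V (Suc 0)) D" and t': "t' \<in> H D (obj V (Suc 0))"
    and wt: "w = t \<cdot> diff V 0" and dt: "diff V 0 = t' \<cdot> w"
    and r: "r \<in> H (obj V (Suc (Suc 0))) (obj V (Suc 0))"
    and rt: "idt C (obj V (Suc 0)) \<boxminus>\<^bsub>obj V (Suc 0),obj V (Suc 0)\<^esub> t' \<cdot> t = r \<cdot> diff V (Suc 0)"
  shows "con_exact C n \<lparr>obj = exchange_obj C V D, diff = exchange_diff C V D w t t' r\<rparr>" (is "con_exact C n ?N")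
proof -
  note cV = con_exact_complex[OF V]
  note oV = complex_obj[OF cV]
  define V0 V1 V2 V3 where V_def: "V0 = obj V 0" "V1 = obj V (Suc 0)" "V2 = obj V (Suc (Suc 0))" "V3 = obj V (Suc (Suc (Suc 0)))"
  define d0 d1 d2 where d_def: "d0 = diff V 0" "d1 = diff V (Suc 0)" "d2 = diff V (Suc (Suc 0))"
  note simps = V_def[symmetric] d_def[symmetric]
  have d0: "d0 \<in> H V0 V1" and d1: "d1 \<in> H V1 V2" and d2: "d2 \<in> H V2 V3"
    using complex_diff[OF cV] n by (auto simp: V_def d_def)
  have dd0: "d1 \<cdot> d0 = \<zero>\<^bsub>V0,V2\<^esub>" and dd1: "d2 \<cdot> d1 = \<zero>\<^bsub>V1,V3\<^esub>"
    using complex_dd[OF cV] n by (auto simp: V_def d_def)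
  have oV': "V0 \<in> Ob C" "V1 \<in> Ob C" "V2 \<in> Ob C" "V3 \<in> Ob C" using d0 d1 d2 Hom_dom Hom_cod by blast+
  note w = w[unfolded simps] and t = t[unfolded simps] and t' = t'[unfolded simps] and wt = wt[unfolded simps]
    and dt = dt[unfolded simps] and r = r[unfolded simps] and rt = rt[unfolded simps]
  have oD: "D \<in> Ob C" using w Hom_cod by blast
  define k where "k = idt C D \<boxminus>\<^bsub>D,D\<^esub> t \<cdot> t'"
  have k: "k \<in> H D D" unfolding k_def by (intro sub_Hom id_Hom oD cmp_Hom[OF t' t])
  have d1t': "d1 \<cdot> t' \<in> H D V2" by (rule cmp_Hom[OF t' d1])
  have nr: "negm C V2 V1 r \<in> H V2 V1" by (rule neg_Hom[OF r])
  have z1: "\<zero>\<^bsub>D,V3\<^esub> \<in> H D V3" by (rule zero_Hom[OF oD oV'(4)])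
  define N1 where "N1 = colm C D V2 D (d1 \<cdot> t') k"
  define N2 where "N2 = matm C V2 D V3 V1 d2 \<zero>\<^bsub>D,V3\<^esub> (negm C V2 V1 r) t'"
  have N1: "N1 \<in> H D (dsum C V2 D)" unfolding N1_def by (rule colm_Hom[OF d1t' k])
  have N2: "N2 \<in> H (dsum C V2 D) (dsum C V3 V1)" unfolding N2_def by (rule matm_Hom[OF d2 z1 nr t'])
  have Nd: "diff ?N 0 = w" "diff ?N (Suc 0) = N1" "diff ?N (Suc (Suc 0)) = N2"
    by (simp_all add: simps N1_def N2_def k_def)
  have No: "obj ?N 0 = V0" "obj ?N (Suc 0) = D" "obj ?N (Suc (Suc 0)) = dsum C V2 D"
    "obj ?N (Suc (Suc (Suc 0))) = dsum C V3 V1" by (simp_all add: simps)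
  have t't: "t' \<cdot> t = idt C V1 \<boxminus>\<^bsub>V1,V1\<^esub> r \<cdot> d1"
    unfolding rt[symmetric] by (rule sub_sub_self[symmetric, OF id_Hom[OF oV'(2)] cmp_Hom[OF t t']])
  have kw: "k \<cdot> w = \<zero>\<^bsub>V0,D\<^esub>"
    unfolding k_def sub_distl[OF w id_Hom[OF oD] cmp_Hom[OF t' t]]
    using idl[OF w] assoc[OF w t' t] sub_self[OF w] wt[symmetric] dt[symmetric] by simp
  \<comment> \<open>The source of the entry r in the third differential: t' (1 - t t') = (1 - t' t)
    t' = r d1 t', so with a negative sign on r the composite with N1 vanishes.\<close>
  have t'k: "t' \<cdot> k = r \<cdot> d1 \<cdot> t'"
  proof -
    have "t' \<cdot> k = t' \<boxminus>\<^bsub>D,V1\<^esub> t' \<cdot> t \<cdot> t'"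
      unfolding k_def sub_distr[OF id_Hom[OF oD] cmp_Hom[OF t' t] t'] using idr[OF t'] assoc[OF t' t t'] by simp
    also have "t' \<cdot> t \<cdot> t' = t' \<boxminus>\<^bsub>D,V1\<^esub> r \<cdot> d1 \<cdot> t'"
      unfolding t't sub_distl[OF t' id_Hom[OF oV'(2)] cmp_Hom[OF d1 r]] using idl[OF t'] by simp
    finally show ?thesis using sub_sub_self[OF t' cmp_Hom[OF t' cmp_Hom[OF d1 r]]] by simp
  qed
  have dd0': "N1 \<cdot> w = \<zero>\<^bsub>V0,dsum C V2 D\<^esub>"
    unfolding N1_def colm_cmp[OF d1t' k w] kw
    using assoc[OF w t' d1] dt dd0 colm_zero[OF oV'(1,3) oD] by simp
  have dd1': "N2 \<cdot> N1 = \<zero>\<^bsub>D,dsum C V3 V1\<^esub>"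
  proof -
    have a: "d2 \<cdot> (d1 \<cdot> t') \<boxplus>\<^bsub>D,V3\<^esub> \<zero>\<^bsub>D,V3\<^esub> \<cdot> k = \<zero>\<^bsub>D,V3\<^esub>"
      using assoc[OF t' d1 d2] dd1 zero_cmp[OF t' oV'(4)] zero_cmp[OF k oV'(4)] add_zero(1)[OF z1] by simp
    have b: "negm C V2 V1 r \<cdot> (d1 \<cdot> t') \<boxplus>\<^bsub>D,V1\<^esub> t' \<cdot> k = \<zero>\<^bsub>D,V1\<^esub>"
      using neg_cmp[OF d1t' r] t'k assoc[OF t' d1 r] add_neg(2)[OF cmp_Hom[OF d1t' r] cmp_Hom[OF d1t' r]]
        sub_self[OF cmp_Hom[OF d1t' r]] by simp
    show ?thesis unfolding N1_def N2_def matm_colm[OF d2 z1 nr t' d1t' k] a b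
      by (rule colm_zero[OF oD oV'(4,2)])
  qed
  \<comment> \<open>For n = 2 degree 3 is the last one and no differential leaves it; hence the side
    condition.\<close>
  have N3: "diff ?N (Suc (Suc (Suc 0))) \<in> H (dsum C V3 V1) (obj V (Suc (Suc (Suc (Suc 0)))))"
    and dd2': "diff ?N (Suc (Suc (Suc 0))) \<cdot> N2 = \<zero>\<^bsub>dsum C V2 D,obj V (Suc (Suc (Suc (Suc 0))))\<^esub>"
    and N3_cmp: "\<And>g T. g \<in> H (obj V (Suc (Suc (Suc (Suc 0))))) T \<Longrightarrow>
      g \<cdot> diff ?N (Suc (Suc (Suc 0))) = rowm C V3 V1 T (g \<cdot> diff V (Suc (Suc (Suc 0)))) \<zero>\<^bsub>V1,T\<^esub>"
    if n3: "Suc (Suc (Suc 0)) \<le> n"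
  proof -
    let ?V4 = "obj V (Suc (Suc (Suc (Suc 0))))" and ?d3 = "diff V (Suc (Suc (Suc 0)))"
    have o4: "?V4 \<in> Ob C" using oV n3 by simp
    have d3: "?d3 \<in> H V3 ?V4" using complex_diff[OF cV n3] by (simp add: V_def)
    have z: "\<zero>\<^bsub>V1,?V4\<^esub> \<in> H V1 ?V4" by (rule zero_Hom[OF oV'(2) o4])
    have N3: "diff ?N (Suc (Suc (Suc 0))) = rowm C V3 V1 ?V4 ?d3 \<zero>\<^bsub>V1,?V4\<^esub>" by (simp add: simps)
    show "diff ?N (Suc (Suc (Suc 0))) \<in> H (dsum C V3 V1) ?V4" unfolding N3 by (rule rowm_Hom[OF d3 z])
    have dd2: "?d3 \<cdot> d2 = \<zero>\<^bsub>V2,?V4\<^esub>" using complex_dd[OF cV, of "Suc (Suc 0)"] n3 by (simp add: V_def d_def)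
    have a: "?d3 \<cdot> d2 \<boxplus>\<^bsub>V2,?V4\<^esub> \<zero>\<^bsub>V1,?V4\<^esub> \<cdot> negm C V2 V1 r = \<zero>\<^bsub>V2,?V4\<^esub>"
      using dd2 zero_cmp[OF nr o4] add_zero(1)[OF zero_Hom[OF oV'(3) o4]] by simp
    have b: "?d3 \<cdot> \<zero>\<^bsub>D,V3\<^esub> \<boxplus>\<^bsub>D,?V4\<^esub> \<zero>\<^bsub>V1,?V4\<^esub> \<cdot> t' = \<zero>\<^bsub>D,?V4\<^esub>"
      using cmp_zero[OF d3 oD] zero_cmp[OF t' o4] add_zero(1)[OF zero_Hom[OF oD o4]] by simp
    show "diff ?N (Suc (Suc (Suc 0))) \<cdot> N2 = \<zero>\<^bsub>dsum C V2 D,?V4\<^esub>"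
      unfolding N3 N2_def rowm_matm[OF d2 z1 nr t' d3 z] a b by (rule rowm_zero[OF o4 oV'(3) oD])
    fix g T assume g: "g \<in> H ?V4 T"
    show "g \<cdot> diff ?N (Suc (Suc (Suc 0))) = rowm C V3 V1 T (g \<cdot> ?d3) \<zero>\<^bsub>V1,T\<^esub>"
      unfolding N3 cmp_rowm[OF d3 z g] using cmp_zero[OF g oV'(2)] by simp
  qed
  have cN: "complex_on C 0 (Suc n) ?N"
  proof (rule complexI)
    fix i assume i: "i \<le> n"
    consider "i = 0" | "i = Suc 0" | "i = Suc (Suc 0)" | "i = Suc (Suc (Suc 0))" | j where "i = Suc (Suc (Suc (Suc j)))"
      by (metis not0_implies_Suc)
    thus "diff ?N i \<in> H (obj ?N i) (obj ?N (Suc i))"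
    proof cases
      case 4 thus ?thesis using N3 No i by simp
    next
      case 5 thus ?thesis using complex_diff[OF cV i] by simp
    qed (use Nd No w N1 N2 in \<open>simp_all del: exchange_diff.simps exchange_obj.simps\<close>)
  next
    fix i assume i: "i < n"
    consider "i = 0" | "i = Suc 0" | "i = Suc (Suc 0)" | "i = Suc (Suc (Suc 0))" | j where "i = Suc (Suc (Suc (Suc j)))"
      by (metis not0_implies_Suc)
    thus "diff ?N (Suc i) \<cdot> diff ?N i = \<zero>\<^bsub>obj ?N i,obj ?N (Suc (Suc i))\<^esub>"
    proof cases
      case 3
      have "obj ?N (Suc (Suc (Suc (Suc 0)))) = obj V (Suc (Suc (Suc (Suc 0))))" by simp
      thus ?thesis using 3 dd2' Nd No i by (simp del: exchange_diff.simps exchange_obj.simps)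
    next
      case 4
      note o = oV[of "Suc (Suc (Suc (Suc (Suc 0))))"] and d4 = complex_diff[OF cV, of "Suc (Suc (Suc (Suc 0)))"]
      have "diff V (Suc (Suc (Suc (Suc 0)))) \<cdot> diff ?N (Suc (Suc (Suc 0))) =
          \<zero>\<^bsub>dsum C V3 V1,obj V (Suc (Suc (Suc (Suc (Suc 0)))))\<^esub>"
        using N3_cmp[OF _ d4] 4 i complex_dd[OF cV i] rowm_zero[OF o oV'(4,2)] by (simp add: simps)
      thus ?thesis using 4 by (simp add: simps)
    next
      case 5 thus ?thesis using complex_dd[OF cV i] by simp
    qed (use Nd No dd0' dd1' in \<open>simp_all del: exchange_diff.simps exchange_obj.simps\<close>)
  qed
  have ex1: "\<exists>m\<in>H (dsum C V2 D) T. g = m \<cdot> N1" if g: "g \<in> H D T" and gw: "g \<cdot> w = \<zero>\<^bsub>V0,T\<^esub>" for g T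
  proof -
    note gt = cmp_Hom[OF t g]
    have "g \<cdot> t \<cdot> d0 = \<zero>\<^bsub>V0,T\<^esub>" using gw wt assoc[OF d0 t g] by simp
    then obtain a where a: "a \<in> H V2 T" "g \<cdot> t = a \<cdot> d1"
      using con_exact_factor[OF V, of 0 "g \<cdot> t" T] gt n by (auto simp: simps)
    have "rowm C V2 D T a g \<cdot> N1 = a \<cdot> (d1 \<cdot> t') \<boxplus>\<^bsub>D,T\<^esub> g \<cdot> k"
      unfolding N1_def by (rule rowm_colm[OF a(1) g d1t' k])
    also have "a \<cdot> (d1 \<cdot> t') = g \<cdot> (t \<cdot> t')" using assoc[OF t' d1 a(1)] a(2) assoc[OF t' t g] by simp
    also have "g \<cdot> k = g \<boxminus>\<^bsub>D,T\<^esub> g \<cdot> (t \<cdot> t')"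
      unfolding k_def using sub_distr[OF id_Hom[OF oD] cmp_Hom[OF t' t] g] idr[OF g] by simp
    finally have "rowm C V2 D T a g \<cdot> N1 = g" using add_sub(3)[OF g cmp_Hom[OF cmp_Hom[OF t' t] g]] by simp
    thus ?thesis using rowm_Hom[OF a(1) g] by metis
  qed
  have ex2: "\<exists>m\<in>H (dsum C V3 V1) T. g = m \<cdot> N2" if g: "g \<in> H (dsum C V2 D) T" and gN: "g \<cdot> N1 = \<zero>\<^bsub>D,T\<^esub>" for g T
  proof -
    obtain a b where a: "a \<in> H V2 T" and b: "b \<in> H D T" and gab: "g = rowm C V2 D T a b"
      using rowm_obtain[OF oV'(3) oD g] .
    note bt = cmp_Hom[OF t b] and ad = cmp_Hom[OF d1 a]
    \<comment> \<open>The second coordinate of the factorization through N2. The relation s below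
      gives b t t' = a d1 t' + b, hence y t' = b; with the equation for r it follows that a + y r
      kills d1, which yields the first coordinate.\<close>
    define y where "y = b \<cdot> t \<boxminus>\<^bsub>V1,T\<^esub> a \<cdot> d1"
    have y: "y \<in> H V1 T" unfolding y_def by (rule sub_Hom[OF bt ad])
    have oT: "T \<in> Ob C" using b Hom_cod by blast
    have s: "a \<cdot> (d1 \<cdot> t') \<boxplus>\<^bsub>D,T\<^esub> b \<cdot> k = \<zero>\<^bsub>D,T\<^esub>"
      using gN unfolding gab N1_def rowm_colm[OF a b d1t' k] .
    have bk: "b \<cdot> k = b \<boxminus>\<^bsub>D,T\<^esub> b \<cdot> (t \<cdot> t')"
      unfolding k_def using sub_distr[OF id_Hom[OF oD] cmp_Hom[OF t' t] b] idr[OF b] by simp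
    have yt': "y \<cdot> t' = b"
    proof -
      note c1 = cmp_Hom[OF d1t' a] and c2 = cmp_Hom[OF cmp_Hom[OF t' t] b]
      have "y \<cdot> t' = b \<cdot> (t \<cdot> t') \<boxminus>\<^bsub>D,T\<^esub> a \<cdot> (d1 \<cdot> t')"
        unfolding y_def sub_distl[OF t' bt ad] using assoc[OF t' t b] assoc[OF t' d1 a] by simp
      moreover have "b \<cdot> (t \<cdot> t') = a \<cdot> (d1 \<cdot> t') \<boxplus>\<^bsub>D,T\<^esub> b"
      proof -
        have "a \<cdot> (d1 \<cdot> t') \<boxplus>\<^bsub>D,T\<^esub> b = a \<cdot> (d1 \<cdot> t') \<boxplus>\<^bsub>D,T\<^esub> (b \<cdot> k \<boxplus>\<^bsub>D,T\<^esub> b \<cdot> (t \<cdot> t'))"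
          unfolding bk using add_sub(4)[OF b c2] by simp
        also have "\<dots> = b \<cdot> (t \<cdot> t')"
          using add_assoc[OF c1 cmp_Hom[OF k b] c2] s add_zero(2)[OF c2] by simp
        finally show ?thesis by simp
      qed
      ultimately show ?thesis using add_sub(2)[OF b c1] by simp
    qed
    have "(a \<boxplus>\<^bsub>V2,T\<^esub> y \<cdot> r) \<cdot> d1 = \<zero>\<^bsub>V1,T\<^esub>"
    proof -
      have "y \<cdot> r \<cdot> d1 = y \<boxminus>\<^bsub>V1,T\<^esub> y \<cdot> (t' \<cdot> t)"
        using assoc[OF d1 r y] rt[symmetric] sub_distr[OF id_Hom[OF oV'(2)] cmp_Hom[OF t t'] y] idr[OF y] by simp
      also have "y \<cdot> (t' \<cdot> t) = b \<cdot> t" using assoc[OF t t' y] yt' by simp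
      finally have e: "y \<cdot> r \<cdot> d1 = y \<boxminus>\<^bsub>V1,T\<^esub> b \<cdot> t" .
      have "(a \<boxplus>\<^bsub>V2,T\<^esub> y \<cdot> r) \<cdot> d1 = a \<cdot> d1 \<boxplus>\<^bsub>V1,T\<^esub> (y \<boxminus>\<^bsub>V1,T\<^esub> b \<cdot> t)"
        using distl[OF d1 a cmp_Hom[OF r y]] e by simp
      moreover have "b \<cdot> t = a \<cdot> d1 \<boxplus>\<^bsub>V1,T\<^esub> y" unfolding y_def using add_sub(3)[OF bt ad] by simp
      ultimately show ?thesis
        using subm_def[of C V1 T y "b \<cdot> t"] add_assoc[OF ad y neg_Hom[OF bt]] add_neg(1)[OF bt bt] sub_self[OF bt] by simp
    qed
    then obtain x where x: "x \<in> H V3 T" "a \<boxplus>\<^bsub>V2,T\<^esub> y \<cdot> r = x \<cdot> d2"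
      using con_exact_factor[OF V, of "Suc 0" "a \<boxplus>\<^bsub>V2,T\<^esub> y \<cdot> r" T] add_Hom[OF a cmp_Hom[OF r y]] n
      by (auto simp: simps)
    have "rowm C V3 V1 T x y \<cdot> N2 = rowm C V2 D T (x \<cdot> d2 \<boxplus>\<^bsub>V2,T\<^esub> y \<cdot> negm C V2 V1 r)
        (x \<cdot> \<zero>\<^bsub>D,V3\<^esub> \<boxplus>\<^bsub>D,T\<^esub> y \<cdot> t')"
      unfolding N2_def by (rule rowm_matm[OF d2 z1 nr t' x(1) y])
    also have "x \<cdot> d2 \<boxplus>\<^bsub>V2,T\<^esub> y \<cdot> negm C V2 V1 r = a"
      using x(2)[symmetric] cmp_neg[OF r y] add_neg(1)[OF cmp_Hom[OF d2 x(1)] cmp_Hom[OF r y]]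
        add_sub(1)[OF a cmp_Hom[OF r y]] by simp
    also have "x \<cdot> \<zero>\<^bsub>D,V3\<^esub> \<boxplus>\<^bsub>D,T\<^esub> y \<cdot> t' = b" using cmp_zero[OF x(1) oD] yt' add_zero(2)[OF b] by simp
    finally show ?thesis using gab rowm_Hom[OF x(1) y] by metis
  qed
  have ex3: "\<exists>x\<in>H V3 T. g = rowm C V3 V1 T x \<zero>\<^bsub>V1,T\<^esub> \<and> x \<cdot> d2 = \<zero>\<^bsub>V2,T\<^esub>"
    if g: "g \<in> H (dsum C V3 V1) T" and gN: "g \<cdot> N2 = \<zero>\<^bsub>dsum C V2 D,T\<^esub>" for g T
  proof -
    obtain x y where x: "x \<in> H V3 T" and y: "y \<in> H V1 T" and gxy: "g = rowm C V3 V1 T x y"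
      using rowm_obtain[OF oV'(4,2) g] .
    note xd = cmp_Hom[OF d2 x] and yr = cmp_Hom[OF r y] and yt = cmp_Hom[OF t' y]
    have oT: "T \<in> Ob C" using x Hom_cod by blast
    have "rowm C V2 D T (x \<cdot> d2 \<boxplus>\<^bsub>V2,T\<^esub> y \<cdot> negm C V2 V1 r) (x \<cdot> \<zero>\<^bsub>D,V3\<^esub> \<boxplus>\<^bsub>D,T\<^esub> y \<cdot> t')
        = rowm C V2 D T \<zero>\<^bsub>V2,T\<^esub> \<zero>\<^bsub>D,T\<^esub>"
      using gN rowm_zero[OF oT oV'(3) oD] unfolding gxy N2_def rowm_matm[OF d2 z1 nr t' x y] by simp
    moreover have "x \<cdot> d2 \<boxplus>\<^bsub>V2,T\<^esub> y \<cdot> negm C V2 V1 r = x \<cdot> d2 \<boxminus>\<^bsub>V2,T\<^esub> y \<cdot> r"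
      using cmp_neg[OF r y] add_neg(1)[OF xd yr] by simp
    moreover have "x \<cdot> \<zero>\<^bsub>D,V3\<^esub> \<boxplus>\<^bsub>D,T\<^esub> y \<cdot> t' = y \<cdot> t'" using cmp_zero[OF x oD] add_zero(2)[OF yt] by simp
    ultimately have e: "x \<cdot> d2 \<boxminus>\<^bsub>V2,T\<^esub> y \<cdot> r = \<zero>\<^bsub>V2,T\<^esub>" "y \<cdot> t' = \<zero>\<^bsub>D,T\<^esub>"
      using rowm_inject[OF sub_Hom[OF xd yr] yt zero_Hom[OF oV'(3) oT] zero_Hom[OF oD oT]] by simp_all
    have xyr: "x \<cdot> d2 = y \<cdot> r" using e(1) sub_eq_zero[OF xd yr] by simp
    \<comment> \<open>Since 1 = t' t + r d1, the vanishing of y t' gives y = y r d1 = x d2 d1 =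
      0.\<close>
    have "y \<cdot> (t' \<cdot> t) = \<zero>\<^bsub>V1,T\<^esub>" using assoc[OF t t' y] e(2) zero_cmp[OF t oT] by simp
    hence "y = y \<cdot> (r \<cdot> d1)"
      using rt[symmetric] sub_distr[OF id_Hom[OF oV'(2)] cmp_Hom[OF t t'] y] idr[OF y] add_zero(3)[OF y] by simp
    also have "\<dots> = x \<cdot> (d2 \<cdot> d1)" using assoc[OF d1 r y] assoc[OF d1 d2 x] xyr by simp
    also have "\<dots> = \<zero>\<^bsub>V1,T\<^esub>" using dd1 cmp_zero[OF x oV'(2)] by simp
    finally have y0: "y = \<zero>\<^bsub>V1,T\<^esub>" .
    hence "x \<cdot> d2 = \<zero>\<^bsub>V2,T\<^esub>" using xyr zero_cmp[OF r oT] by simp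
    thus ?thesis using x gxy y0 by blast
  qed
  \<comment> \<open>For i = 0, 1, 2 the three relations above apply, i = 3 only strips off the zero
    entry on V1, and from i = 4 on the complex is V.\<close>
  have main: "i < n \<and> (\<exists>k\<in>H (obj ?N (Suc (Suc i))) T. g = k \<cdot> diff ?N (Suc i)) \<or> i = n \<and> g = \<zero>\<^bsub>obj ?N (Suc i),T\<^esub>"
    if i: "i \<le> n" and g: "g \<in> H (obj ?N (Suc i)) T" and gd: "g \<cdot> diff ?N i = \<zero>\<^bsub>obj ?N i,T\<^esub>" for i g T
  proof -
    have oT: "T \<in> Ob C" using g Hom_cod by blast
    consider "i = 0" | "i = Suc 0" | "i = Suc (Suc 0)" | "i = Suc (Suc (Suc 0))" | j where "i = Suc (Suc (Suc (Suc j)))"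
      by (metis not0_implies_Suc)
    thus ?thesis
    proof cases
      case 1 thus ?thesis using ex1[of g T] g gd Nd No n by (simp del: exchange_diff.simps exchange_obj.simps)
    next
      case 2 thus ?thesis using ex2[of g T] g gd Nd No n by (simp del: exchange_diff.simps exchange_obj.simps)
    next
      case 3
      obtain x where x: "x \<in> H V3 T" "g = rowm C V3 V1 T x \<zero>\<^bsub>V1,T\<^esub>" "x \<cdot> d2 = \<zero>\<^bsub>V2,T\<^esub>"
        using ex3[of g T] g gd 3 Nd No by (auto simp del: exchange_diff.simps exchange_obj.simps)
      have "i < n \<and> (\<exists>k\<in>H (obj V (Suc (Suc i))) T. x = k \<cdot> diff V (Suc i)) \<or> i = n \<and> x = \<zero>\<^bsub>obj V (Suc i),T\<^esub>"
        using con_exact_step[OF V i, of x T] x 3 by (simp add: simps)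
      thus ?thesis
      proof
        assume "i < n \<and> (\<exists>k\<in>H (obj V (Suc (Suc i))) T. x = k \<cdot> diff V (Suc i))"
        then obtain k where k: "i < n" "k \<in> H (obj V (Suc (Suc (Suc (Suc 0))))) T" "x = k \<cdot> diff V (Suc (Suc (Suc 0)))"
          using 3 by auto
        hence "g = k \<cdot> diff ?N (Suc (Suc (Suc 0)))" using N3_cmp[of k T] x(2) 3 by simp
        thus ?thesis using k 3 by (auto simp del: exchange_diff.simps)
      next
        assume a: "i = n \<and> x = \<zero>\<^bsub>obj V (Suc i),T\<^esub>"
        hence "x = \<zero>\<^bsub>V3,T\<^esub>" unfolding 3 V_def by blast
        hence "g = \<zero>\<^bsub>obj ?N (Suc i),T\<^esub>"
          unfolding 3 No(4) using x(2) rowm_zero[OF oT oV'(4,2)] by simp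
        thus ?thesis using a by blast
      qed
    next
      case 4
      have n3: "Suc (Suc (Suc 0)) \<le> n" using i 4 by simp
      have g': "g \<in> H (obj V (Suc (Suc (Suc (Suc 0))))) T" using g 4 by simp
      have gH: "g \<cdot> diff V (Suc (Suc (Suc 0))) \<in> H V3 T"
        using cmp_Hom[OF complex_diff[OF cV n3] g'] by (simp add: V_def)
      have "rowm C V3 V1 T (g \<cdot> diff V (Suc (Suc (Suc 0)))) \<zero>\<^bsub>V1,T\<^esub> = rowm C V3 V1 T \<zero>\<^bsub>V3,T\<^esub> \<zero>\<^bsub>V1,T\<^esub>"
        using N3_cmp[OF n3 g'] gd 4 rowm_zero[OF oT oV'(4,2)] by (simp add: simps)
      hence "g \<cdot> diff V i = \<zero>\<^bsub>obj V i,T\<^esub>"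
        using rowm_inject[OF gH zero_Hom[OF oV'(2) oT] zero_Hom[OF oV'(4) oT] zero_Hom[OF oV'(2) oT]] 4
        by (simp add: V_def)
      thus ?thesis using con_exact_step[OF V i, of g T] g' 4 by simp
    next
      case 5 thus ?thesis using con_exact_step[OF V i, of g T] g gd by simp
    qed
  qed
  show ?thesis unfolding con_exact_def
  proof (intro conjI ballI allI impI)
    show "complex_on C 0 (Suc n) ?N" by (rule cN)
  next
    fix T g assume "g \<in> H (obj ?N (Suc n)) T" "g \<cdot> diff ?N n = \<zero>\<^bsub>obj ?N n,T\<^esub>"
    thus "g = \<zero>\<^bsub>obj ?N (Suc n),T\<^esub>" using main[OF order_refl] by blast
  next
    fix T i g assume "i < n" "g \<in> H (obj ?N (Suc i)) T" "g \<cdot> diff ?N i = \<zero>\<^bsub>obj ?N i,T\<^esub>"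
    thus "\<exists>k\<in>H (obj ?N (Suc (Suc i))) T. g = k \<cdot> diff ?N (Suc i)"
      using main[of i g T] by auto
  qed
qed

section \<open>Recognizing conflations and composing inflations\<close>

context extension_calculus
begin

lemma D_complex: "\<D> X \<delta> \<Longrightarrow> complex_on C 0 (Suc n) X"
  by (rule con_exact_complex[OF D_con])

lemma D_diff: "\<lbrakk>\<D> X \<delta>; i \<le> n\<rbrakk> \<Longrightarrow> diff X i \<in> H (obj X i) (obj X (Suc i))"
  by (rule complex_diff[OF D_complex])

lemma D_obj: "\<lbrakk>\<D> X \<delta>; i \<le> Suc n\<rbrakk> \<Longrightarrow> obj X i \<in> Ob C"
  by (rule complex_obj[OF D_complex])

text \<open>The candidate extension \<rho> is the pullback of \<delta> along the last component c of
  a comparison map from Y to X. Going through X, a realization Y' of \<rho> and Y are connected by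
  maps in both directions with last component c' c, which is the identity up to a map through the
  last differential of Y. Such a map pulls \<rho> back to zero, so it also passes through the last
  differential of Y', and both connecting maps can be corrected to fix the ends.\<close>

lemma realize_con_exact:
  assumes X: "\<D> X \<delta>" and Y: "con_exact C n Y" and Y0: "obj Y 0 = obj X 0"
    and t: "t \<in> H (obj X (Suc 0)) (obj Y (Suc 0))" and td: "t \<cdot> diff X 0 = diff Y 0"
    and t': "t' \<in> H (obj Y (Suc 0)) (obj X (Suc 0))" and t'd: "t' \<cdot> diff Y 0 = diff X 0"
  shows "\<exists>\<rho>. \<D> Y \<rho>"
proof -
  note cX = D_complex[OF X] and cY = con_exact_complex[OF Y] and eX = D_con[OF X]
  define A where "A = obj X 0"
  have A: "A \<in> Ob C" "obj X 0 = A" "obj Y 0 = A" using D_obj[OF X, of 0] Y0 by (auto simp: A_def)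
  note idA = id_Hom[OF A(1)]
  have dX: "diff X 0 \<in> H A (obj X (Suc 0))" and dY: "diff Y 0 \<in> H A (obj Y (Suc 0))"
    using complex_diff[OF cX, of 0] complex_diff[OF cY, of 0] A by auto
  obtain p where p: "chain_map_on C 0 (Suc n) Y X p" "p 0 = idt C A" "p 1 = t'"
    using con_exact_extend[OF Y cX, of "idt C A" t'] idA t' t'd idr[OF dX] A by auto
  obtain q where q: "chain_map_on C 0 (Suc n) X Y q" "q 0 = idt C A" "q 1 = t"
    using con_exact_extend[OF eX cY, of "idt C A" t] idA t td idr[OF dY] A by auto
  have L: "obj X (Suc n) \<in> Ob C" "obj Y (Suc n) \<in> Ob C" using complex_obj[OF cX] complex_obj[OF cY] by auto
  define c c' where cc_def: "c = p (Suc n)" "c' = q (Suc n)"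
  have c: "c \<in> H (obj Y (Suc n)) (obj X (Suc n))" and c': "c' \<in> H (obj X (Suc n)) (obj Y (Suc n))"
    using chain_map_Hom[OF p(1) cY cX] chain_map_Hom[OF q(1) cX cY] by (auto simp: cc_def)
  have dXn: "diff X n \<in> H (obj X n) (obj X (Suc n))" and dYn: "diff Y n \<in> H (obj Y n) (obj Y (Suc n))"
    using complex_diff[OF cX] complex_diff[OF cY] by auto
  have pn: "p n \<in> H (obj Y n) (obj X n)" using chain_map_Hom[OF p(1) cY cX] by auto
  \<comment> \<open>The composite of the comparison maps is the identity in degree 0, hence
    homotopic to the identity; only the last component of the homotopy is kept.\<close>
  obtain h where h: "h \<in> H (obj Y (Suc n)) (obj Y n)"
    and c'c: "c' \<cdot> c = idt C (obj Y (Suc n)) \<boxplus>\<^bsub>obj Y (Suc n),obj Y (Suc n)\<^esub> diff Y n \<cdot> h"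
    using con_exact_homotopy[OF Y cY chain_map_cmp[OF p(1) q(1) cY cX cY] chain_map_id[OF cY]]
      p(2) q(2) A idl[OF idA] unfolding cc_def by (metis order_refl)
  obtain h2 where h2: "h2 \<in> H (obj X (Suc n)) (obj X n)"
    and cc': "c \<cdot> c' = idt C (obj X (Suc n)) \<boxplus>\<^bsub>obj X (Suc n),obj X (Suc n)\<^esub> diff X n \<cdot> h2"
    using con_exact_homotopy[OF eX cX chain_map_cmp[OF q(1) p(1) cX cY cX] chain_map_id[OF cX]]
      p(2) q(2) A idl[OF idA] unfolding cc_def by (metis order_refl)
  have \<delta>: "\<delta> \<in> \<E> (obj X (Suc n)) A" using D_ext[OF X] A by simp
  have dn\<delta>: "pull E (diff X n) \<delta> = \<o>\<^bsub>obj X n,A\<^esub>" using D_pull[OF X] A by simp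
  define \<rho> where "\<rho> = pull E c \<delta>"
  have \<rho>: "\<rho> \<in> \<E> (obj Y (Suc n)) A" unfolding \<rho>_def by (rule pull_mem[OF c A(1) \<delta>])
  \<comment> \<open>This makes c' liftable to a map from X to Y'. It holds because c c' is the
    identity up to a map through \<open>diff X n\<close>, along which \<delta> pulls back to
    zero.\<close>
  have c'\<rho>: "pull E c' \<rho> = \<delta>"
  proof -
    have "pull E c' \<rho> = pull E (c \<cdot> c') \<delta>" unfolding \<rho>_def by (rule pull_pull[OF c c' A(1) \<delta>])
    also have "\<dots> = pull E (idt C (obj X (Suc n))) \<delta> \<otimes>\<^bsub>Ext E (obj X (Suc n)) A\<^esub> pull E (diff X n \<cdot> h2) \<delta>"
      unfolding cc' by (rule pull_plus[OF id_Hom[OF L(1)] cmp_Hom[OF h2 dXn] A(1) \<delta>])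
    also have "pull E (diff X n \<cdot> h2) \<delta> = \<o>\<^bsub>obj X (Suc n),A\<^esub>"
      using pull_pull[OF dXn h2 A(1) \<delta>] dn\<delta> pull_one[OF h2 A(1)] by simp
    finally show ?thesis using pull_id[OF L(1) A(1) \<delta>] ext_mult_one[OF L(1) A(1) \<delta>] by simp
  qed
  obtain Y' where Y': "\<D> Y' \<rho>" "obj Y' 0 = A" "obj Y' (Suc n) = obj Y (Suc n)"
    using D_ex[OF L(2) A(1) \<rho>] by blast
  note cY' = D_complex[OF Y'(1)]
  have dY'n: "diff Y' n \<in> H (obj Y' n) (obj Y (Suc n))" using D_diff[OF Y'(1), of n] Y' by simp
  have "push E (idt C A) \<rho> = pull E c \<delta>" using push_id[OF L(2) A(1) \<rho>] by (simp add: \<rho>_def)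
  then obtain a where a: "chain_map_on C 0 (Suc n) Y' X a" "a 0 = idt C A" "a (Suc n) = c"
    using D_lift[OF Y'(1) X, of "idt C A" c] idA c A Y' by auto
  have "push E (idt C A) \<delta> = pull E c' \<rho>" using push_id[OF L(1) A(1) \<delta>] c'\<rho> by simp
  then obtain b where b: "chain_map_on C 0 (Suc n) X Y' b" "b 0 = idt C A" "b (Suc n) = c'"
    using D_lift[OF X Y'(1), of "idt C A" c'] idA c' A Y' by auto
  have id: "idt C (obj Y (Suc n)) \<in> H (obj Y (Suc n)) (obj Y (Suc n))" by (rule id_Hom[OF L(2)])
  obtain F where F: "chain_map_on C 0 (Suc n) Y' Y F" "F 0 = idt C A" "F (Suc n) = idt C (obj Y (Suc n))"
    using adjust_last[OF n_pos cY' cY chain_map_cmp[OF a(1) q(1) cY' cX cY], of "idt C (obj Y (Suc n))" h]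
      id h c'c Y' a(2,3) q(2) idl[OF idA] unfolding cc_def by auto
  have "pull E (diff Y n \<cdot> h) \<rho> = \<o>\<^bsub>obj Y (Suc n),A\<^esub>"
  proof -
    have "pull E (diff Y n) \<rho> = pull E (diff X n \<cdot> p n) \<delta>"
      unfolding \<rho>_def using pull_pull[OF c dYn A(1) \<delta>] chain_map_comm[OF p(1), of n] by (simp add: cc_def)
    also have "\<dots> = \<o>\<^bsub>obj Y n,A\<^esub>" using pull_pull[OF dXn pn A(1) \<delta>] dn\<delta> pull_one[OF pn A(1)] by simp
    finally show ?thesis using pull_pull[OF dYn h A(1) \<rho>] pull_one[OF h A(1)] by simp
  qed
  \<comment> \<open>The correction term is written with the last differential of Y; to remove it
    from a map into Y' it has to be rewritten with the one of Y'.\<close>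
  then obtain h' where h': "h' \<in> H (obj Y (Suc n)) (obj Y' n)" "diff Y n \<cdot> h = diff Y' n \<cdot> h'"
    using D_pull_factor[OF Y'(1), of "diff Y n \<cdot> h" "obj Y (Suc n)"] cmp_Hom[OF h dYn] Y' by auto
  have "c' \<cdot> c = idt C (obj Y (Suc n)) \<boxplus>\<^bsub>obj Y (Suc n),obj Y' (Suc n)\<^esub> diff Y' n \<cdot> h'"
    using c'c h'(2) Y'(3) by simp
  then obtain G where G: "chain_map_on C 0 (Suc n) Y Y' G" "G 0 = idt C A" "G (Suc n) = idt C (obj Y (Suc n))"
    using adjust_last[OF n_pos cY cY' chain_map_cmp[OF p(1) b(1) cY cX cY'], of "idt C (obj Y (Suc n))" h']
      id h' Y' b(2,3) p(2) idl[OF idA] unfolding cc_def by auto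
  have "hequiv C n Y' Y"
    by (rule con_exact_hequiv[OF D_con[OF Y'(1)] Y, of F G]) (use F G Y' A in \<open>auto simp: end_fixing_map_def\<close>)
  hence "\<D> Y \<rho>" by (rule D_hequiv[OF Y'(1) cY])
  thus ?thesis by blast
qed

text \<open>The first terms are only related by a retraction up to homotopy, so Y cannot be compared
  with X directly. With f = \<open>diff Y 0\<close>, the pushforward \<theta> of \<delta> along j
  lives on the right object but need not be killed by f. Pulling it back along the last differential
  q of a realization of the pushforward of \<theta> along f forces this, and the first morphism e of
  the resulting realization V is the one to compare with f.\<close>

lemma realize_retract:
  assumes X: "\<D> X \<delta>" and Y: "con_exact C n Y"
    and g0: "g0 \<in> H (obj Y 0) (obj X 0)" and g1: "g1 \<in> H (obj Y (Suc 0)) (obj X (Suc 0))"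
    and gd: "g1 \<cdot> diff Y 0 = diff X 0 \<cdot> g0"
    and j: "j \<in> H (obj X 0) (obj Y 0)" and h: "h \<in> H (obj Y (Suc 0)) (obj Y 0)"
    and jg: "j \<cdot> g0 = idt C (obj Y 0) \<boxplus>\<^bsub>obj Y 0,obj Y 0\<^esub> h \<cdot> diff Y 0"
  shows "\<exists>\<rho>. \<D> Y \<rho>"
proof -
  note cY = con_exact_complex[OF Y]
  define A B K where AB_def: "A = obj Y 0" "B = obj Y (Suc 0)" "K = obj X (Suc n)"
  define f where "f = diff Y 0"
  have o: "A \<in> Ob C" "B \<in> Ob C" "K \<in> Ob C" "obj X 0 \<in> Ob C"
    using complex_obj[OF cY] D_obj[OF X] by (auto simp: AB_def)
  have f: "f \<in> H A B" using complex_diff[OF cY, of 0] by (simp add: AB_def f_def)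
  note g0 = g0[folded AB_def] and g1 = g1[folded AB_def] and gd = gd[folded f_def]
    and j = j[folded AB_def] and h = h[folded AB_def] and jg = jg[folded AB_def f_def]
  have \<delta>: "\<delta> \<in> \<E> K (obj X 0)" using D_ext[OF X] by (simp add: AB_def)
  define \<theta> where "\<theta> = push E j \<delta>"
  have \<theta>: "\<theta> \<in> \<E> K A" unfolding \<theta>_def by (rule push_mem[OF j o(3) \<delta>])
  define \<zeta> where "\<zeta> = push E f \<theta>"
  have \<zeta>: "\<zeta> \<in> \<E> K B" unfolding \<zeta>_def by (rule push_mem[OF f o(3) \<theta>])
  obtain Z where Z: "\<D> Z \<zeta>" "obj Z 0 = B" "obj Z (Suc n) = K" using D_ex[OF o(3,2) \<zeta>] by blast
  define Q q where Q_def: "Q = obj Z n" "q = diff Z n"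
  have q: "q \<in> H Q K" using D_diff[OF Z(1), of n] Z by (simp add: Q_def)
  have oQ: "Q \<in> Ob C" using q Hom_dom by blast
  have q\<zeta>: "pull E q \<zeta> = \<o>\<^bsub>Q,B\<^esub>" using D_pull[OF Z(1)] Z by (simp add: Q_def)
  have q\<theta>: "pull E q \<theta> \<in> \<E> Q A" by (rule pull_mem[OF q o(1) \<theta>])
  obtain V where V: "\<D> V (pull E q \<theta>)" "obj V 0 = A" "obj V (Suc n) = Q" using D_ex[OF oQ o(1) q\<theta>] by blast
  define e V1 where e_def: "e = diff V 0" "V1 = obj V (Suc 0)"
  have e: "e \<in> H A V1" using D_diff[OF V(1), of 0] V by (simp add: e_def)
  have oV: "V1 \<in> Ob C" using e Hom_cod by blast
  have "push E f (pull E q \<theta>) = \<o>\<^bsub>Q,B\<^esub>" using push_pull_swap[OF f q \<theta>] q\<zeta> by (simp add: \<zeta>_def)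
  then obtain k where k: "k \<in> H V1 B" "f = k \<cdot> e"
    using D_push_factor[OF V(1), of f B] f V by (auto simp: e_def)
  \<comment> \<open>e kills the pullback of \<theta> along q, so e and some multiple m f have the
    same effect on \<theta>. As \<theta> comes from \<delta> along j, the map (e - m f) j then
    extends over \<open>diff X 0\<close>.\<close>
  have "pull E q (push E e \<theta>) = \<o>\<^bsub>Q,V1\<^esub>"
    using push_pull_swap[OF e q \<theta>] D_push[OF V(1)] V by (simp add: e_def)
  then obtain m where m: "m \<in> H B V1" "push E e \<theta> = push E m \<zeta>"
    using D_push_onto[OF Z(1) oV, of "push E e \<theta>"] push_mem[OF e o(3) \<theta>] Z by (auto simp: Q_def)
  note ej = cmp_Hom[OF j e] and mf = cmp_Hom[OF f m(1)]
  note mfj = cmp_Hom[OF j mf]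
  have "push E (e \<cdot> j) \<delta> = push E (m \<cdot> f \<cdot> j) \<delta>"
    using m(2) push_push[OF j e o(3) \<delta>] push_push[OF f m(1) o(3) \<theta>] push_push[OF j mf o(3) \<delta>]
    by (simp add: \<theta>_def \<zeta>_def)
  hence "push E (e \<cdot> j \<boxminus>\<^bsub>obj X 0,V1\<^esub> m \<cdot> f \<cdot> j) \<delta> = \<o>\<^bsub>K,V1\<^esub>"
    using push_sub_one[OF ej mfj o(3) \<delta>] by simp
  then obtain r where r: "r \<in> H (obj X (Suc 0)) V1" "e \<cdot> j \<boxminus>\<^bsub>obj X 0,V1\<^esub> m \<cdot> f \<cdot> j = r \<cdot> diff X 0"
    using D_push_factor[OF X sub_Hom[OF ej mfj]] by (auto simp: AB_def)
  have dX: "diff X 0 \<in> H (obj X 0) (obj X (Suc 0))" using D_diff[OF X, of 0] by simp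
  note hf = cmp_Hom[OF f h] and rg = cmp_Hom[OF g1 r(1)]
  have jx: "x \<cdot> j \<cdot> g0 = x \<boxplus>\<^bsub>A,V1\<^esub> x \<cdot> h \<cdot> f" if x: "x \<in> H A V1" for x
    using assoc[OF g0 j x] jg distr[OF id_Hom[OF o(1)] hf x] idr[OF x] assoc[OF f h x] by simp
  have "(e \<cdot> j \<boxminus>\<^bsub>obj X 0,V1\<^esub> m \<cdot> f \<cdot> j) \<cdot> g0 = r \<cdot> g1 \<cdot> f"
    unfolding r(2) using assoc[OF g0 dX r(1)] gd assoc[OF f g1 r(1)] by simp
  hence eq: "(e \<boxplus>\<^bsub>A,V1\<^esub> e \<cdot> h \<cdot> f) \<boxminus>\<^bsub>A,V1\<^esub> (m \<cdot> f \<boxplus>\<^bsub>A,V1\<^esub> m \<cdot> f \<cdot> h \<cdot> f) = r \<cdot> g1 \<cdot> f"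
    using sub_distl[OF g0 ej mfj] jx[OF e] jx[OF mf] by simp
  note ehH = cmp_Hom[OF h e] and mfhH = cmp_Hom[OF h mf]
  note eh = cmp_Hom[OF f ehH] and mfh = cmp_Hom[OF f mfhH] and rgf = cmp_Hom[OF f rg]
  \<comment> \<open>Composing (e - m f) j = r \<open>diff X 0\<close> with g0, and using j g0 = 1 +
    h f, gives (e - m f) (1 + h f) = r g1 f. Every summand except e ends in f, and k' is the
    coefficient obtained by solving for e.\<close>
  define k' where "k' = ((r \<cdot> g1 \<boxplus>\<^bsub>B,V1\<^esub> (m \<boxplus>\<^bsub>B,V1\<^esub> m \<cdot> f \<cdot> h)) \<boxminus>\<^bsub>B,V1\<^esub> e \<cdot> h)"
  have mm: "m \<boxplus>\<^bsub>B,V1\<^esub> m \<cdot> f \<cdot> h \<in> H B V1" by (rule add_Hom[OF m(1) mfhH])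
  have k': "k' \<in> H B V1" unfolding k'_def by (intro sub_Hom add_Hom rg mm ehH)
  have "k' \<cdot> f = (r \<cdot> g1 \<cdot> f \<boxplus>\<^bsub>A,V1\<^esub> (m \<cdot> f \<boxplus>\<^bsub>A,V1\<^esub> m \<cdot> f \<cdot> h \<cdot> f)) \<boxminus>\<^bsub>A,V1\<^esub> e \<cdot> h \<cdot> f"
    unfolding k'_def sub_distl[OF f add_Hom[OF rg mm] ehH] distl[OF f rg mm] distl[OF f m(1) mfhH] ..
  also have "r \<cdot> g1 \<cdot> f \<boxplus>\<^bsub>A,V1\<^esub> (m \<cdot> f \<boxplus>\<^bsub>A,V1\<^esub> m \<cdot> f \<cdot> h \<cdot> f) = e \<boxplus>\<^bsub>A,V1\<^esub> e \<cdot> h \<cdot> f"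
    using add_sub(4)[OF add_Hom[OF e eh] add_Hom[OF mf mfh]] eq by simp
  also have "\<dots> \<boxminus>\<^bsub>A,V1\<^esub> e \<cdot> h \<cdot> f = e" by (rule add_sub(1)[OF e eh])
  finally show ?thesis
    using realize_con_exact[OF V(1) Y, of k k'] V k k' by (simp add: AB_def e_def f_def)
qed

text \<open>\<rho> need not be a pushforward along u; the obstruction is its pushforward along
  \<open>diff X (Suc 0)\<close>, and this vanishes after pulling back to Q. So \<epsilon> arises,
  and \<sigma> combines two extensions killed by v u. Conversely, e kills \<delta> and hence equals
  g u for some g on B; as e also kills \<epsilon>, a multiple of \<open>diff X (Suc 0)\<close> can
  be subtracted from g so that the difference kills \<rho> and extends over v.\<close>

lemma first_cmp_factor:
  assumes X: "\<D> X \<delta>" and Y: "\<D> Y \<rho>" and YX: "obj Y 0 = obj X (Suc 0)"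
  obtains V \<sigma> t t' where "\<D> V \<sigma>" "obj V 0 = obj X 0"
    "t \<in> H (obj V (Suc 0)) (obj Y (Suc 0))" "diff Y 0 \<cdot> diff X 0 = t \<cdot> diff V 0"
    "t' \<in> H (obj Y (Suc 0)) (obj V (Suc 0))" "diff V 0 = t' \<cdot> (diff Y 0 \<cdot> diff X 0)"
proof -
  define A B F M K L where o_def: "A = obj X 0" "B = obj X (Suc 0)" "F = obj Y (Suc 0)"
    "M = obj X (Suc (Suc 0))" "K = obj Y (Suc n)" "L = obj X (Suc n)"
  define u v d1 where d_def: "u = diff X 0" "v = diff Y 0" "d1 = diff X (Suc 0)"
  have u: "u \<in> H A B" and d1: "d1 \<in> H B M" and v: "v \<in> H B F"
    using D_diff[OF X, of 0] D_diff[OF X, of "Suc 0"] D_diff[OF Y, of 0] n_pos YX by (auto simp: o_def d_def)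
  have o: "A \<in> Ob C" "B \<in> Ob C" "M \<in> Ob C" "F \<in> Ob C" "K \<in> Ob C" "L \<in> Ob C"
    using D_obj[OF X] D_obj[OF Y] n_pos by (auto simp: o_def)
  have \<delta>: "\<delta> \<in> \<E> L A" and \<rho>: "\<rho> \<in> \<E> K B" using D_ext[OF X] D_ext[OF Y] YX by (auto simp: o_def)
  have u\<delta>: "push E u \<delta> = \<o>\<^bsub>L,B\<^esub>" and v\<rho>: "push E v \<rho> = \<o>\<^bsub>K,F\<^esub>"
    using D_push[OF X] D_push[OF Y] by (auto simp: o_def d_def)
  have d1\<rho>: "push E d1 \<rho> \<in> \<E> K M" by (rule push_mem[OF d1 o(5) \<rho>])
  obtain Z where Z: "\<D> Z (push E d1 \<rho>)" "obj Z 0 = M" "obj Z (Suc n) = K" using D_ex[OF o(5,3) d1\<rho>] by blast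
  define Q q where Q_def: "Q = obj Z n" "q = diff Z n"
  have q: "q \<in> H Q K" using D_diff[OF Z(1), of n] Z by (simp add: Q_def)
  have oQ: "Q \<in> Ob C" using q Hom_dom by blast
  have q\<rho>: "pull E q \<rho> \<in> \<E> Q B" by (rule pull_mem[OF q o(2) \<rho>])
  have "push E d1 (pull E q \<rho>) = \<o>\<^bsub>Q,M\<^esub>"
    using push_pull_swap[OF d1 q \<rho>] D_pull[OF Z(1)] Z by (simp add: Q_def)
  then obtain \<epsilon> where \<epsilon>: "\<epsilon> \<in> \<E> Q A" "pull E q \<rho> = push E u \<epsilon>"
    using D_push_mid[OF X oQ, of "pull E q \<rho>"] q\<rho> by (auto simp: o_def d_def)
  obtain \<sigma> where \<sigma>: "\<sigma> \<in> \<E> (dsum C Q L) A" "pull E (i1 Q L) \<sigma> = \<epsilon>" "pull E (i2 Q L) \<sigma> = \<delta>"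
    and \<sigma>_push: "\<And>a T. \<lbrakk>a \<in> H A T; push E a \<epsilon> = \<o>\<^bsub>Q,T\<^esub>; push E a \<delta> = \<o>\<^bsub>L,T\<^esub>\<rbrakk>
      \<Longrightarrow> push E a \<sigma> = \<o>\<^bsub>dsum C Q L,T\<^esub>"
    using pull_dsum[OF oQ o(6,1) \<epsilon>(1) \<delta>] by metis
  note oS = dsum_Ob[OF oQ o(6)] and S = bip_Hom[OF oQ o(6)]
  obtain V where V: "\<D> V \<sigma>" "obj V 0 = A" "obj V (Suc n) = dsum C Q L" using D_ex[OF oS o(1) \<sigma>(1)] by blast
  define e V1 where e_def: "e = diff V 0" "V1 = obj V (Suc 0)"
  have e: "e \<in> H A V1" using D_diff[OF V(1), of 0] V by (simp add: e_def)
  have oV: "V1 \<in> Ob C" using e Hom_cod by blast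
  have e\<sigma>: "push E e \<sigma> = \<o>\<^bsub>dsum C Q L,V1\<^esub>" using D_push[OF V(1)] V by (simp add: e_def)
  have e\<epsilon>: "push E e \<epsilon> = \<o>\<^bsub>Q,V1\<^esub>"
    using push_pull_swap[OF e S(1) \<sigma>(1)] e\<sigma> pull_one[OF S(1) oV] \<sigma>(2) by simp
  have e\<delta>: "push E e \<delta> = \<o>\<^bsub>L,V1\<^esub>"
    using push_pull_swap[OF e S(2) \<sigma>(1)] e\<sigma> pull_one[OF S(2) oV] \<sigma>(3) by simp
  note vu = cmp_Hom[OF u v]
  have "push E (v \<cdot> u) \<delta> = \<o>\<^bsub>L,F\<^esub>" using push_push[OF u v o(6) \<delta>] u\<delta> push_one[OF v o(6)] by simp
  moreover have "push E (v \<cdot> u) \<epsilon> = \<o>\<^bsub>Q,F\<^esub>"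
    using push_push[OF u v oQ \<epsilon>(1)] \<epsilon>(2)[symmetric] push_pull_swap[OF v q \<rho>] v\<rho> pull_one[OF q o(4)] by simp
  ultimately obtain t where t: "t \<in> H V1 F" "v \<cdot> u = t \<cdot> e"
    using D_push_factor[OF V(1), of "v \<cdot> u" F] \<sigma>_push[OF vu] vu V by (auto simp: e_def)
  obtain g where g: "g \<in> H B V1" "e = g \<cdot> u"
    using D_push_factor[OF X, of e V1] e e\<delta> by (auto simp: o_def d_def)
  have "pull E q (push E g \<rho>) = \<o>\<^bsub>Q,V1\<^esub>"
    using push_pull_swap[OF g(1) q \<rho>] \<epsilon>(2) push_push[OF u g(1) oQ \<epsilon>(1)] e\<epsilon> g(2) by simp
  then obtain k where k: "k \<in> H M V1" "push E g \<rho> = push E k (push E d1 \<rho>)"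
    using D_push_onto[OF Z(1) oV, of "push E g \<rho>"] push_mem[OF g(1) o(5) \<rho>] Z by (auto simp: Q_def)
  note kd = cmp_Hom[OF d1 k(1)]
  have "push E (g \<boxminus>\<^bsub>B,V1\<^esub> k \<cdot> d1) \<rho> = \<o>\<^bsub>K,V1\<^esub>"
    using k(2) push_push[OF d1 k(1) o(5) \<rho>] push_sub_one[OF g(1) kd o(5) \<rho>] by simp
  then obtain t' where t': "t' \<in> H F V1" "g \<boxminus>\<^bsub>B,V1\<^esub> k \<cdot> d1 = t' \<cdot> v"
    using D_push_factor[OF Y, of "g \<boxminus>\<^bsub>B,V1\<^esub> k \<cdot> d1" V1] sub_Hom[OF g(1) kd] YX by (auto simp: o_def d_def)
  \<comment> \<open>Subtracting k d1 from g does not change the composite with u.\<close>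
  have "k \<cdot> d1 \<cdot> u = \<zero>\<^bsub>A,V1\<^esub>"
    using assoc[OF u d1 k(1)] complex_dd[OF D_complex[OF X] n_pos] cmp_zero[OF k(1) o(1)]
    by (simp add: o_def d_def)
  hence "t' \<cdot> v \<cdot> u = e"
    unfolding t'(2)[symmetric] using sub_distl[OF u g(1) kd] g(2) add_zero(3)[OF e] by simp
  hence "e = t' \<cdot> (v \<cdot> u)" using assoc[OF u v t'(1)] by simp
  thus ?thesis using that[OF V(1) _ _ _ _ _, of t t'] V t t' by (simp add: o_def d_def e_def)
qed

lemma first_mor_cmp:
  assumes "first_mor {X. \<exists>\<delta>. \<D> X \<delta>} A B u" "first_mor {X. \<exists>\<delta>. \<D> X \<delta>} B F v"
  shows "first_mor {X. \<exists>\<delta>. \<D> X \<delta>} A F (v \<cdot> u)"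
proof -
  obtain X \<delta> where X: "\<D> X \<delta>" "obj X 0 = A" "obj X (Suc 0) = B" "diff X 0 = u"
    using assms(1) by (auto simp: first_mor_def)
  obtain Y \<rho> where Y: "\<D> Y \<rho>" "obj Y 0 = B" "obj Y (Suc 0) = F" "diff Y 0 = v"
    using assms(2) by (auto simp: first_mor_def)
  have YX: "obj Y 0 = obj X (Suc 0)" using X Y by simp
  obtain V \<sigma> t t' where V: "\<D> V \<sigma>" "obj V 0 = A"
    and t: "t \<in> H (obj V (Suc 0)) F" "v \<cdot> u = t \<cdot> diff V 0"
    and t': "t' \<in> H F (obj V (Suc 0))" "diff V 0 = t' \<cdot> (v \<cdot> u)"
    using first_cmp_factor[OF X(1) Y(1) YX] X Y by metis
  show ?thesis
  \<comment> \<open>The exchange complex alters degrees 1 to 3, which exist only for n \<ge> 2; for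
    n = 1 the factorizations feed \<open>D_first_cmp\<close> instead.\<close>
  proof (cases "n = Suc 0")
    case True
    then obtain W \<omega> where "\<D> W \<omega>" "obj W 0 = A" "obj W (Suc 0) = F" "diff W 0 = v \<cdot> u"
      using D_first_cmp[OF True X(1) Y(1) YX V(1), of t t'] V(2) t t' unfolding X(2-4) Y(2-4) by blast
    thus ?thesis by (auto simp: first_mor_def)
  next
    case False
    hence n: "Suc 0 < n" using n_pos by simp
    define V1 e where V1_def: "V1 = obj V (Suc 0)" "e = diff V 0"
    have e: "e \<in> H A V1" using D_diff[OF V(1), of 0] V by (simp add: V1_def)
    note t = t[folded V1_def] and t' = t'[folded V1_def]
    have w: "v \<cdot> u \<in> H A F" unfolding t(2) by (rule cmp_Hom[OF e t(1)])
    have oV: "V1 \<in> Ob C" using e Hom_cod by blast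
    \<comment> \<open>1 - t' t kills the first differential of V because t' t fixes it, so it
      factors through the second one. The factor is the map r that the exchange complex
      needs.\<close>
    let ?s = "idt C V1 \<boxminus>\<^bsub>V1,V1\<^esub> t' \<cdot> t"
    note t't = cmp_Hom[OF t(1) t'(1)]
    have "?s \<cdot> e = \<zero>\<^bsub>A,V1\<^esub>"
      using sub_distl[OF e id_Hom[OF oV] t't] idl[OF e] assoc[OF e t(1) t'(1)] t(2)[symmetric] t'(2)[symmetric]
        sub_self[OF e] by simp
    then obtain r where r: "r \<in> H (obj V (Suc (Suc 0))) V1" "?s = r \<cdot> diff V (Suc 0)"
      using con_exact_factor[OF D_con[OF V(1)] n_pos, of ?s V1] sub_Hom[OF id_Hom[OF oV] t't] V
      by (auto simp: V1_def)
    let ?N = "\<lparr>obj = exchange_obj C V F, diff = exchange_diff C V F (v \<cdot> u) t t' r\<rparr>"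
    have "con_exact C n ?N"
      by (rule exchange_con_exact[OF D_con[OF V(1)] n])
        (use w t t' r V in \<open>simp_all add: V1_def\<close>)
    hence "\<exists>\<rho>. \<D> ?N \<rho>"
      by (rule realize_con_exact[OF V(1), of _ t t']) (use t t' in \<open>simp_all add: V1_def\<close>)
    thus ?thesis using V by (auto simp: first_mor_def intro!: exI[of _ ?N])
  qed
qed

end

section \<open>Weak isomorphisms\<close>

context additive_category
begin

text \<open>A weak isomorphism which is invertible in degrees \<open>k \<le> n\<close> and \<open>k + 1\<close> has a homotopy
  inverse in all degrees below; only degrees 0 and 1 of it are needed.\<close>

lemma homotopy_descend:
  assumes Y: "cov_exact C n Y" and k: "k < n"
    and e: "e \<in> H (obj Y k) (obj Y k)" and e': "e' \<in> H (obj Y (Suc k)) (obj Y (Suc k))"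
    and comm: "e' \<cdot> diff Y k = diff Y k \<cdot> e"
    and h: "h \<in> H (obj Y (Suc (Suc k))) (obj Y (Suc k))"
    and eq: "diff Y (Suc k) \<cdot> (e' \<boxminus>\<^bsub>obj Y (Suc k),obj Y (Suc k)\<^esub>
        (idt C (obj Y (Suc k)) \<boxplus>\<^bsub>obj Y (Suc k),obj Y (Suc k)\<^esub> h \<cdot> diff Y (Suc k)))
      = \<zero>\<^bsub>obj Y (Suc k),obj Y (Suc (Suc k))\<^esub>"
  shows "\<exists>h'\<in>H (obj Y (Suc k)) (obj Y k). diff Y k \<cdot> (e \<boxminus>\<^bsub>obj Y k,obj Y k\<^esub>
        (idt C (obj Y k) \<boxplus>\<^bsub>obj Y k,obj Y k\<^esub> h' \<cdot> diff Y k)) = \<zero>\<^bsub>obj Y k,obj Y (Suc k)\<^esub>"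
proof -
  note cY = cov_exact_complex[OF Y]
  define A B F where o_def: "A = obj Y k" "B = obj Y (Suc k)" "F = obj Y (Suc (Suc k))"
  define d d' where d_def: "d = diff Y k" "d' = diff Y (Suc k)"
  note simps = o_def[symmetric] d_def[symmetric]
  have d: "d \<in> H A B" and d': "d' \<in> H B F" and dd: "d' \<cdot> d = \<zero>\<^bsub>A,F\<^esub>"
    using complex_diff[OF cY] complex_dd[OF cY k] k by (auto simp: o_def d_def)
  have o: "A \<in> Ob C" "B \<in> Ob C" using d Hom_dom Hom_cod by blast+
  note e = e[unfolded simps] and e' = e'[unfolded simps] and comm = comm[unfolded simps]
    and h = h[unfolded simps] and eq = eq[unfolded simps]
  note hd = cmp_Hom[OF d' h] and I = id_Hom[OF o(2)] and IA = id_Hom[OF o(1)]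
  let ?s = "e' \<boxminus>\<^bsub>B,B\<^esub> (idt C B \<boxplus>\<^bsub>B,B\<^esub> h \<cdot> d')"
  have s: "?s \<in> H B B" by (intro sub_Hom add_Hom e' I hd)
  \<comment> \<open>The defect is only known to vanish after composition with d'. Exactness turns it
    into d h', the missing half of the homotopy in degree k + 1, and the same h' is the half needed
    in degree k.\<close>
  obtain h' where h': "h' \<in> H B A" "?s = d \<cdot> h'"
    using cov_exact_factor[OF Y k, of ?s B] s eq by (auto simp: simps)
  note hd' = cmp_Hom[OF d h'(1)]
  have "d \<cdot> h' \<cdot> d = d \<cdot> e \<boxminus>\<^bsub>A,B\<^esub> d"
  proof -
    have "?s \<cdot> d = e' \<cdot> d \<boxminus>\<^bsub>A,B\<^esub> (d \<boxplus>\<^bsub>A,B\<^esub> h \<cdot> (d' \<cdot> d))"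
      using sub_distl[OF d e' add_Hom[OF I hd]] distl[OF d I hd] idl[OF d] assoc[OF d d' h] by simp
    thus ?thesis using h'(2) comm dd cmp_zero[OF h o(1)] add_zero(1)[OF d] by simp
  qed
  hence "d \<cdot> (idt C A \<boxplus>\<^bsub>A,A\<^esub> h' \<cdot> d) = d \<boxplus>\<^bsub>A,B\<^esub> (d \<cdot> e \<boxminus>\<^bsub>A,B\<^esub> d)"
    using distr[OF IA hd' d] idr[OF d] assoc[OF d h'(1) d] by simp
  also have "\<dots> = d \<cdot> e" by (rule add_sub(3)[OF cmp_Hom[OF e d] d])
  finally have "d \<cdot> (e \<boxminus>\<^bsub>A,A\<^esub> (idt C A \<boxplus>\<^bsub>A,A\<^esub> h' \<cdot> d)) = \<zero>\<^bsub>A,B\<^esub>"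
    using sub_distr[OF e add_Hom[OF IA hd'] d] sub_self[OF cmp_Hom[OF e d]] by simp
  thus ?thesis using h'(1) by (auto simp: simps)
qed

text \<open>What is carried down from degree k is the homotopy relation composed with the outgoing
  differential, because the other half of the homotopy is only found one step later. In degree 0
  that differential is monic and can be cancelled.\<close>

lemma cov_exact_left_inverse:
  assumes X: "cov_exact C n X" and Y: "cov_exact C n Y" and f: "chain_map_on C 0 (Suc n) X Y f"
    and k: "k \<le> n" and iso: "is_iso C (obj X k) (obj Y k) (f k)" "is_iso C (obj X (Suc k)) (obj Y (Suc k)) (f (Suc k))"
  shows "\<exists>g0\<in>H (obj Y 0) (obj X 0). \<exists>g1\<in>H (obj Y (Suc 0)) (obj X (Suc 0)).
    \<exists>h\<in>H (obj X (Suc 0)) (obj X 0). \<exists>h'\<in>H (obj Y (Suc 0)) (obj Y 0).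
    g1 \<cdot> diff Y 0 = diff X 0 \<cdot> g0 \<and>
    g0 \<cdot> f 0 = idt C (obj X 0) \<boxplus>\<^bsub>obj X 0,obj X 0\<^esub> h \<cdot> diff X 0 \<and>
    f 0 \<cdot> g0 = idt C (obj Y 0) \<boxplus>\<^bsub>obj Y 0,obj Y 0\<^esub> h' \<cdot> diff Y 0"
proof -
  note cX = cov_exact_complex[OF X] and cY = cov_exact_complex[OF Y]
  note fH = chain_map_Hom[OF f cX cY] and dX = complex_diff[OF cX] and dY = complex_diff[OF cY]
    and oX = complex_obj[OF cX] and oY = complex_obj[OF cY]
  define Q where "Q k g0 g1 h h' \<longleftrightarrow> g0 \<in> H (obj Y k) (obj X k) \<and> g1 \<in> H (obj Y (Suc k)) (obj X (Suc k)) \<and>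
      h \<in> H (obj X (Suc k)) (obj X k) \<and> h' \<in> H (obj Y (Suc k)) (obj Y k) \<and>
      g1 \<cdot> diff Y k = diff X k \<cdot> g0 \<and>
      diff X k \<cdot> (g0 \<cdot> f k \<boxminus>\<^bsub>obj X k,obj X k\<^esub> (idt C (obj X k) \<boxplus>\<^bsub>obj X k,obj X k\<^esub> h \<cdot> diff X k))
        = \<zero>\<^bsub>obj X k,obj X (Suc k)\<^esub> \<and>
      diff Y k \<cdot> (f k \<cdot> g0 \<boxminus>\<^bsub>obj Y k,obj Y k\<^esub> (idt C (obj Y k) \<boxplus>\<^bsub>obj Y k,obj Y k\<^esub> h' \<cdot> diff Y k))
        = \<zero>\<^bsub>obj Y k,obj Y (Suc k)\<^esub>" for k g0 g1 h h'
  have base: "\<exists>g0 g1 h h'. Q k g0 g1 h h'"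
  proof -
    have ok: "obj X k \<in> Ob C" "obj Y k \<in> Ob C" "obj X (Suc k) \<in> Ob C" "obj Y (Suc k) \<in> Ob C"
      using k oX oY by auto
    obtain g0 where g0: "g0 \<in> H (obj Y k) (obj X k)" "g0 \<cdot> f k = idt C (obj X k)" "f k \<cdot> g0 = idt C (obj Y k)"
      using iso(1) ok by (auto simp: is_iso_def Hom_def)
    obtain g1 where g1: "g1 \<in> H (obj Y (Suc k)) (obj X (Suc k))" "g1 \<cdot> f (Suc k) = idt C (obj X (Suc k))"
      using iso(2) ok by (auto simp: is_iso_def Hom_def)
    have fk: "f k \<in> H (obj X k) (obj Y k)" "f (Suc k) \<in> H (obj X (Suc k)) (obj Y (Suc k))" using fH k by auto
    have dk: "diff X k \<in> H (obj X k) (obj X (Suc k))" "diff Y k \<in> H (obj Y k) (obj Y (Suc k))" using dX dY k by auto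
    have "g1 \<cdot> diff Y k = g1 \<cdot> (diff Y k \<cdot> (f k \<cdot> g0))" using g0(3) idr[OF dk(2)] by simp
    also have "\<dots> = g1 \<cdot> (f (Suc k) \<cdot> diff X k \<cdot> g0)"
      using assoc[OF g0(1) fk(1) dk(2)] chain_map_comm[OF f k] by simp
    also have "\<dots> = diff X k \<cdot> g0"
      using assoc[OF g0(1) dk(1) fk(2)] assoc[OF cmp_Hom[OF g0(1) dk(1)] fk(2) g1(1)] g1(2)
        idl[OF cmp_Hom[OF g0(1) dk(1)]] by simp
    finally have comm: "g1 \<cdot> diff Y k = diff X k \<cdot> g0" .
    have van: "d \<cdot> (idt C A \<boxminus>\<^bsub>A,A\<^esub> (idt C A \<boxplus>\<^bsub>A,A\<^esub> \<zero>\<^bsub>B,A\<^esub> \<cdot> d)) = \<zero>\<^bsub>A,B\<^esub>"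
      if d: "d \<in> H A B" for d A B
    proof -
      have A: "A \<in> Ob C" using d Hom_dom by blast
      show ?thesis using zero_cmp[OF d A] add_zero(1)[OF id_Hom[OF A]] sub_self[OF id_Hom[OF A]] cmp_zero[OF d A] by simp
    qed
    \<comment> \<open>In the starting degree f has a true inverse, so the homotopies are zero
      there.\<close>
    have "Q k g0 g1 \<zero>\<^bsub>obj X (Suc k),obj X k\<^esub> \<zero>\<^bsub>obj Y (Suc k),obj Y k\<^esub>"
      unfolding Q_def using g0 g1 comm van[OF dk(1)] van[OF dk(2)] ok by (simp add: zero_Hom)
    thus ?thesis by blast
  qed
  have step: "\<exists>g0 g1 h h'. Q k g0 g1 h h'" if k: "k < n" and IH: "Q (Suc k) g1 g2 h h'" for k g1 g2 h h'
  proof -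
    note IH = IH[unfolded Q_def]
    have g1: "g1 \<in> H (obj Y (Suc k)) (obj X (Suc k))" using IH by blast
    have g2: "g2 \<in> H (obj Y (Suc (Suc k))) (obj X (Suc (Suc k)))" using IH by blast
    have dk: "diff X k \<in> H (obj X k) (obj X (Suc k))" "diff Y k \<in> H (obj Y k) (obj Y (Suc k))"
      "diff X (Suc k) \<in> H (obj X (Suc k)) (obj X (Suc (Suc k)))" "diff Y (Suc k) \<in> H (obj Y (Suc k)) (obj Y (Suc (Suc k)))"
      using dX dY k by auto
    have fk: "f k \<in> H (obj X k) (obj Y k)" "f (Suc k) \<in> H (obj X (Suc k)) (obj Y (Suc k))" using fH k by auto
    have oYk: "obj Y k \<in> Ob C" using dk Hom_dom by blast
    have "diff X (Suc k) \<cdot> (g1 \<cdot> diff Y k) = g2 \<cdot> (diff Y (Suc k) \<cdot> diff Y k)"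
      using assoc[OF dk(2) g1 dk(3)] assoc[OF dk(2,4) g2] IH by simp
    also have "\<dots> = \<zero>\<^bsub>obj Y k,obj X (Suc (Suc k))\<^esub>" using complex_dd[OF cY k] cmp_zero[OF g2 oYk] by simp
    finally obtain g0 where g0: "g0 \<in> H (obj Y k) (obj X k)" "g1 \<cdot> diff Y k = diff X k \<cdot> g0"
      using cov_exact_factor[OF X k cmp_Hom[OF dk(2) g1]] by blast
    have "g1 \<cdot> f (Suc k) \<cdot> diff X k = diff X k \<cdot> (g0 \<cdot> f k)"
      using assoc[OF dk(1) fk(2) g1] chain_map_comm[OF f, of k] k assoc[OF fk(1) dk(2) g1] g0(2)
        assoc[OF fk(1) g0(1) dk(1)] by simp
    moreover have "f (Suc k) \<cdot> g1 \<cdot> diff Y k = diff Y k \<cdot> (f k \<cdot> g0)"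
      using assoc[OF dk(2) g1 fk(2)] g0(2) assoc[OF g0(1) dk(1) fk(2)] chain_map_comm[OF f, of k] k
        assoc[OF g0(1) fk(1) dk(2)] by simp
    ultimately show ?thesis
      using homotopy_descend[OF X k cmp_Hom[OF fk(1) g0(1)] cmp_Hom[OF fk(2) g1], of h]
        homotopy_descend[OF Y k cmp_Hom[OF g0(1) fk(1)] cmp_Hom[OF g1 fk(2)], of h'] IH g0 g1
      unfolding Q_def by blast
  qed
  have "\<exists>g0 g1 h h'. Q 0 g0 g1 h h'"
    using k base
  proof (induction k)
    case (Suc k) thus ?case using step[of k] by auto
  qed
  then obtain g0 g1 h h' where q: "Q 0 g0 g1 h h'" by blast
  note q = q[unfolded Q_def]
  have *: "g = a" if "cov_exact C n Z" "g \<in> H (obj Z 0) (obj Z 0)" "a \<in> H (obj Z 0) (obj Z 0)"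
    "diff Z 0 \<cdot> (g \<boxminus>\<^bsub>obj Z 0,obj Z 0\<^esub> a) = \<zero>\<^bsub>obj Z 0,obj Z (Suc 0)\<^esub>" for Z g a
    using cov_exact_mono[OF that(1) sub_Hom[OF that(2,3)]] that(4) sub_eq_zero[OF that(2,3)] by simp
  have H0: "f 0 \<in> H (obj X 0) (obj Y 0)" "diff X 0 \<in> H (obj X 0) (obj X (Suc 0))" "diff Y 0 \<in> H (obj Y 0) (obj Y (Suc 0))"
    "idt C (obj X 0) \<in> H (obj X 0) (obj X 0)" "idt C (obj Y 0) \<in> H (obj Y 0) (obj Y 0)"
    using fH dX dY oX oY id_Hom by auto
  have g0: "g0 \<in> H (obj Y 0) (obj X 0)" and hh: "h \<in> H (obj X (Suc 0)) (obj X 0)" "h' \<in> H (obj Y (Suc 0)) (obj Y 0)"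
    using q by auto
  have "g0 \<cdot> f 0 = idt C (obj X 0) \<boxplus>\<^bsub>obj X 0,obj X 0\<^esub> h \<cdot> diff X 0"
    by (rule *[OF X cmp_Hom[OF H0(1) g0] add_Hom[OF H0(4) cmp_Hom[OF H0(2) hh(1)]]]) (use q in blast)
  moreover have "f 0 \<cdot> g0 = idt C (obj Y 0) \<boxplus>\<^bsub>obj Y 0,obj Y 0\<^esub> h' \<cdot> diff Y 0"
    by (rule *[OF Y cmp_Hom[OF g0 H0(1)] add_Hom[OF H0(5) cmp_Hom[OF H0(3) hh(2)]]]) (use q in blast)
  ultimately show ?thesis using q by blast
qed

end

context extension_calculus
begin

text \<open>A homotopy inverse g in degrees 0 and 1 puts X and Y in symmetric positions, so
  \<open>realize_retract\<close> gives both directions.\<close>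

lemma weak_iso_inner:
  assumes X: "con_exact C n X" "cov_exact C n X" and Y: "con_exact C n Y" "cov_exact C n Y"
    and f: "chain_map_on C 0 (Suc n) X Y f"
    and k: "k \<le> n" and iso: "is_iso C (obj X k) (obj Y k) (f k)" "is_iso C (obj X (Suc k)) (obj Y (Suc k)) (f (Suc k))"
  shows "(\<exists>\<delta>. \<D> X \<delta>) \<longleftrightarrow> (\<exists>\<rho>. \<D> Y \<rho>)"
proof -
  obtain g0 g1 h h' where g: "g0 \<in> H (obj Y 0) (obj X 0)" "g1 \<in> H (obj Y (Suc 0)) (obj X (Suc 0))"
    "g1 \<cdot> diff Y 0 = diff X 0 \<cdot> g0"
    and h: "h \<in> H (obj X (Suc 0)) (obj X 0)" "g0 \<cdot> f 0 = idt C (obj X 0) \<boxplus>\<^bsub>obj X 0,obj X 0\<^esub> h \<cdot> diff X 0"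
    and h': "h' \<in> H (obj Y (Suc 0)) (obj Y 0)" "f 0 \<cdot> g0 = idt C (obj Y 0) \<boxplus>\<^bsub>obj Y 0,obj Y 0\<^esub> h' \<cdot> diff Y 0"
    using cov_exact_left_inverse[OF X(2) Y(2) f k iso] by blast
  note fH = chain_map_Hom[OF f con_exact_complex[OF X(1)] con_exact_complex[OF Y(1)]]
  have f01: "f 0 \<in> H (obj X 0) (obj Y 0)" "f (Suc 0) \<in> H (obj X (Suc 0)) (obj Y (Suc 0))"
    "f (Suc 0) \<cdot> diff X 0 = diff Y 0 \<cdot> f 0" using fH chain_map_comm[OF f] by auto
  show ?thesis
    using realize_retract[OF _ Y(1) g f01(1) h'] realize_retract[OF _ X(1) f01 g(1) h] by blast
qed

text \<open>\<open>realize_retract\<close> with an honest retraction and zero homotopy. For a weak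
  isomorphism invertible in degrees n + 1 and 0 this is one of the two directions; its dual
  \<open>weak_iso_last\<close> is the other.\<close>

lemma weak_iso_first:
  assumes X: "con_exact C n X" and Y: "\<D> Y \<rho>" and f: "chain_map_on C 0 (Suc n) X Y f"
    and iso: "is_iso C (obj X 0) (obj Y 0) (f 0)"
  shows "\<exists>\<delta>. \<D> X \<delta>"
proof -
  note cX = con_exact_complex[OF X]
  note fH = chain_map_Hom[OF f cX D_complex[OF Y]]
  have o: "obj X 0 \<in> Ob C" "obj X (Suc 0) \<in> Ob C" "obj Y 0 \<in> Ob C"
    using complex_obj[OF cX] D_obj[OF Y] by auto
  have dX: "diff X 0 \<in> H (obj X 0) (obj X (Suc 0))" using complex_diff[OF cX] by auto
  have f01: "f 0 \<in> H (obj X 0) (obj Y 0)" "f (Suc 0) \<in> H (obj X (Suc 0)) (obj Y (Suc 0))"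
    "f (Suc 0) \<cdot> diff X 0 = diff Y 0 \<cdot> f 0" using fH chain_map_comm[OF f] by auto
  obtain j where j: "j \<in> H (obj Y 0) (obj X 0)" "j \<cdot> f 0 = idt C (obj X 0)"
    using iso o by (auto simp: is_iso_def Hom_def)
  have "j \<cdot> f 0 = idt C (obj X 0) \<boxplus>\<^bsub>obj X 0,obj X 0\<^esub> \<zero>\<^bsub>obj X (Suc 0),obj X 0\<^esub> \<cdot> diff X 0"
    using j(2) zero_cmp[OF dX o(1)] add_zero(1)[OF id_Hom[OF o(1)]] by simp
  thus ?thesis by (rule realize_retract[OF Y X f01 j(1) zero_Hom[OF o(2,1)]])
qed

end

section \<open>Duality\<close>

definition opc :: "('o, 'm) cat \<Rightarrow> ('o, 'm) cat" where
  "opc C = \<lparr>Ob = Ob C, Mor = (\<lambda>A B. Mor C B A), idt = idt C, cmp = (\<lambda>g f. f \<bullet>\<^bsub>C\<^esub> g)\<rparr>"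

definition ope :: "('o, 'm, 'e) bifunctor \<Rightarrow> ('o, 'm, 'e) bifunctor" where
  "ope E = \<lparr>Ext = (\<lambda>K A. Ext E A K), push = pull E, pull = push E\<rparr>"

text \<open>Truncated subtraction makes the values beyond the relevant range constant, so a double
  reversal agrees with the original complex in the relevant degrees but need not be the same
  record.\<close>

definition rev_cpx :: "nat \<Rightarrow> ('o, 'm) cpx \<Rightarrow> ('o, 'm) cpx" where
  "rev_cpx n X = \<lparr>obj = (\<lambda>i. obj X (Suc n - i)), diff = (\<lambda>i. diff X (n - i))\<rparr>"

lemma opc_simps [simp]: "Ob (opc C) = Ob C" "Mor (opc C) A B = Mor C B A" "idt (opc C) = idt C"
    "g \<bullet>\<^bsub>opc C\<^esub> f = f \<bullet>\<^bsub>C\<^esub> g"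
  by (simp_all add: opc_def)

lemma ope_simps [simp]: "Ext (ope E) K A = Ext E A K" "push (ope E) = pull E" "pull (ope E) = push E"
  by (simp_all add: ope_def)

lemma rev_cpx_simps [simp]: "obj (rev_cpx n X) i = obj X (Suc n - i)" "diff (rev_cpx n X) i = diff X (n - i)"
  by (simp_all add: rev_cpx_def)

lemma Hom_opc [simp]: "Hom (opc C) A B = Hom C B A"
  by (auto simp: Hom_def)

lemma (in preadditive_category) opc_preadditive: "preadditive_category (opc C)"
  by (rule preadditive_category.intro)
    (auto simp: id_arr cmp_assoc id_left id_right Mor_group cmp_add_left cmp_add_right intro: cmp_arr)

lemma (in additive_category) opc_additive: "additive_category (opc C)"
proof (intro additive_category.intro additive_category_axioms.intro)
  show "preadditive_category (opc C)" by (rule opc_preadditive)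
  show "\<exists>Z. zero_object (opc C) Z" using ex_zero_object by (auto simp: zero_object_def conj_commute)
  fix A B assume "A \<in> Ob (opc C)" "B \<in> Ob (opc C)"
  then obtain S where "is_biproduct C A B S" using ex_biproduct by auto
  hence "is_biproduct (opc C) A B \<lparr>sumob = sumob S, in1 = pr1 S, in2 = pr2 S, pr1 = in1 S, pr2 = in2 S\<rparr>"
    by (auto simp: is_biproduct_def)
  thus "\<exists>S. is_biproduct (opc C) A B S" by blast
qed

lemma (in additive_bifunctor) ope_bifunctor: "additive_bifunctor (opc C) (ope E)"
  by (rule additive_bifunctor.intro)
    (auto simp: Ext_group push_hom pull_hom push_id pull_id push_cmp pull_cmp push_pull push_add pull_add)

lemma chain_map_opc:
  assumes "chain_map_on (opc C) 0 (Suc n) X Y f"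
  shows "chain_map_on C 0 (Suc n) (rev_cpx n Y) (rev_cpx n X) (\<lambda>i. f (Suc n - i))"
  unfolding chain_map_on_def
proof (intro conjI ballI)
  fix i assume "i \<in> {0..Suc n}"
  thus "f (Suc n - i) \<in> arr C (obj (rev_cpx n Y) i) (obj (rev_cpx n X) i)"
    using assms by (simp add: chain_map_on_def)
next
  fix i assume "i \<in> {0..<Suc n}"
  hence "n - i < Suc n" "Suc n - i = Suc (n - i)" by auto
  thus "f (Suc n - Suc i) \<bullet>\<^bsub>C\<^esub> diff (rev_cpx n Y) i = diff (rev_cpx n X) i \<bullet>\<^bsub>C\<^esub> f (Suc n - i)"
    using assms by (simp add: chain_map_on_def)
qed

lemma chain_map_opc':
  assumes "chain_map_on C 0 (Suc n) (rev_cpx n Y) (rev_cpx n X) f"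
  shows "chain_map_on (opc C) 0 (Suc n) X Y (\<lambda>i. f (Suc n - i))"
  unfolding chain_map_on_def
proof (intro conjI ballI)
  fix i assume "i \<in> {0..Suc n}"
  hence "Suc n - i \<le> Suc n" "Suc n - (Suc n - i) = i" by auto
  thus "f (Suc n - i) \<in> arr (opc C) (obj X i) (obj Y i)"
    using assms by (auto simp: chain_map_on_def dest: bspec[of _ _ "Suc n - i"])
next
  fix i assume "i \<in> {0..<Suc n}"
  hence "n - i < Suc n" "Suc n - i = Suc (n - i)" "n - (n - i) = i" by auto
  thus "f (Suc n - Suc i) \<bullet>\<^bsub>opc C\<^esub> diff X i = diff Y i \<bullet>\<^bsub>opc C\<^esub> f (Suc n - i)"
    using assms by (auto simp: chain_map_on_def dest: bspec[of _ _ "n - i"])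
qed

context additive_category
begin

lemma complex_opc: "complex_on (opc C) 0 (Suc n) X \<longleftrightarrow> complex_on C 0 (Suc n) (rev_cpx n X)"
proof
  assume X: "complex_on (opc C) 0 (Suc n) X"
  interpret op: additive_category "opc C" by (rule opc_additive)
  show "complex_on C 0 (Suc n) (rev_cpx n X)"
  proof (rule complexI)
    fix i assume "i \<le> n"
    thus "diff (rev_cpx n X) i \<in> H (obj (rev_cpx n X) i) (obj (rev_cpx n X) (Suc i))"
      using op.complex_diff[OF X, of "n - i"] by (simp add: Suc_diff_le)
  next
    fix i assume i: "i < n"
    hence "Suc n - i = Suc (Suc (n - Suc i))" "n - i = Suc (n - Suc i)" by auto
    thus "diff (rev_cpx n X) (Suc i) \<cdot> diff (rev_cpx n X) i =
        \<zero>\<^bsub>obj (rev_cpx n X) i,obj (rev_cpx n X) (Suc (Suc i))\<^esub>"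
      using op.complex_dd[OF X, of "n - Suc i"] i by simp
  qed
next
  assume X: "complex_on C 0 (Suc n) (rev_cpx n X)"
  interpret op: additive_category "opc C" by (rule opc_additive)
  show "complex_on (opc C) 0 (Suc n) X"
  proof (rule op.complexI)
    fix i assume "i \<le> n"
    thus "diff X i \<in> op.H (obj X i) (obj X (Suc i))"
      using complex_diff[OF X, of "n - i"] by (simp add: Suc_diff_le)
  next
    fix i assume i: "i < n"
    hence "Suc n - (n - Suc i) = Suc (Suc i)" "n - (n - Suc i) = Suc i" "Suc (n - Suc i) = n - i" "n - (n - i) = i"
      by auto
    thus "diff X (Suc i) \<bullet>\<^bsub>opc C\<^esub> diff X i = zerom (opc C) (obj X i) (obj X (Suc (Suc i)))"
      using complex_dd[OF X, of "n - Suc i"] i by simp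
  qed
qed

lemma con_exact_opc: assumes X: "cov_exact C n (rev_cpx n X)" shows "con_exact (opc C) n X"
  unfolding con_exact_def
proof (intro conjI ballI allI impI)
  show "complex_on (opc C) 0 (Suc n) X" using cov_exact_complex[OF X] by (simp add: complex_opc)
next
  fix T g assume "g \<in> Hom (opc C) (obj X (Suc n)) T" "g \<bullet>\<^bsub>opc C\<^esub> diff X n = zerom (opc C) (obj X n) T"
  thus "g = zerom (opc C) (obj X (Suc n)) T" using cov_exact_mono[OF X, of g T] by simp
next
  fix T i g assume i: "i < n" and g: "g \<in> Hom (opc C) (obj X (Suc i)) T"
    "g \<bullet>\<^bsub>opc C\<^esub> diff X i = zerom (opc C) (obj X i) T"
  \<comment> \<open>Degree i + 1 here is degree n - i of the reversed complex, so exactness there is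
    used at index n - (i + 1).\<close>
  have "Suc n - (n - Suc i) = Suc (Suc i)" "n - (n - Suc i) = Suc i" "Suc (n - Suc i) = n - i" "n - (n - i) = i"
    "Suc n - Suc (n - i) = i" "Suc n - (n - i) = Suc i"
    using i by auto
  thus "\<exists>k\<in>Hom (opc C) (obj X (Suc (Suc i))) T. g = k \<bullet>\<^bsub>opc C\<^esub> diff X (Suc i)"
    using cov_exact_factor[OF X, of "n - Suc i" g T] g i by simp
qed

lemma cov_exact_opc: assumes X: "con_exact C n (rev_cpx n X)" shows "cov_exact (opc C) n X"
  unfolding cov_exact_def
proof (intro conjI ballI allI impI)
  show "complex_on (opc C) 0 (Suc n) X" using con_exact_complex[OF X] by (simp add: complex_opc)
next
  fix T g assume "g \<in> Hom (opc C) T (obj X 0)" "diff X 0 \<bullet>\<^bsub>opc C\<^esub> g = zerom (opc C) T (obj X 1)"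
  thus "g = zerom (opc C) T (obj X 0)" using con_exact_epi[OF X, of g T] by simp
next
  fix T i g assume i: "i < n" and g: "g \<in> Hom (opc C) T (obj X (Suc i))"
    "diff X (Suc i) \<bullet>\<^bsub>opc C\<^esub> g = zerom (opc C) T (obj X (Suc (Suc i)))"
  have "Suc n - (n - Suc i) = Suc (Suc i)" "n - (n - Suc i) = Suc i" "Suc (n - Suc i) = n - i" "n - (n - i) = i"
    "Suc n - Suc (n - i) = i" "Suc n - (n - i) = Suc i"
    using i by auto
  thus "\<exists>k\<in>Hom (opc C) T (obj X i). g = diff X i \<bullet>\<^bsub>opc C\<^esub> k"
    using con_exact_factor[OF X, of "n - Suc i" g T] g i by simp
qed

lemma homotopic_opc:
  assumes X: "complex_on C 0 (Suc n) (rev_cpx n X)" and Y: "complex_on C 0 (Suc n) (rev_cpx n Y)"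
    and "homotopic (opc C) n X Y f g"
  shows "homotopic C n (rev_cpx n Y) (rev_cpx n X) (\<lambda>i. f (Suc n - i)) (\<lambda>i. g (Suc n - i))"
proof -
  obtain h where h: "\<forall>i\<le>n. h i \<in> arr C (obj Y i) (obj X (Suc i))"
    "f 0 = g 0 \<boxplus>\<^bsub>obj Y 0,obj X 0\<^esub> diff X 0 \<cdot> h 0"
    "\<forall>i<n. f (Suc i) = g (Suc i) \<boxplus>\<^bsub>obj Y (Suc i),obj X (Suc i)\<^esub>
           (h i \<cdot> diff Y i \<boxplus>\<^bsub>obj Y (Suc i),obj X (Suc i)\<^esub> diff X (Suc i) \<cdot> h (Suc i))"
    "f (Suc n) = g (Suc n) \<boxplus>\<^bsub>obj Y (Suc n),obj X (Suc n)\<^esub> h n \<cdot> diff Y n"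
    using assms(3) by (auto simp: homotopic_def)
  show ?thesis unfolding homotopic_def
  proof (intro exI[of _ "\<lambda>i. h (n - i)"] conjI allI impI)
    fix i assume "i \<le> n"
    thus "h (n - i) \<in> arr C (obj (rev_cpx n Y) (Suc i)) (obj (rev_cpx n X) i)"
      using h(1) by (simp add: Suc_diff_le)
  next
    fix i assume i: "i < n"
    define m where "m = n - Suc i"
    have m: "m < n" "n - i = Suc m" "n - Suc i = m" "Suc n - Suc i = Suc m" using i by (auto simp: m_def)
    have o: "obj Y m \<in> Ob C" "obj Y (Suc m) \<in> Ob C" "obj X (Suc m) \<in> Ob C" "obj X (Suc (Suc m)) \<in> Ob C"
      using complex_obj[OF Y, of "Suc n - m"] complex_obj[OF Y, of "n - m"] complex_obj[OF X, of "n - m"]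
        complex_obj[OF X, of "n - Suc m"] m(1) by (auto simp: Suc_diff_le Suc_diff_Suc)
    have hm: "h m \<in> H (obj Y m) (obj X (Suc m))" "h (Suc m) \<in> H (obj Y (Suc m)) (obj X (Suc (Suc m)))"
      using h(1) m(1) o by (auto simp: Hom_def)
    have dm: "diff Y m \<in> H (obj Y (Suc m)) (obj Y m)" "diff X (Suc m) \<in> H (obj X (Suc (Suc m))) (obj X (Suc m))"
      using complex_diff[OF Y, of "n - m"] complex_diff[OF X, of "n - Suc m"] m(1)
      by (auto simp: Suc_diff_le Suc_diff_Suc)
    \<comment> \<open>Passing to the opposite category exchanges the summands dh and hd, so the two
      equations agree up to commutativity of addition.\<close>
    show "f (Suc n - Suc i) = g (Suc n - Suc i) \<boxplus>\<^bsub>obj (rev_cpx n Y) (Suc i),obj (rev_cpx n X) (Suc i)\<^esub>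
        (diff (rev_cpx n X) i \<cdot> h (n - i) \<boxplus>\<^bsub>obj (rev_cpx n Y) (Suc i),obj (rev_cpx n X) (Suc i)\<^esub>
         h (n - Suc i) \<cdot> diff (rev_cpx n Y) (Suc i))"
      using h(3) m add_comm[OF cmp_Hom[OF hm(2) dm(2)] cmp_Hom[OF dm(1) hm(1)]] by simp
  qed (use h in simp_all)
qed

lemma hequiv_opc:
  assumes X: "complex_on C 0 (Suc n) (rev_cpx n X)" and Y: "complex_on C 0 (Suc n) (rev_cpx n Y)"
    and "hequiv (opc C) n X Y"
  shows "hequiv C n (rev_cpx n X) (rev_cpx n Y)"
proof -
  obtain f g where f: "end_fixing_map (opc C) n X Y f" and g: "end_fixing_map (opc C) n Y X g"
    and h: "homotopic (opc C) n X X (\<lambda>i. g i \<bullet>\<^bsub>opc C\<^esub> f i) (\<lambda>i. idt (opc C) (obj X i))"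
      "homotopic (opc C) n Y Y (\<lambda>i. f i \<bullet>\<^bsub>opc C\<^esub> g i) (\<lambda>i. idt (opc C) (obj Y i))"
    using assms(3) unfolding hequiv_def by blast
  have "end_fixing_map C n (rev_cpx n Y) (rev_cpx n X) (\<lambda>i. f (Suc n - i))"
    using f chain_map_opc[of C n X Y f] unfolding end_fixing_map_def by auto
  moreover have "end_fixing_map C n (rev_cpx n X) (rev_cpx n Y) (\<lambda>i. g (Suc n - i))"
    using g chain_map_opc[of C n Y X g] unfolding end_fixing_map_def by auto
  ultimately show ?thesis unfolding hequiv_def
    using homotopic_opc[OF X X h(1)] homotopic_opc[OF Y Y h(2)] by auto
qed

text \<open>Identities form chain maps between records that agree in degrees 0, ..., n + 1. This
  bridges the difference between a complex and its double reversal.\<close>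

lemma hequiv_cong:
  assumes X: "complex_on C 0 (Suc n) X"
    and o: "\<And>i. i \<le> Suc n \<Longrightarrow> obj Y i = obj X i" and d: "\<And>i. i \<le> n \<Longrightarrow> diff Y i = diff X i"
  shows "complex_on C 0 (Suc n) Y" "hequiv C n X Y"
proof -
  show Y: "complex_on C 0 (Suc n) Y"
    by (rule complexI) (use complex_diff[OF X] complex_dd[OF X] o d in auto)
  let ?f = "\<lambda>i. idt C (obj X i)"
  have "chain_map_on C 0 (Suc n) X Y ?f" "chain_map_on C 0 (Suc n) Y X ?f"
    using chain_map_id[OF X] o d by (auto simp: chain_map_on_def)
  hence f: "end_fixing_map C n X Y ?f" "end_fixing_map C n Y X ?f"
    using o by (auto simp: end_fixing_map_def)
  note I = id_Hom[OF complex_obj[OF X]]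
  have "homotopic C n X X (\<lambda>i. ?f i \<cdot> ?f i) ?f"
    using iffD2[OF homotopic_cong[OF X X, of "\<lambda>i. ?f i \<cdot> ?f i" ?f ?f ?f] homotopic_refl[OF X X, of ?f]] idl[OF I] I by blast
  moreover have "homotopic C n Y Y (\<lambda>i. ?f i \<cdot> ?f i) (\<lambda>i. idt C (obj Y i))"
    using iffD2[OF homotopic_cong[OF Y Y, of "\<lambda>i. ?f i \<cdot> ?f i" ?f "\<lambda>i. idt C (obj Y i)" ?f] homotopic_refl[OF Y Y, of ?f]]
      idl[OF I] I o by simp
  ultimately show "hequiv C n X Y" unfolding hequiv_def using f by blast
qed

end

section \<open>The dual calculus\<close>

context extension_calculus
begin

lemma D_rev_rev: assumes "\<D> X \<delta>" shows "\<D> (rev_cpx n (rev_cpx n X)) \<delta>"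
  using hequiv_cong[OF D_complex[OF assms], of "rev_cpx n (rev_cpx n X)"] D_hequiv[OF assms] by simp

text \<open>The assumptions come in dual pairs, and each is verified from its partner. This is what
  transfers results on inflations to deflations.\<close>

lemma op_calculus: "extension_calculus (opc C) (ope E) n (\<lambda>X. \<D> (rev_cpx n X))"
proof (intro extension_calculus.intro extension_category.intro extension_calculus_axioms.intro)
  show "additive_category (opc C)" by (rule opc_additive)
  show "additive_bifunctor (opc C) (ope E)" by (rule ope_bifunctor)
  show "n > 0" by (rule n_pos)
next
  fix X \<delta> assume "\<D> (rev_cpx n X) \<delta>"
  thus "con_exact (opc C) n X" by (intro con_exact_opc D_cov)
next
  fix X \<delta> assume "\<D> (rev_cpx n X) \<delta>"
  thus "cov_exact (opc C) n X" by (intro cov_exact_opc D_con)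
next
  fix X \<delta> assume "\<D> (rev_cpx n X) \<delta>"
  thus "\<delta> \<in> carrier (Ext (ope E) (obj X (Suc n)) (obj X 0))" using D_ext by fastforce
next
  fix X \<delta> assume X: "\<D> (rev_cpx n X) \<delta>"
  thus "push (ope E) (diff X 0) \<delta> = \<one>\<^bsub>Ext (ope E) (obj X (Suc n)) (obj X (Suc 0))\<^esub>"
    using D_pull[OF X] by simp
next
  fix X \<delta> assume X: "\<D> (rev_cpx n X) \<delta>"
  thus "pull (ope E) (diff X n) \<delta> = \<one>\<^bsub>Ext (ope E) (obj X n) (obj X 0)\<^esub>" using D_push[OF X] by simp
next
  fix X \<delta> g T assume X: "\<D> (rev_cpx n X) \<delta>" and "g \<in> Hom (opc C) (obj X 0) T"
    "push (ope E) g \<delta> = \<one>\<^bsub>Ext (ope E) (obj X (Suc n)) T\<^esub>"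
  thus "\<exists>k\<in>Hom (opc C) (obj X (Suc 0)) T. g = k \<bullet>\<^bsub>opc C\<^esub> diff X 0"
    using D_pull_factor[OF X, of g T] by simp
next
  fix X \<delta> g T assume X: "\<D> (rev_cpx n X) \<delta>" and "g \<in> Hom (opc C) T (obj X (Suc n))"
    "pull (ope E) g \<delta> = \<one>\<^bsub>Ext (ope E) T (obj X 0)\<^esub>"
  thus "\<exists>k\<in>Hom (opc C) T (obj X n). g = diff X n \<bullet>\<^bsub>opc C\<^esub> k"
    using D_push_factor[OF X, of g T] by simp
next
  fix X \<delta> T \<eta> assume X: "\<D> (rev_cpx n X) \<delta>" and "T \<in> Ob (opc C)"
    "\<eta> \<in> carrier (Ext (ope E) (obj X (Suc n)) T)" "pull (ope E) (diff X n) \<eta> = \<one>\<^bsub>Ext (ope E) (obj X n) T\<^esub>"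
  thus "\<exists>g\<in>Hom (opc C) (obj X 0) T. \<eta> = push (ope E) g \<delta>"
    using D_pull_onto[OF X, of T \<eta>] by simp
next
  fix X \<delta> T \<eta> assume X: "\<D> (rev_cpx n X) \<delta>" and "T \<in> Ob (opc C)"
    "\<eta> \<in> carrier (Ext (ope E) T (obj X 0))" "push (ope E) (diff X 0) \<eta> = \<one>\<^bsub>Ext (ope E) T (obj X (Suc 0))\<^esub>"
  thus "\<exists>g\<in>Hom (opc C) T (obj X (Suc n)). \<eta> = pull (ope E) g \<delta>"
    using D_push_onto[OF X, of T \<eta>] by simp
next
  fix X \<delta> T \<eta> assume X: "\<D> (rev_cpx n X) \<delta>" and "T \<in> Ob (opc C)"
    "\<eta> \<in> carrier (Ext (ope E) T (obj X (Suc 0)))"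
    "push (ope E) (diff X (Suc 0)) \<eta> = \<one>\<^bsub>Ext (ope E) T (obj X (Suc (Suc 0)))\<^esub>"
  \<comment> \<open>Degree 2 and the differential leaving degree 1 both reverse to index n - 1; the
    way back is correct only for n > 0.\<close>
  moreover have "Suc n - (n - Suc 0) = Suc (Suc 0)" "n - (n - Suc 0) = Suc 0" using n_pos by auto
  ultimately show "\<exists>\<epsilon>\<in>carrier (Ext (ope E) T (obj X 0)). \<eta> = push (ope E) (diff X 0) \<epsilon>"
    using D_pull_mid[OF X, of T \<eta>] by (simp add: numeral_2_eq_2)
next
  fix X \<delta> T \<eta> assume X: "\<D> (rev_cpx n X) \<delta>" and "T \<in> Ob (opc C)"
    "\<eta> \<in> carrier (Ext (ope E) (obj X n) T)"
    "pull (ope E) (diff X (n - Suc 0)) \<eta> = \<one>\<^bsub>Ext (ope E) (obj X (n - Suc 0)) T\<^esub>"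
  moreover have "Suc n - Suc (Suc 0) = n - Suc 0" by simp
  ultimately show "\<exists>\<epsilon>\<in>carrier (Ext (ope E) (obj X (Suc n)) T). \<eta> = pull (ope E) (diff X n) \<epsilon>"
    using D_push_mid[OF X, of T \<eta>] by simp
next
  fix K A \<delta> assume "K \<in> Ob (opc C)" "A \<in> Ob (opc C)" "\<delta> \<in> carrier (Ext (ope E) K A)"
  then obtain X where "\<D> X \<delta>" "obj X 0 = K" "obj X (Suc n) = A" using D_ex[of A K \<delta>] by auto
  thus "\<exists>X. \<D> (rev_cpx n X) \<delta> \<and> obj X 0 = A \<and> obj X (Suc n) = K"
    using D_rev_rev by (intro exI[of _ "rev_cpx n X"]) simp
next
  fix X \<delta> Y \<rho> a c assume X: "\<D> (rev_cpx n X) \<delta>" and Y: "\<D> (rev_cpx n Y) \<rho>"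
    and "a \<in> Hom (opc C) (obj X 0) (obj Y 0)" "c \<in> Hom (opc C) (obj X (Suc n)) (obj Y (Suc n))"
      "push (ope E) a \<delta> = pull (ope E) c \<rho>"
  then obtain f where f: "chain_map_on C 0 (Suc n) (rev_cpx n Y) (rev_cpx n X) f" "f 0 = c" "f (Suc n) = a"
    using D_lift[OF Y X, of c a] by auto
  show "\<exists>f. chain_map_on (opc C) 0 (Suc n) X Y f \<and> f 0 = a \<and> f (Suc n) = c"
    using chain_map_opc'[OF f(1)] f by (intro exI[of _ "\<lambda>i. f (Suc n - i)"]) simp
next
  fix X \<delta> Y assume X: "\<D> (rev_cpx n X) \<delta>" and Y: "complex_on (opc C) 0 (Suc n) Y" and "hequiv (opc C) n X Y"
  thus "\<D> (rev_cpx n Y) \<delta>"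
    using D_hequiv[OF X] hequiv_opc[OF D_complex[OF X]] by (simp add: complex_opc)
next
  fix X \<delta> Y \<rho> V \<sigma> t t'
  assume n: "n = Suc 0" and X: "\<D> (rev_cpx n X) \<delta>" and Y: "\<D> (rev_cpx n Y) \<rho>" and YX: "obj Y 0 = obj X (Suc 0)"
    and V: "\<D> (rev_cpx n V) \<sigma>" "obj V 0 = obj X 0"
    and t: "t \<in> Hom (opc C) (obj V (Suc 0)) (obj Y (Suc 0))" "diff Y 0 \<bullet>\<^bsub>opc C\<^esub> diff X 0 = t \<bullet>\<^bsub>opc C\<^esub> diff V 0"
    and t': "t' \<in> Hom (opc C) (obj Y (Suc 0)) (obj V (Suc 0))" "diff V 0 = t' \<bullet>\<^bsub>opc C\<^esub> (diff Y 0 \<bullet>\<^bsub>opc C\<^esub> diff X 0)"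
  have "\<exists>W \<omega>. \<D> W \<omega> \<and> obj W (Suc n) = obj (rev_cpx n X) (Suc n) \<and> obj W n = obj (rev_cpx n Y) n \<and>
      diff W n = diff (rev_cpx n X) n \<cdot> diff (rev_cpx n Y) n"
    by (rule D_last_cmp[OF n X Y _ V(1), of t t'])
      (use YX in \<open>simp add: Suc_diff_le; fail\<close> | use V(2) in \<open>simp; fail\<close> | use t(1) in \<open>simp add: Suc_diff_le; fail\<close>
        | use t(2) in \<open>simp; fail\<close> | use t'(1) in \<open>simp add: Suc_diff_le; fail\<close> | use t'(2) in \<open>simp; fail\<close>)+
  then obtain W \<omega> where W: "\<D> W \<omega>" "obj W (Suc n) = obj X 0" "obj W n = obj Y (Suc 0)"
      "diff W n = diff X 0 \<cdot> diff Y 0" by (auto simp: Suc_diff_le)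
  show "\<exists>W \<omega>. \<D> (rev_cpx n W) \<omega> \<and> obj W 0 = obj X 0 \<and> obj W (Suc 0) = obj Y (Suc 0) \<and>
      diff W 0 = diff Y 0 \<bullet>\<^bsub>opc C\<^esub> diff X 0"
    by (intro exI[of _ "rev_cpx n W"] exI[of _ \<omega>]) (use W D_rev_rev in simp)
next
  fix X \<delta> Y \<rho> V \<sigma> t t'
  assume n: "n = Suc 0" and X: "\<D> (rev_cpx n X) \<delta>" and Y: "\<D> (rev_cpx n Y) \<rho>" and YX: "obj Y (Suc n) = obj X n"
    and V: "\<D> (rev_cpx n V) \<sigma>" "obj V (Suc n) = obj X (Suc n)"
    and t: "t \<in> Hom (opc C) (obj Y n) (obj V n)" "diff X n \<bullet>\<^bsub>opc C\<^esub> diff Y n = diff V n \<bullet>\<^bsub>opc C\<^esub> t"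
    and t': "t' \<in> Hom (opc C) (obj V n) (obj Y n)" "diff V n = diff X n \<bullet>\<^bsub>opc C\<^esub> diff Y n \<bullet>\<^bsub>opc C\<^esub> t'"
  have "\<exists>W \<omega>. \<D> W \<omega> \<and> obj W 0 = obj (rev_cpx n X) 0 \<and> obj W (Suc 0) = obj (rev_cpx n Y) (Suc 0) \<and>
      diff W 0 = diff (rev_cpx n Y) 0 \<cdot> diff (rev_cpx n X) 0"
    by (rule D_first_cmp[OF n X Y _ V(1), of t t'])
      (use YX in \<open>simp add: Suc_diff_le; fail\<close> | use V(2) in \<open>simp; fail\<close> | use t(1) in \<open>simp add: Suc_diff_le; fail\<close>
        | use t(2) in \<open>simp; fail\<close> | use t'(1) in \<open>simp add: Suc_diff_le; fail\<close> | use t'(2) in \<open>simp; fail\<close>)+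
  then obtain W \<omega> where W: "\<D> W \<omega>" "obj W 0 = obj X (Suc n)" "obj W (Suc 0) = obj Y n"
      "diff W 0 = diff Y n \<cdot> diff X n" by auto
  show "\<exists>W \<omega>. \<D> (rev_cpx n W) \<omega> \<and> obj W (Suc n) = obj X (Suc n) \<and> obj W n = obj Y n \<and>
      diff W n = diff X n \<bullet>\<^bsub>opc C\<^esub> diff Y n"
    by (intro exI[of _ "rev_cpx n W"] exI[of _ \<omega>]) (use W D_rev_rev in \<open>simp add: Suc_diff_le\<close>)
qed

lemma last_mor_cmp:
  assumes "last_mor n {X. \<exists>\<delta>. \<D> X \<delta>} A B u" "last_mor n {X. \<exists>\<delta>. \<D> X \<delta>} B F v"
  shows "last_mor n {X. \<exists>\<delta>. \<D> X \<delta>} A F (v \<cdot> u)"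
proof -
  interpret op: extension_calculus "opc C" "ope E" n "\<lambda>X. \<D> (rev_cpx n X)" by (rule op_calculus)
  \<comment> \<open>Last morphisms are first morphisms of reversed conflations. One direction
    reverses twice and therefore uses \<open>D_rev_rev\<close>.\<close>
  have *: "last_mor n {X. \<exists>\<delta>. \<D> X \<delta>} A B u \<longleftrightarrow> first_mor {X. \<exists>\<delta>. \<D> (rev_cpx n X) \<delta>} B A u" for A B u
  proof
    assume "last_mor n {X. \<exists>\<delta>. \<D> X \<delta>} A B u"
    then obtain X \<delta> where X: "\<D> X \<delta>" "obj X n = A" "obj X (Suc n) = B" "diff X n = u" by (auto simp: last_mor_def)
    thus "first_mor {X. \<exists>\<delta>. \<D> (rev_cpx n X) \<delta>} B A u"
      using D_rev_rev[OF X(1)] by (auto simp: first_mor_def intro!: exI[of _ "rev_cpx n X"])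
  next
    assume "first_mor {X. \<exists>\<delta>. \<D> (rev_cpx n X) \<delta>} B A u"
    then obtain X \<delta> where X: "\<D> (rev_cpx n X) \<delta>" "obj X 0 = B" "obj X (Suc 0) = A" "diff X 0 = u"
      by (auto simp: first_mor_def)
    thus "last_mor n {X. \<exists>\<delta>. \<D> X \<delta>} A B u"
      by (auto simp: last_mor_def Suc_diff_le intro!: exI[of _ "rev_cpx n X"])
  qed
  show ?thesis using op.first_mor_cmp assms unfolding * by simp
qed

lemma weak_iso_last:
  assumes Y: "cov_exact C n Y" and X: "\<D> X \<delta>" and f: "chain_map_on C 0 (Suc n) X Y f"
    and iso: "is_iso C (obj X (Suc n)) (obj Y (Suc n)) (f (Suc n))"
  shows "\<exists>\<rho>. \<D> Y \<rho>"
proof -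
  interpret op: extension_calculus "opc C" "ope E" n "\<lambda>X. \<D> (rev_cpx n X)" by (rule op_calculus)
  note cY = cov_exact_complex[OF Y]
  have rY: "complex_on C 0 (Suc n) (rev_cpx n (rev_cpx n Y))" "hequiv C n Y (rev_cpx n (rev_cpx n Y))"
    by (rule hequiv_cong[OF cY]; simp)+
  have "cov_exact C n (rev_cpx n (rev_cpx n Y))"
    using Y rY(1) n_pos by (auto simp: cov_exact_def)
  hence Y': "con_exact (opc C) n (rev_cpx n Y)" by (rule con_exact_opc)
  have "chain_map_on C 0 (Suc n) (rev_cpx n (rev_cpx n X)) (rev_cpx n (rev_cpx n Y)) f"
    using f by (auto simp: chain_map_on_def)
  \<comment> \<open>In the opposite category f runs from Y to X, so the realized complex is the
    target, as \<open>weak_iso_first\<close> requires.\<close>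
  hence f': "chain_map_on (opc C) 0 (Suc n) (rev_cpx n Y) (rev_cpx n X) (\<lambda>i. f (Suc n - i))"
    by (rule chain_map_opc')
  have "\<exists>\<rho>. \<D> (rev_cpx n (rev_cpx n Y)) \<rho>"
    by (rule op.weak_iso_first[OF Y' D_rev_rev[OF X] f']) (use iso in \<open>auto simp: is_iso_def\<close>)
  thus ?thesis using D_hequiv[OF _ cY hequiv_sym[OF rY(2)]] by blast
qed

end

section \<open>Conflations in an \<open>n\<close>-exangulated category\<close>

lemma (in extension_category) push_neg_one:
  assumes "a \<in> H A A'" "K \<in> Ob C" "\<delta> \<in> \<E> K A" "push E a \<delta> = \<o>\<^bsub>K,A'\<^esub>"
  shows "push E (negm C A A' a) \<delta> = \<o>\<^bsub>K,A'\<^esub>"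
proof -
  note o = Hom_dom[OF assms(1)] Hom_cod[OF assms(1)]
  show ?thesis unfolding neg_eq_sub[OF assms(1)]
    using push_sub_one[OF zero_Hom[OF o] assms(1-3)] push_zero[OF o assms(2,3)] assms(4) by simp
qed

lemma (in extension_category) ext_dsum_eq_one:
  assumes "A \<in> Ob C" "B \<in> Ob C" "K \<in> Ob C" "\<eta> \<in> \<E> K (dsum C A B)"
    and "push E (p1 A B) \<eta> = \<o>\<^bsub>K,A\<^esub>" "push E (p2 A B) \<eta> = \<o>\<^bsub>K,B\<^esub>"
  shows "\<eta> = \<o>\<^bsub>K,dsum C A B\<^esub>"
proof -
  note S = dsum_Ob[OF assms(1,2)] and B = bip_Hom[OF assms(1,2)]
  have "\<eta> = push E (i1 A B \<cdot> p1 A B) \<eta> \<otimes>\<^bsub>Ext E K (dsum C A B)\<^esub> push E (i2 A B \<cdot> p2 A B) \<eta>"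
    using push_plus[OF cmp_Hom[OF B(3,1)] cmp_Hom[OF B(4,2)] assms(3,4)] bip_eq(5)[OF assms(1,2)]
      push_id[OF assms(3) S assms(4)] by simp
  thus ?thesis
    using push_push[OF B(3,1) assms(3,4)] push_push[OF B(4,2) assms(3,4)] assms(5,6)
      push_one[OF B(1) assms(3)] push_one[OF B(2) assms(3)] ext_mult_one[OF assms(3) S ext_zero_mem[OF assms(3) S]] by simp
qed

lemma (in extension_category) ext_dsum_eq_one':
  assumes "K \<in> Ob C" "L \<in> Ob C" "A \<in> Ob C" "\<eta> \<in> \<E> (dsum C K L) A"
    and "pull E (i1 K L) \<eta> = \<o>\<^bsub>K,A\<^esub>" "pull E (i2 K L) \<eta> = \<o>\<^bsub>L,A\<^esub>"
  shows "\<eta> = \<o>\<^bsub>dsum C K L,A\<^esub>"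
proof -
  note S = dsum_Ob[OF assms(1,2)] and B = bip_Hom[OF assms(1,2)]
  have "\<eta> = pull E (i1 K L \<cdot> p1 K L) \<eta> \<otimes>\<^bsub>Ext E (dsum C K L) A\<^esub> pull E (i2 K L \<cdot> p2 K L) \<eta>"
    using pull_plus[OF cmp_Hom[OF B(3,1)] cmp_Hom[OF B(4,2)] assms(3,4)] bip_eq(5)[OF assms(1,2)]
      pull_id[OF S assms(3,4)] by simp
  thus ?thesis
    using pull_pull[OF B(1,3) assms(3,4)] pull_pull[OF B(2,4) assms(3,4)] assms(5,6)
      pull_one[OF B(3) assms(3)] pull_one[OF B(4) assms(3)] ext_mult_one[OF S assms(3) ext_zero_mem[OF S assms(3)]] by simp
qed

context n_exangulated_category
begin

sublocale extension_category C E
  by (intro_locales)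

abbreviation dist :: "('o, 'm) cpx \<Rightarrow> 'e \<Rightarrow> bool" where
  "dist \<equiv> distinguished C E n s"

lemma dist_complex: "dist X \<delta> \<Longrightarrow> complex_on C 0 (Suc n) X"
  and dist_ext: "dist X \<delta> \<Longrightarrow> \<delta> \<in> \<E> (obj X (Suc n)) (obj X 0)"
  by (simp_all add: distinguished_def)

lemma dist_obj: "\<lbrakk>dist X \<delta>; i \<le> Suc n\<rbrakk> \<Longrightarrow> obj X i \<in> Ob C"
  by (rule complex_obj[OF dist_complex])

lemma dist_diff: "\<lbrakk>dist X \<delta>; i \<le> n\<rbrakk> \<Longrightarrow> diff X i \<in> H (obj X i) (obj X (Suc i))"
  by (rule complex_diff[OF dist_complex])

lemma dist_cov:
  assumes X: "dist X \<delta>" and i: "i < n" and g: "g \<in> H T (obj X (Suc i))"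
    and gd: "diff X (Suc i) \<cdot> g = \<zero>\<^bsub>T,obj X (Suc (Suc i))\<^esub>"
  shows "\<exists>k\<in>H T (obj X i). g = diff X i \<cdot> k"
proof -
  have T: "T \<in> Ob C" using g Hom_dom by blast
  have "cov_exact_at C X T i" using R1[OF X] T i by (simp add: n_exangle_def)
  hence "g \<in> (\<lambda>f. diff X i \<cdot> f) ` arr C T (obj X i)"
    using g gd Hom_arr unfolding cov_exact_at_def by (simp add: kernel_def Hom_arr)
  thus ?thesis using T dist_obj[OF X, of i] i by (auto intro: HomI)
qed

lemma dist_con:
  assumes X: "dist X \<delta>" and i: "i < n" and g: "g \<in> H (obj X (Suc i)) T"
    and gd: "g \<cdot> diff X i = \<zero>\<^bsub>obj X i,T\<^esub>"
  shows "\<exists>k\<in>H (obj X (Suc (Suc i))) T. g = k \<cdot> diff X (Suc i)"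
proof -
  have T: "T \<in> Ob C" using g Hom_cod by blast
  have "con_exact_at C X T i" using R1[OF X] T i by (simp add: n_exangle_def)
  hence "g \<in> (\<lambda>f. f \<cdot> diff X (Suc i)) ` arr C (obj X (Suc (Suc i))) T"
    using g gd Hom_arr unfolding con_exact_at_def by (simp add: kernel_def Hom_arr)
  thus ?thesis using T dist_obj[OF X, of "Suc (Suc i)"] i by (auto intro: HomI)
qed

lemma dist_push_iff:
  assumes X: "dist X \<delta>" and g: "g \<in> H (obj X 0) T"
  shows "push E g \<delta> = \<o>\<^bsub>obj X (Suc n),T\<^esub> \<longleftrightarrow> (\<exists>k\<in>H (obj X (Suc 0)) T. g = k \<cdot> diff X 0)"
proof -
  have T: "T \<in> Ob C" using g Hom_cod by blast
  have "(\<lambda>g. g \<cdot> diff X 0) ` arr C (obj X 1) T =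
      kernel (Mor C (obj X 0) T) (Ext E (obj X (Suc n)) T) (\<lambda>g. push E g \<delta>)"
    using R1[OF X] T by (simp add: n_exangle_def)
  hence "push E g \<delta> = \<o>\<^bsub>obj X (Suc n),T\<^esub> \<longleftrightarrow> g \<in> (\<lambda>g. g \<cdot> diff X 0) ` arr C (obj X 1) T"
    using Hom_arr[OF g] by (simp add: kernel_def)
  thus ?thesis using T dist_obj[OF X, of "Suc 0"] by (auto simp: Hom_iff)
qed

lemma dist_pull_iff:
  assumes X: "dist X \<delta>" and g: "g \<in> H T (obj X (Suc n))"
  shows "pull E g \<delta> = \<o>\<^bsub>T,obj X 0\<^esub> \<longleftrightarrow> (\<exists>k\<in>H T (obj X n). g = diff X n \<cdot> k)"
proof -
  have T: "T \<in> Ob C" using g Hom_dom by blast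
  have "(\<lambda>g. diff X n \<cdot> g) ` arr C T (obj X n) =
      kernel (Mor C T (obj X (Suc n))) (Ext E T (obj X 0)) (\<lambda>g. pull E g \<delta>)"
    using R1[OF X] T by (simp add: n_exangle_def)
  hence "pull E g \<delta> = \<o>\<^bsub>T,obj X 0\<^esub> \<longleftrightarrow> g \<in> (\<lambda>g. diff X n \<cdot> g) ` arr C T (obj X n)"
    using Hom_arr[OF g] by (simp add: kernel_def)
  thus ?thesis using T dist_obj[OF X, of n] by (auto simp: Hom_iff)
qed

section \<open>Exact sequences of extension groups\<close>

lemma dist_push: assumes X: "dist X \<delta>" shows "push E (diff X 0) \<delta> = \<o>\<^bsub>obj X (Suc n),obj X (Suc 0)\<^esub>"
  using dist_push_iff[OF X dist_diff[OF X]] idl[OF dist_diff[OF X, of 0]] id_Hom[OF dist_obj[OF X, of "Suc 0"]]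
  by (metis Suc_le_mono le0)

lemma dist_pull: assumes X: "dist X \<delta>" shows "pull E (diff X n) \<delta> = \<o>\<^bsub>obj X n,obj X 0\<^esub>"
  using dist_pull_iff[OF X dist_diff[OF X]] idr[OF dist_diff[OF X, of n]] id_Hom[OF dist_obj[OF X, of n]]
  by (metis le_SucI order_refl)

text \<open>Exactness at E(X_{n+1}, T), which is not among the conditions on an n-exangle. Let
  \<sigma> = (\<delta>, \<eta>) be realized by W. By (EA2op) along the projection p1, a mapping
  cocone realizes the pullback of \<sigma> along \<open>diff X n\<close>, which is zero. So its
  first morphism splits, that is, 1 = b p1 - a \<open>diff W 0\<close> for some a and b; as
  \<open>diff W 0\<close> kills \<sigma>, the latter is the pushforward of \<delta> along b.\<close>

lemma dist_push_onto:
  assumes n: "n > 0" and X: "dist X \<delta>" and T: "T \<in> Ob C" and \<eta>: "\<eta> \<in> \<E> (obj X (Suc n)) T"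
    and d\<eta>: "pull E (diff X n) \<eta> = \<o>\<^bsub>obj X n,T\<^esub>"
  shows "\<exists>g\<in>H (obj X 0) T. \<eta> = push E g \<delta>"
proof -
  define A K where o_def: "A = obj X 0" "K = obj X (Suc n)"
  have o: "A \<in> Ob C" "K \<in> Ob C" "obj X n \<in> Ob C" using dist_obj[OF X] by (auto simp: o_def)
  have \<delta>: "\<delta> \<in> \<E> K A" using dist_ext[OF X] by (simp add: o_def)
  note \<eta> = \<eta>[folded o_def]
  have d: "diff X n \<in> H (obj X n) K" using dist_diff[OF X, of n] by (simp add: o_def)
  note S = dsum_Ob[OF o(1) T] and B = bip_Hom[OF o(1) T]
  obtain \<sigma> where \<sigma>: "\<sigma> \<in> \<E> K (dsum C A T)" "push E (p1 A T) \<sigma> = \<delta>" "push E (p2 A T) \<sigma> = \<eta>"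
    and d\<sigma>: "pull E (diff X n) \<sigma> = \<o>\<^bsub>obj X n,dsum C A T\<^esub>"
    using push_dsum[OF o(1) T o(2) \<delta> \<eta>] d d\<eta> dist_pull[OF X] unfolding o_def by metis
  obtain W where W: "dist W \<sigma>" "obj W 0 = dsum C A T" "obj W (Suc n) = K"
    using is_class[OF o(2) S \<sigma>(1)] by blast
  obtain f where f: "f 0 = p1 A T" and N: "dist (mapping_cocone C n W X f) \<o>\<^bsub>obj X n,dsum C A T\<^esub>"
    using EA2_op[OF W(1), of "p1 A T" X] W \<sigma>(2) B(3) X d\<sigma> by (auto simp: o_def Hom_arr)
  have dW: "diff W 0 \<in> H (dsum C A T) (obj W (Suc 0))" using dist_diff[OF W(1), of 0] W by simp
  have oW: "obj W (Suc 0) \<in> Ob C" using dW Hom_cod by blast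
  let ?d = "negm C (dsum C A T) (obj W (Suc 0)) (diff W 0)"
  note nd = neg_Hom[OF dW] and I = id_Hom[OF S]
  have N0: "obj (mapping_cocone C n W X f) 0 = dsum C A T" "obj (mapping_cocone C n W X f) (Suc 0) = dsum C (obj W (Suc 0)) A"
    "diff (mapping_cocone C n W X f) 0 = colm C (dsum C A T) (obj W (Suc 0)) A ?d (p1 A T)"
    "obj (mapping_cocone C n W X f) (Suc n) = obj X n"
    using n W f by (auto simp: mapping_cocone_def o_def)
  obtain k where k: "k \<in> H (dsum C (obj W (Suc 0)) A) (dsum C A T)"
    "idt C (dsum C A T) = k \<cdot> colm C (dsum C A T) (obj W (Suc 0)) A ?d (p1 A T)"
    using dist_push_iff[OF N, of "idt C (dsum C A T)" "dsum C A T"] push_one[OF I o(3)] I unfolding N0 by blast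
  obtain a b where a: "a \<in> H (obj W (Suc 0)) (dsum C A T)" and b: "b \<in> H A (dsum C A T)"
    and kab: "k = rowm C (obj W (Suc 0)) A (dsum C A T) a b" using rowm_obtain[OF oW o(1) k(1)] .
  have id: "idt C (dsum C A T) = a \<cdot> ?d \<boxplus>\<^bsub>dsum C A T,dsum C A T\<^esub> b \<cdot> p1 A T"
    using k(2) rowm_colm[OF a b nd B(3)] by (simp add: kab)
  have "push E ?d \<sigma> = \<o>\<^bsub>K,obj W (Suc 0)\<^esub>"
    by (rule push_neg_one[OF dW o(2) \<sigma>(1)]) (use dist_push[OF W(1)] W in simp)
  hence "push E (a \<cdot> ?d) \<sigma> = \<o>\<^bsub>K,dsum C A T\<^esub>"
    using push_push[OF nd a o(2) \<sigma>(1)] push_one[OF a o(2)] by simp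
  hence "\<sigma> = push E b \<delta>"
    using push_plus[OF cmp_Hom[OF nd a] cmp_Hom[OF B(3) b] o(2) \<sigma>(1)] id push_id[OF o(2) S \<sigma>(1)]
      push_push[OF B(3) b o(2) \<sigma>(1)] \<sigma>(2) ext_mult_one(2)[OF o(2) S push_mem[OF b o(2) \<delta>]] by simp
  hence "\<eta> = push E (p2 A T \<cdot> b) \<delta>" using \<sigma>(3) push_push[OF b B(4) o(2) \<delta>] by simp
  thus ?thesis using cmp_Hom[OF b B(4)] by (auto simp: o_def)
qed

text \<open>Mirror image of \<open>dist_push_onto\<close>: (EA2) is applied along an injection into
  a direct sum, and a section of the last morphism of the cone replaces the retraction.\<close>

lemma dist_pull_onto:
  assumes n: "n > 0" and X: "dist X \<delta>" and T: "T \<in> Ob C" and \<eta>: "\<eta> \<in> \<E> T (obj X 0)"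
    and d\<eta>: "push E (diff X 0) \<eta> = \<o>\<^bsub>T,obj X (Suc 0)\<^esub>"
  shows "\<exists>g\<in>H T (obj X (Suc n)). \<eta> = pull E g \<delta>"
proof -
  define A K where o_def: "A = obj X 0" "K = obj X (Suc n)"
  have o: "A \<in> Ob C" "K \<in> Ob C" "obj X (Suc 0) \<in> Ob C" using dist_obj[OF X] by (auto simp: o_def)
  have \<delta>: "\<delta> \<in> \<E> K A" using dist_ext[OF X] by (simp add: o_def)
  note \<eta> = \<eta>[folded o_def]
  have d: "diff X 0 \<in> H A (obj X (Suc 0))" using dist_diff[OF X, of 0] by (simp add: o_def)
  note S = dsum_Ob[OF o(2) T] and B = bip_Hom[OF o(2) T]
  obtain \<sigma> where \<sigma>: "\<sigma> \<in> \<E> (dsum C K T) A" "pull E (i1 K T) \<sigma> = \<delta>" "pull E (i2 K T) \<sigma> = \<eta>"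
    and d\<sigma>: "push E (diff X 0) \<sigma> = \<o>\<^bsub>dsum C K T,obj X (Suc 0)\<^esub>"
    using pull_dsum[OF o(2) T o(1) \<delta> \<eta>] d d\<eta> dist_push[OF X] unfolding o_def by metis
  obtain W where W: "dist W \<sigma>" "obj W 0 = A" "obj W (Suc n) = dsum C K T"
    using is_class[OF S o(1) \<sigma>(1)] by blast
  obtain f where f: "f (Suc n) = i1 K T" and M: "dist (mapping_cone C n X W f) \<o>\<^bsub>dsum C K T,obj X (Suc 0)\<^esub>"
    using EA2[OF W(1), of "i1 K T" X] W \<sigma>(2) B(1) X d\<sigma> by (auto simp: o_def Hom_arr)
  have dW: "diff W n \<in> H (obj W n) (dsum C K T)" using dist_diff[OF W(1), of n] W by simp
  have oW: "obj W n \<in> Ob C" using dW Hom_dom by blast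
  note I = id_Hom[OF S]
  have M0: "obj (mapping_cone C n X W f) (Suc n) = dsum C K T" "obj (mapping_cone C n X W f) n = dsum C K (obj W n)"
    "diff (mapping_cone C n X W f) n = rowm C K (obj W n) (dsum C K T) (i1 K T) (diff W n)"
    "obj (mapping_cone C n X W f) 0 = obj X (Suc 0)"
    using n W f by (auto simp: mapping_cone_def o_def)
  obtain k where k: "k \<in> H (dsum C K T) (dsum C K (obj W n))"
    "idt C (dsum C K T) = rowm C K (obj W n) (dsum C K T) (i1 K T) (diff W n) \<cdot> k"
    using dist_pull_iff[OF M, of "idt C (dsum C K T)" "dsum C K T"] pull_one[OF I o(3)] I unfolding M0 by blast
  obtain a b where a: "a \<in> H (dsum C K T) K" and b: "b \<in> H (dsum C K T) (obj W n)"
    and kab: "k = colm C (dsum C K T) K (obj W n) a b" using colm_obtain[OF o(2) oW k(1)] .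
  have id: "idt C (dsum C K T) = i1 K T \<cdot> a \<boxplus>\<^bsub>dsum C K T,dsum C K T\<^esub> diff W n \<cdot> b"
    using k(2) rowm_colm[OF B(1) dW a b] by (simp add: kab)
  have "pull E (diff W n) \<sigma> = \<o>\<^bsub>obj W n,A\<^esub>" using dist_pull[OF W(1)] W by simp
  hence "pull E (diff W n \<cdot> b) \<sigma> = \<o>\<^bsub>dsum C K T,A\<^esub>"
    using pull_pull[OF dW b o(1) \<sigma>(1)] pull_one[OF b o(1)] by simp
  hence "\<sigma> = pull E a \<delta>"
    using pull_plus[OF cmp_Hom[OF a B(1)] cmp_Hom[OF b dW] o(1) \<sigma>(1)] id pull_id[OF S o(1) \<sigma>(1)]
      pull_pull[OF B(1) a o(1) \<sigma>(1)] \<sigma>(2) ext_mult_one(1)[OF S o(1) pull_mem[OF a o(1) \<delta>]] by simp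
  hence "\<eta> = pull E (a \<cdot> i2 K T) \<delta>" using \<sigma>(3) pull_pull[OF a B(2) o(1) \<delta>] by simp
  thus ?thesis using cmp_Hom[OF B(2) a] by (auto simp: o_def)
qed

text \<open>Exactness at E(T, X_1), where (EA1) enters. Let v be the first morphism of a realization
  of \<eta>, let u = \<open>diff X 0\<close>, and let \<omega> belong to the inflation v u. Since v
  u kills \<delta>, the latter is a pullback of \<omega>, and the cone of the comparison realizes
  the pushforward of \<omega> along u. The first morphism of this cone kills \<eta>, so \<eta> is a
  pullback of that pushforward and hence itself a pushforward along u.\<close>

lemma dist_push_mid:
  assumes n: "n > 0" and X: "dist X \<delta>" and T: "T \<in> Ob C" and \<eta>: "\<eta> \<in> \<E> T (obj X (Suc 0))"
    and d\<eta>: "push E (diff X (Suc 0)) \<eta> = \<o>\<^bsub>T,obj X (Suc (Suc 0))\<^esub>"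
  shows "\<exists>\<epsilon>\<in>\<E> T (obj X 0). \<eta> = push E (diff X 0) \<epsilon>"
proof -
  define A B F where o_def: "A = obj X 0" "B = obj X (Suc 0)" "F = obj X (Suc (Suc 0))"
  define u d where d_def: "u = diff X 0" "d = diff X (Suc 0)"
  have u: "u \<in> H A B" and d: "d \<in> H B F" using dist_diff[OF X, of 0] dist_diff[OF X, of "Suc 0"] n by (auto simp: o_def d_def)
  have o: "A \<in> Ob C" "B \<in> Ob C" "F \<in> Ob C" using u d Hom_dom Hom_cod by blast+
  note \<eta> = \<eta>[folded o_def] and d\<eta> = d\<eta>[folded o_def d_def]
  define K where "K = obj X (Suc n)"
  have oK: "K \<in> Ob C" and \<delta>: "\<delta> \<in> \<E> K A" and u\<delta>: "push E u \<delta> = \<o>\<^bsub>K,B\<^esub>"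
    using dist_obj[OF X] dist_ext[OF X] dist_push[OF X] by (auto simp: o_def d_def K_def)
  obtain Y where Y: "dist Y \<eta>" "obj Y 0 = B" "obj Y (Suc n) = T" using is_class[OF T o(2) \<eta>] by blast
  define v D where v_def: "v = diff Y 0" "D = obj Y (Suc 0)"
  have v: "v \<in> H B D" using dist_diff[OF Y(1), of 0] Y by (simp add: v_def)
  have oD: "D \<in> Ob C" using v Hom_cod by blast
  have "inflation C E n s A B u" "inflation C E n s B D v"
    using X Y by (auto simp: first_mor_def conflations_def o_def d_def v_def)
  from EA1_inflation[OF this] obtain W \<omega> where W: "dist W \<omega>" "obj W 0 = A" "obj W (Suc 0) = D" "diff W 0 = v \<cdot> u"
    by (auto simp: first_mor_def conflations_def)
  have "push E (v \<cdot> u) \<delta> = \<o>\<^bsub>K,D\<^esub>" using push_push[OF u v oK \<delta>] u\<delta> push_one[OF v oK] by simp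
  then obtain c where c: "c \<in> H K (obj W (Suc n))" "\<delta> = pull E c \<omega>"
    using dist_pull_onto[OF n W(1) oK, of \<delta>] \<delta> W by auto
  obtain f where f: "chain_map_on C 0 (Suc n) X W f" "f 0 = idt C A" and M: "dist (mapping_cone C n X W f) (push E u \<omega>)"
    using EA2[OF W(1), of c X] W c X by (auto simp: o_def d_def K_def Hom_arr)
  have f1: "f (Suc 0) \<in> H B D" using chain_map_Hom[OF f(1) dist_complex[OF X] dist_complex[OF W(1)], of "Suc 0"] W
    by (simp add: o_def)
  have f1u: "f (Suc 0) \<cdot> u = v \<cdot> u"
    using chain_map_comm[OF f(1), of 0] f(2) W(4) idr[OF cmp_Hom[OF u v]] by (simp add: d_def)
  \<comment> \<open>(EA2) does not allow prescribing \<open>f (Suc 0)\<close> to be v. The two agree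
    on u, hence differ by a multiple of d, and d kills \<eta>.\<close>
  have "(f (Suc 0) \<boxminus>\<^bsub>B,D\<^esub> v) \<cdot> u = \<zero>\<^bsub>A,D\<^esub>"
    using sub_distl[OF u f1 v] f1u sub_self[OF cmp_Hom[OF u v]] by simp
  then obtain j where j: "j \<in> H F D" "f (Suc 0) \<boxminus>\<^bsub>B,D\<^esub> v = j \<cdot> d"
    using dist_con[OF X n, of "f (Suc 0) \<boxminus>\<^bsub>B,D\<^esub> v" D] sub_Hom[OF f1 v] by (auto simp: o_def d_def)
  have "f (Suc 0) = v \<boxplus>\<^bsub>B,D\<^esub> j \<cdot> d" using eq_add_iff[OF f1 v cmp_Hom[OF d j(1)]] j(2) by simp
  hence f1\<eta>: "push E (f (Suc 0)) \<eta> = \<o>\<^bsub>T,D\<^esub>"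
    using push_plus[OF v cmp_Hom[OF d j(1)] T \<eta>] push_push[OF d j(1) T \<eta>] d\<eta> push_one[OF j(1) T]
      dist_push[OF Y(1)] Y ext_mult_one[OF T oD ext_zero_mem[OF T oD]] by (simp add: v_def)
  have nd: "negm C B F d \<in> H B F" by (rule neg_Hom[OF d])
  define m where "m = colm C B F D (negm C B F d) (f (Suc 0))"
  have m: "m \<in> H B (dsum C F D)" unfolding m_def by (rule colm_Hom[OF nd f1])
  note P = bip_Hom[OF o(3) oD]
  have "push E m \<eta> = \<o>\<^bsub>T,dsum C F D\<^esub>"
    by (rule ext_dsum_eq_one[OF o(3) oD T push_mem[OF m T \<eta>]])
      (use push_push[OF m P(3) T \<eta>] push_push[OF m P(4) T \<eta>] pr_colm[OF nd f1] push_neg_one[OF d T \<eta> d\<eta>] f1\<eta>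
        in \<open>simp_all add: m_def\<close>)
  moreover have M0: "obj (mapping_cone C n X W f) 0 = B" "obj (mapping_cone C n X W f) (Suc 0) = dsum C F D"
    "diff (mapping_cone C n X W f) 0 = m" "obj (mapping_cone C n X W f) (Suc n) = obj W (Suc n)"
    using n W by (auto simp: mapping_cone_def o_def d_def m_def numeral_2_eq_2)
  ultimately obtain c' where c': "c' \<in> H T (obj W (Suc n))" "\<eta> = pull E c' (push E u \<omega>)"
    using dist_pull_onto[OF n M T, of \<eta>] \<eta> by auto
  have \<omega>: "\<omega> \<in> \<E> (obj W (Suc n)) A" using dist_ext[OF W(1)] W by simp
  have "\<eta> = push E u (pull E c' \<omega>)" using c'(2) push_pull_swap[OF u c'(1) \<omega>] by simp
  thus ?thesis using pull_mem[OF c'(1) o(1) \<omega>] by (auto simp: o_def d_def)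
qed

text \<open>Mirror image of \<open>dist_push_mid\<close>, with (EA1) for deflations and a mapping
  cocone.\<close>

lemma dist_pull_mid:
  assumes n: "n > 0" and X: "dist X \<delta>" and T: "T \<in> Ob C" and \<eta>: "\<eta> \<in> \<E> (obj X n) T"
    and d\<eta>: "pull E (diff X (n - Suc 0)) \<eta> = \<o>\<^bsub>obj X (n - Suc 0),T\<^esub>"
  shows "\<exists>\<epsilon>\<in>\<E> (obj X (Suc n)) T. \<eta> = pull E (diff X n) \<epsilon>"
proof -
  obtain m where m: "n = Suc m" using n by (cases n) auto
  define A B F where o_def: "A = obj X (Suc n)" "B = obj X n" "F = obj X m"
  define u d where d_def: "u = diff X n" "d = diff X m"
  have u: "u \<in> H B A" and d: "d \<in> H F B" using dist_diff[OF X, of n] dist_diff[OF X, of m] m by (auto simp: o_def d_def)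
  have o: "A \<in> Ob C" "B \<in> Ob C" "F \<in> Ob C" using u d Hom_dom Hom_cod by blast+
  have \<eta>: "\<eta> \<in> \<E> B T" and d\<eta>: "pull E d \<eta> = \<o>\<^bsub>F,T\<^esub>" using \<eta> d\<eta> m by (auto simp: o_def d_def)
  define K where "K = obj X 0"
  have oK: "K \<in> Ob C" and \<delta>: "\<delta> \<in> \<E> A K" and u\<delta>: "pull E u \<delta> = \<o>\<^bsub>B,K\<^esub>"
    using dist_obj[OF X] dist_ext[OF X] dist_pull[OF X] by (auto simp: o_def d_def K_def)
  obtain Y where Y: "dist Y \<eta>" "obj Y 0 = T" "obj Y (Suc n) = B" using is_class[OF o(2) T \<eta>] by blast
  define v D where v_def: "v = diff Y n" "D = obj Y n"
  have v: "v \<in> H D B" using dist_diff[OF Y(1), of n] Y by (simp add: v_def)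
  have oD: "D \<in> Ob C" using v Hom_dom by blast
  have "deflation C E n s D B v" "deflation C E n s B A u"
    using X Y by (auto simp: last_mor_def conflations_def o_def d_def v_def)
  from EA1_deflation[OF this] obtain W \<omega> where W: "dist W \<omega>" "obj W (Suc n) = A" "obj W n = D" "diff W n = u \<cdot> v"
    by (auto simp: last_mor_def conflations_def)
  have "pull E (u \<cdot> v) \<delta> = \<o>\<^bsub>D,K\<^esub>" using pull_pull[OF u v oK \<delta>] u\<delta> pull_one[OF v oK] by simp
  then obtain c where c: "c \<in> H (obj W 0) K" "\<delta> = push E c \<omega>"
    using dist_push_onto[OF n W(1) oK, of \<delta>] \<delta> W by auto
  obtain f where f: "chain_map_on C 0 (Suc n) W X f" "f (Suc n) = idt C A"
    and N: "dist (mapping_cocone C n W X f) (pull E u \<omega>)"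
    using EA2_op[OF W(1), of c X] W c X by (auto simp: o_def d_def K_def Hom_arr)
  have f1: "f n \<in> H D B" using chain_map_Hom[OF f(1) dist_complex[OF W(1)] dist_complex[OF X], of n] W
    by (simp add: o_def)
  have uf1: "u \<cdot> f n = u \<cdot> v"
    using chain_map_comm[OF f(1), of n] f(2) W(4) idl[OF cmp_Hom[OF v u]] by (simp add: d_def)
  have "u \<cdot> (f n \<boxminus>\<^bsub>D,B\<^esub> v) = \<zero>\<^bsub>D,A\<^esub>"
    using sub_distr[OF f1 v u] uf1 sub_self[OF cmp_Hom[OF v u]] by simp
  then obtain j where j: "j \<in> H D F" "f n \<boxminus>\<^bsub>D,B\<^esub> v = d \<cdot> j"
    using dist_cov[OF X, of m "f n \<boxminus>\<^bsub>D,B\<^esub> v" D] sub_Hom[OF f1 v] m by (auto simp: o_def d_def)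
  have "f n = v \<boxplus>\<^bsub>D,B\<^esub> d \<cdot> j" using eq_add_iff[OF f1 v cmp_Hom[OF j(1) d]] j(2) by simp
  hence f1\<eta>: "pull E (f n) \<eta> = \<o>\<^bsub>D,T\<^esub>"
    using pull_plus[OF v cmp_Hom[OF j(1) d] T \<eta>] pull_pull[OF d j(1) T \<eta>] d\<eta> pull_one[OF j(1) T]
      dist_pull[OF Y(1)] Y ext_mult_one[OF oD T ext_zero_mem[OF oD T]] by (simp add: v_def)
  define r where "r = rowm C D F B (f n) d"
  have r: "r \<in> H (dsum C D F) B" unfolding r_def by (rule rowm_Hom[OF f1 d])
  note P = bip_Hom[OF oD o(3)]
  have "pull E r \<eta> = \<o>\<^bsub>dsum C D F,T\<^esub>"
    by (rule ext_dsum_eq_one'[OF oD o(3) T pull_mem[OF r T \<eta>]])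
      (use pull_pull[OF r P(1) T \<eta>] pull_pull[OF r P(2) T \<eta>] rowm_in[OF f1 d] d\<eta> f1\<eta> in \<open>simp_all add: r_def\<close>)
  moreover have N0: "obj (mapping_cocone C n W X f) (Suc n) = B" "obj (mapping_cocone C n W X f) n = dsum C D F"
    "diff (mapping_cocone C n W X f) n = r" "obj (mapping_cocone C n W X f) 0 = obj W 0"
    using m W by (auto simp: mapping_cocone_def o_def d_def r_def)
  ultimately obtain c' where c': "c' \<in> H (obj W 0) T" "\<eta> = push E c' (pull E u \<omega>)"
    using dist_push_onto[OF n N T, of \<eta>] \<eta> by auto
  have \<omega>: "\<omega> \<in> \<E> A (obj W 0)" using dist_ext[OF W(1)] W by simp
  have "\<eta> = pull E u (push E c' \<omega>)" using c'(2) push_pull_swap[OF c'(1) u \<omega>] by simp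
  thus ?thesis using push_mem[OF c'(1) o(1) \<omega>] by (auto simp: o_def d_def)
qed

section \<open>Projectives, injectives and the ends of conflations\<close>

lemma projective_ext: assumes "P \<in> projectives C E n s" "A \<in> Ob C" "\<eta> \<in> \<E> P A" shows "\<eta> = \<o>\<^bsub>P,A\<^esub>"
proof -
  have P: "P \<in> Ob C" using assms(1) by (simp add: projectives_def)
  obtain Y where Y: "dist Y \<eta>" "obj Y 0 = A" "obj Y (Suc n) = P" using is_class[OF P assms(2,3)] by blast
  \<comment> \<open>The identity of P lifts through the deflation of a realization of \<eta>, so the
    pullback of \<eta> along it, which is \<eta>, vanishes.\<close>
  obtain b where b: "b \<in> H P (obj Y n)" "idt C P = diff Y n \<cdot> b"
    using assms(1) Y id_arr[OF P] HomI[OF P dist_obj[OF Y(1), of n]] unfolding projectives_def by fastforce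
  hence "pull E (idt C P) \<eta> = \<o>\<^bsub>P,A\<^esub>"
    using dist_pull_iff[OF Y(1), of "idt C P" P] Y id_Hom[OF P] by blast
  thus ?thesis using pull_id[OF P assms(2,3)] by simp
qed

lemma injective_ext: assumes "J \<in> injectives C E n s" "K \<in> Ob C" "\<eta> \<in> \<E> K J" shows "\<eta> = \<o>\<^bsub>K,J\<^esub>"
proof -
  have J: "J \<in> Ob C" using assms(1) by (simp add: injectives_def)
  obtain Y where Y: "dist Y \<eta>" "obj Y 0 = J" "obj Y (Suc n) = K" using is_class[OF assms(2) J assms(3)] by blast
  obtain b where b: "b \<in> H (obj Y (Suc 0)) J" "idt C J = b \<cdot> diff Y 0"
    using assms(1) Y id_arr[OF J] HomI[OF dist_obj[OF Y(1), of "Suc 0"] J] unfolding injectives_def by fastforce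
  hence "push E (idt C J) \<eta> = \<o>\<^bsub>K,J\<^esub>"
    using dist_push_iff[OF Y(1), of "idt C J" J] Y id_Hom[OF J] by blast
  thus ?thesis using push_id[OF assms(2) J assms(3)] by simp
qed

text \<open>Since \<open>\<E>(P\<^sub>n, X\<^sub>0) = 0\<close>, the extension of \<open>X\<close> is a pushout of the one of \<open>P\<close>;
  the resulting mapping cocone continues \<open>X\<close> to the left by \<open>P\<^sub>0\<close>.\<close>

lemma dist_mono:
  assumes n: "n > 0" and X: "dist X \<delta>" and P: "dist P \<theta>" "obj P (Suc n) = obj X (Suc n)"
    and proj: "obj P n \<in> projectives C E n s"
    and T: "arr C T (obj P 0) = {\<zero>\<^bsub>T,obj P 0\<^esub>}"
    and f: "f \<in> H T (obj X 0)" and df: "diff X 0 \<cdot> f = \<zero>\<^bsub>T,obj X (Suc 0)\<^esub>"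
  shows "f = \<zero>\<^bsub>T,obj X 0\<^esub>"
proof -
  define A K where o_def: "A = obj X 0" "K = obj X (Suc n)"
  define P1 X1 where o1_def: "P1 = obj P (Suc 0)" "X1 = obj X (Suc 0)"
  have o: "A \<in> Ob C" "K \<in> Ob C" "P1 \<in> Ob C" "X1 \<in> Ob C" "T \<in> Ob C"
    using dist_obj[OF X] dist_obj[OF P(1)] Hom_dom[OF f] by (auto simp: o_def o1_def)
  have dP: "diff P n \<in> H (obj P n) K" using dist_diff[OF P(1), of n] P by (simp add: o_def)
  have \<delta>: "\<delta> \<in> \<E> K A" using dist_ext[OF X] by (simp add: o_def)
  have "pull E (diff P n) \<delta> = \<o>\<^bsub>obj P n,A\<^esub>"
    by (rule projective_ext[OF proj o(1) pull_mem[OF dP o(1) \<delta>]])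
  then obtain b where b: "b \<in> H (obj P 0) A" "\<delta> = push E b \<theta>"
    using dist_push_onto[OF n P(1) o(1), of \<delta>] \<delta> P by (auto simp: o_def)
  obtain g where g: "chain_map_on C 0 (Suc n) P X g" "g 0 = b"
    and N: "dist (mapping_cocone C n P X g) (pull E (diff X n) \<theta>)" (is "dist ?N _")
    using EA2_op[OF P(1), of b X] b P X by (auto simp: o_def Hom_arr)
  have g1: "g (Suc 0) \<in> H P1 X1"
    using chain_map_Hom[OF g(1) dist_complex[OF P(1)] dist_complex[OF X], of "Suc 0"] by (simp add: o1_def)
  have dX: "diff X 0 \<in> H A X1" using dist_diff[OF X, of 0] by (simp add: o_def o1_def)
  have f: "f \<in> H T A" and df: "diff X 0 \<cdot> f = \<zero>\<^bsub>T,X1\<^esub>" using f df by (simp_all add: o_def o1_def)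
  have z: "\<zero>\<^bsub>T,P1\<^esub> \<in> H T P1" by (rule zero_Hom[OF o(5,3)])
  \<comment> \<open>f placed in the summand A of the term P1 + A of the cocone. The next
    differential kills it, so it comes from a map T -> P_0, which is zero by assumption.\<close>
  define c where "c = colm C T P1 A \<zero>\<^bsub>T,P1\<^esub> f"
  have c: "c \<in> H T (dsum C P1 A)" unfolding c_def by (rule colm_Hom[OF z f])
  have e: "g (Suc 0) \<cdot> \<zero>\<^bsub>T,P1\<^esub> \<boxplus>\<^bsub>T,X1\<^esub> diff X 0 \<cdot> f = \<zero>\<^bsub>T,X1\<^esub>"
    using cmp_zero[OF g1 o(5)] df add_zero(1)[OF zero_Hom[OF o(5,4)]] by simp
  have "diff ?N (Suc 0) \<cdot> c = \<zero>\<^bsub>T,obj ?N (Suc (Suc 0))\<^esub>"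
  \<comment> \<open>For n = 1 the differential leaving degree 1 is already the last one and a row;
    otherwise it is a matrix with a further component to P_2.\<close>
  proof (cases "n = Suc 0")
    case True
    hence N2: "obj ?N (Suc (Suc 0)) = X1" "diff ?N (Suc 0) = rowm C P1 A X1 (g (Suc 0)) (diff X 0)"
      by (auto simp: mapping_cocone_def o1_def o_def)
    show ?thesis unfolding N2 c_def rowm_colm[OF g1 dX z f] e ..
  next
    case False
    define P2 where "P2 = obj P (Suc (Suc 0))"
    have d1: "diff P (Suc 0) \<in> H P1 P2" using dist_diff[OF P(1), of "Suc 0"] n by (simp add: o1_def P2_def)
    have oP2: "P2 \<in> Ob C" using d1 Hom_cod by blast
    note nd = neg_Hom[OF d1] and zA = zero_Hom[OF o(1) oP2]
    have N2: "obj ?N (Suc (Suc 0)) = dsum C P2 X1"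
      "diff ?N (Suc 0) = matm C P1 A P2 X1 (negm C P1 P2 (diff P (Suc 0))) \<zero>\<^bsub>A,P2\<^esub> (g (Suc 0)) (diff X 0)"
      using False n by (auto simp: mapping_cocone_def o1_def o_def P2_def)
    have e': "negm C P1 P2 (diff P (Suc 0)) \<cdot> \<zero>\<^bsub>T,P1\<^esub> \<boxplus>\<^bsub>T,P2\<^esub> \<zero>\<^bsub>A,P2\<^esub> \<cdot> f = \<zero>\<^bsub>T,P2\<^esub>"
      using cmp_zero[OF nd o(5)] zero_cmp[OF f oP2] add_zero(1)[OF zero_Hom[OF o(5) oP2]] by simp
    show ?thesis unfolding N2 c_def matm_colm[OF nd zA g1 dX z f] e e' by (rule colm_zero[OF o(5) oP2 o(4)])
  qed
  moreover have N1: "obj ?N (Suc 0) = dsum C P1 A" "obj ?N 0 = obj P 0"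
    using n by (auto simp: mapping_cocone_def o1_def o_def)
  ultimately obtain k where k: "k \<in> H T (obj P 0)" "c = diff ?N 0 \<cdot> k"
    using dist_cov[OF N n, of c T] c by auto
  have "k = \<zero>\<^bsub>T,obj P 0\<^esub>" using T k(1) Hom_arr by blast
  hence "c = \<zero>\<^bsub>T,dsum C P1 A\<^esub>" using k(2) cmp_zero[OF dist_diff[OF N, of 0] o(5)] N1 by simp
  hence "colm C T P1 A \<zero>\<^bsub>T,P1\<^esub> f = colm C T P1 A \<zero>\<^bsub>T,P1\<^esub> \<zero>\<^bsub>T,A\<^esub>"
    using colm_zero[OF o(5,3,1)] by (simp add: c_def)
  thus ?thesis using colm_inject[OF z f z zero_Hom[OF o(5,1)]] by (simp add: o_def)
qed

text \<open>Dual of \<open>dist_mono\<close>: extensions with values in the injective J_1 vanish, so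
  \<delta> is a pullback of the extension of J, and the cone of the comparison continues X to the
  right by J_{n+1}.\<close>

lemma dist_epi:
  assumes n: "n > 0" and X: "dist X \<delta>" and J: "dist J \<theta>" "obj J 0 = obj X 0"
    and inj: "obj J (Suc 0) \<in> injectives C E n s"
    and T: "arr C (obj J (Suc n)) T = {\<zero>\<^bsub>obj J (Suc n),T\<^esub>}"
    and f: "f \<in> H (obj X (Suc n)) T" and df: "f \<cdot> diff X n = \<zero>\<^bsub>obj X n,T\<^esub>"
  shows "f = \<zero>\<^bsub>obj X (Suc n),T\<^esub>"
proof -
  obtain m where m: "n = Suc m" using n by (cases n) auto
  define A K where o_def: "A = obj X 0" "K = obj X (Suc n)"
  define Jn Xn where o1_def: "Jn = obj J n" "Xn = obj X n"
  have o: "A \<in> Ob C" "K \<in> Ob C" "Jn \<in> Ob C" "Xn \<in> Ob C" "T \<in> Ob C"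
    using dist_obj[OF X] dist_obj[OF J(1)] Hom_cod[OF f] by (auto simp: o_def o1_def)
  have dJ: "diff J 0 \<in> H A (obj J (Suc 0))" using dist_diff[OF J(1), of 0] J by (simp add: o_def)
  have \<delta>: "\<delta> \<in> \<E> K A" using dist_ext[OF X] by (simp add: o_def)
  have "push E (diff J 0) \<delta> = \<o>\<^bsub>K,obj J (Suc 0)\<^esub>"
    by (rule injective_ext[OF inj o(2) push_mem[OF dJ o(2) \<delta>]])
  then obtain b where b: "b \<in> H K (obj J (Suc n))" "\<delta> = pull E b \<theta>"
    using dist_pull_onto[OF n J(1) o(2), of \<delta>] \<delta> J by (auto simp: o_def)
  obtain g where g: "chain_map_on C 0 (Suc n) X J g" "g (Suc n) = b"
    and M: "dist (mapping_cone C n X J g) (push E (diff X 0) \<theta>)" (is "dist ?M _")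
    using EA2[OF J(1), of b X] b J X by (auto simp: o_def Hom_arr)
  have g1: "g n \<in> H Xn Jn"
    using chain_map_Hom[OF g(1) dist_complex[OF X] dist_complex[OF J(1)], of n] by (simp add: o1_def)
  have dX: "diff X n \<in> H Xn K" using dist_diff[OF X, of n] by (simp add: o_def o1_def)
  note ndX = neg_Hom[OF dX]
  have f: "f \<in> H K T" and df: "f \<cdot> diff X n = \<zero>\<^bsub>Xn,T\<^esub>" using f df by (simp_all add: o_def o1_def)
  have z: "\<zero>\<^bsub>Jn,T\<^esub> \<in> H Jn T" by (rule zero_Hom[OF o(3,5)])
  define c where "c = rowm C K Jn T f \<zero>\<^bsub>Jn,T\<^esub>"
  have c: "c \<in> H (dsum C K Jn) T" unfolding c_def by (rule rowm_Hom[OF f z])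
  have e: "f \<cdot> negm C Xn K (diff X n) \<boxplus>\<^bsub>Xn,T\<^esub> \<zero>\<^bsub>Jn,T\<^esub> \<cdot> g n = \<zero>\<^bsub>Xn,T\<^esub>"
    using cmp_neg[OF dX f] df neg_zero[OF o(4,5)] zero_cmp[OF g1 o(5)] add_zero(1)[OF zero_Hom[OF o(4,5)]] by simp
  have "c \<cdot> diff ?M m = \<zero>\<^bsub>obj ?M m,T\<^esub>"
  \<comment> \<open>The differential entering degree n = m + 1 is the first one, hence a column, if
    m = 0, and a matrix otherwise.\<close>
  proof (cases m)
    case 0
    hence M2: "obj ?M m = Xn" "diff ?M m = colm C Xn K Jn (negm C Xn K (diff X n)) (g n)"
      using m by (auto simp: mapping_cone_def o1_def o_def numeral_2_eq_2)
    show ?thesis unfolding M2 c_def rowm_colm[OF f z ndX g1] e ..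
  next
    case (Suc l)
    define Jm where "Jm = obj J m"
    have d1: "diff J m \<in> H Jm Jn" using dist_diff[OF J(1), of m] m by (simp add: o1_def Jm_def)
    have oJm: "Jm \<in> Ob C" using d1 Hom_dom by blast
    note zA = zero_Hom[OF oJm o(2)]
    have M2: "obj ?M m = dsum C Xn Jm"
      "diff ?M m = matm C Xn Jm K Jn (negm C Xn K (diff X n)) \<zero>\<^bsub>Jm,K\<^esub> (g n) (diff J m)"
      using Suc m by (auto simp: mapping_cone_def o1_def o_def Jm_def)
    have e': "f \<cdot> \<zero>\<^bsub>Jm,K\<^esub> \<boxplus>\<^bsub>Jm,T\<^esub> \<zero>\<^bsub>Jn,T\<^esub> \<cdot> diff J m = \<zero>\<^bsub>Jm,T\<^esub>"
      using cmp_zero[OF f oJm] zero_cmp[OF d1 o(5)] add_zero(1)[OF zero_Hom[OF oJm o(5)]] by simp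
    show ?thesis unfolding M2 c_def rowm_matm[OF ndX zA g1 d1 f z] e e' by (rule rowm_zero[OF o(5,4) oJm])
  qed
  moreover have M1: "obj ?M (Suc m) = dsum C K Jn" "obj ?M (Suc (Suc m)) = obj J (Suc n)"
    using m by (auto simp: mapping_cone_def o1_def o_def)
  ultimately obtain k where k: "k \<in> H (obj J (Suc n)) T" "c = k \<cdot> diff ?M n"
    using dist_con[OF M, of m c T] c m by auto
  have "k = \<zero>\<^bsub>obj J (Suc n),T\<^esub>" using T k(1) Hom_arr by blast
  hence "c = \<zero>\<^bsub>dsum C K Jn,T\<^esub>" using k(2) zero_cmp[OF dist_diff[OF M, of n] o(5)] M1 m by simp
  hence "rowm C K Jn T f \<zero>\<^bsub>Jn,T\<^esub> = rowm C K Jn T \<zero>\<^bsub>K,T\<^esub> \<zero>\<^bsub>Jn,T\<^esub>"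
    using rowm_zero[OF o(5,2,3)] by (simp add: c_def)
  thus ?thesis using rowm_inject[OF f z zero_Hom[OF o(2,5)] z] by (simp add: o_def)
qed

text \<open>Every map kills the zero extension, so the identity of the first term extends along i to
  r, and the identity of the last term lifts along p to q'. It remains to make these
  compatible.\<close>

lemma dist_zero_split:
  assumes n: "n = Suc 0" and N: "dist N \<o>\<^bsub>obj N (Suc n),obj N 0\<^esub>"
  shows "\<exists>S. is_biproduct C (obj N 0) (obj N (Suc n)) S \<and> sumob S = obj N (Suc 0)"
proof -
  define A M K i p where o_def: "A = obj N 0" "M = obj N (Suc 0)" "K = obj N (Suc n)" "i = diff N 0" "p = diff N (Suc 0)"
  have i: "i \<in> H A M" and p: "p \<in> H M K" and pi: "p \<cdot> i = \<zero>\<^bsub>A,K\<^esub>"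
    using dist_diff[OF N] complex_dd[OF dist_complex[OF N]] n by (auto simp: o_def)
  have o: "A \<in> Ob C" "M \<in> Ob C" "K \<in> Ob C" using i p Hom_dom Hom_cod by blast+
  obtain r where r: "r \<in> H M A" "r \<cdot> i = idt C A"
    using dist_push_iff[OF N, of "idt C A" A] id_Hom[OF o(1)] push_one[OF id_Hom[OF o(1)] o(3)]
    by (auto simp: o_def)
  obtain q' where q': "q' \<in> H K M" "p \<cdot> q' = idt C K"
    using dist_pull_iff[OF N, of "idt C K" K] id_Hom[OF o(3)] pull_one[OF id_Hom[OF o(3)] o(1)] n
    by (auto simp: o_def)
  note rq = cmp_Hom[OF q'(1) r(1)]
  note irq = cmp_Hom[OF rq i]
  \<comment> \<open>The lift is corrected by its r-component, so that r q = 0 while p q = 1 is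
    kept.\<close>
  define q where "q = q' \<boxminus>\<^bsub>K,M\<^esub> i \<cdot> (r \<cdot> q')"
  have q: "q \<in> H K M" unfolding q_def by (rule sub_Hom[OF q'(1) irq])
  have pq: "p \<cdot> q = idt C K"
    unfolding q_def sub_distr[OF q'(1) irq p]
    using q'(2) assoc[OF rq i p] pi zero_cmp[OF rq o(3)] add_zero(3)[OF id_Hom[OF o(3)]] by simp
  have rq0: "r \<cdot> q = \<zero>\<^bsub>K,A\<^esub>"
    unfolding q_def sub_distr[OF q'(1) irq r(1)]
    using assoc[OF rq i r(1)] r(2) idl[OF rq] sub_self[OF rq] by simp
  note ir = cmp_Hom[OF r(1) i] and qp = cmp_Hom[OF p q] and I = id_Hom[OF o(2)]
  let ?s = "i \<cdot> r \<boxplus>\<^bsub>M,M\<^esub> q \<cdot> p"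
  have s: "?s \<in> H M M" by (rule add_Hom[OF ir qp])
  have ps: "p \<cdot> ?s = p"
    using distr[OF ir qp p] assoc[OF r(1) i p] pi zero_cmp[OF r(1) o(3)] assoc[OF p q p] pq idl[OF p] add_zero(2)[OF p] by simp
  have rs: "r \<cdot> ?s = r"
    using distr[OF ir qp r(1)] assoc[OF r(1) i r(1)] r(2) idl[OF r(1)] assoc[OF p q r(1)] rq0 zero_cmp[OF p o(1)]
      add_zero(1)[OF r(1)] by simp
  \<comment> \<open>Exactness in the middle writes 1 - s as i k, where s is the sum of i r and q p;
    then k = r i k = r (1 - s) = 0.\<close>
  have "p \<cdot> (idt C M \<boxminus>\<^bsub>M,M\<^esub> ?s) = \<zero>\<^bsub>M,K\<^esub>"
    using sub_distr[OF I s p] ps idr[OF p] sub_self[OF p] by simp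
  then obtain k where k: "k \<in> H M A" "idt C M \<boxminus>\<^bsub>M,M\<^esub> ?s = i \<cdot> k"
    using dist_cov[OF N, of 0 "idt C M \<boxminus>\<^bsub>M,M\<^esub> ?s" M] sub_Hom[OF I s] n by (auto simp: o_def)
  have "k = r \<cdot> (idt C M \<boxminus>\<^bsub>M,M\<^esub> ?s)" unfolding k(2) using assoc[OF k(1) i r(1)] r(2) idl[OF k(1)] by simp
  also have "\<dots> = \<zero>\<^bsub>M,A\<^esub>" using sub_distr[OF I s r(1)] rs idr[OF r(1)] sub_self[OF r(1)] by simp
  finally have "idt C M \<boxminus>\<^bsub>M,M\<^esub> ?s = \<zero>\<^bsub>M,M\<^esub>" using k(2) cmp_zero[OF i o(2)] by simp
  hence "?s = idt C M" using sub_eq_zero[OF I s] by simp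
  hence "is_biproduct C A K \<lparr>sumob = M, in1 = i, in2 = q, pr1 = r, pr2 = p\<rparr>"
    using o i p q r pi pq rq0 by (simp add: is_biproduct_def Hom_iff)
  thus ?thesis by (auto simp: o_def)
qed

text \<open>A Schanuel type argument that controls the last term of the conflation W given by (EA1).
  As its first morphism w and that of V factor through each other, the extension of W is a pullback
  of \<sigma> and w kills \<sigma>. So the cone of a comparison from W to V realizes zero and
  splits, and the last term of W becomes a summand of the sum of Y_1 and V_2.\<close>

lemma dist_first_cmp:
  assumes n: "n = Suc 0" and X: "dist X \<delta>" and Y: "dist Y \<rho>" and YX: "obj Y 0 = obj X (Suc 0)"
    and V: "dist V \<sigma>" "obj V 0 = obj X 0"
    and t: "t \<in> H (obj V (Suc 0)) (obj Y (Suc 0))" "diff Y 0 \<cdot> diff X 0 = t \<cdot> diff V 0"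
    and t': "t' \<in> H (obj Y (Suc 0)) (obj V (Suc 0))" "diff V 0 = t' \<cdot> (diff Y 0 \<cdot> diff X 0)"
  shows "\<exists>W \<omega> S. dist W \<omega> \<and> obj W 0 = obj X 0 \<and> obj W (Suc 0) = obj Y (Suc 0) \<and>
    diff W 0 = diff Y 0 \<cdot> diff X 0 \<and>
    is_biproduct C (obj Y (Suc 0)) (obj V (Suc n)) S \<and> sumob S = dsum C (obj W (Suc n)) (obj V (Suc 0))"
proof -
  have n0: "n > 0" using n by simp
  define A F V1 V2 where o_def: "A = obj X 0" "F = obj Y (Suc 0)" "V1 = obj V (Suc 0)" "V2 = obj V (Suc n)"
  define w e where d_def: "w = diff Y 0 \<cdot> diff X 0" "e = diff V 0"
  note t = t[folded o_def d_def] and t' = t'[folded o_def d_def]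
  have "inflation C E n s A (obj X (Suc 0)) (diff X 0)" "inflation C E n s (obj X (Suc 0)) F (diff Y 0)"
    using X Y YX by (auto simp: first_mor_def conflations_def o_def)
  from EA1_inflation[OF this] obtain W \<omega> where W: "dist W \<omega>" "obj W 0 = A" "obj W (Suc 0) = F" "diff W 0 = w"
    by (auto simp: first_mor_def conflations_def d_def)
  have w: "w \<in> H A F" and e: "e \<in> H A V1" using dist_diff[OF W(1), of 0] dist_diff[OF V(1), of 0] W V by (auto simp: o_def d_def)
  define W2 where "W2 = obj W (Suc n)"
  have o: "A \<in> Ob C" "F \<in> Ob C" "W2 \<in> Ob C" "V2 \<in> Ob C"
    using dist_obj[OF W(1)] dist_obj[OF V(1)] w Hom_dom Hom_cod by (auto simp: o_def W2_def)
  have \<omega>: "\<omega> \<in> \<E> W2 A" and \<sigma>: "\<sigma> \<in> \<E> V2 A" using dist_ext[OF W(1)] dist_ext[OF V(1)] W V by (auto simp: o_def W2_def)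
  have "push E e \<omega> = \<o>\<^bsub>W2,V1\<^esub>"
    using t'(2) push_push[OF w t'(1) o(3) \<omega>] dist_push[OF W(1)] W push_one[OF t'(1) o(3)] by (simp add: W2_def)
  then obtain c where c: "c \<in> H W2 V2" "\<omega> = pull E c \<sigma>"
    using dist_pull_onto[OF n0 V(1) o(3), of \<omega>] \<omega> V by (auto simp: o_def d_def)
  have "push E w \<sigma> = \<o>\<^bsub>V2,F\<^esub>"
    using t(2) push_push[OF e t(1) o(4) \<sigma>] dist_push[OF V(1)] V push_one[OF t(1) o(4)] by (simp add: o_def d_def)
  then obtain f where "dist (mapping_cone C n W V f) \<o>\<^bsub>V2,F\<^esub>"
    using EA2[OF V(1), of c W] c W V by (auto simp: o_def W2_def Hom_arr)
  moreover have "obj (mapping_cone C n W V f) 0 = F" "obj (mapping_cone C n W V f) (Suc 0) = dsum C W2 V1"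
    "obj (mapping_cone C n W V f) (Suc n) = V2"
    using n W by (auto simp: mapping_cone_def o_def W2_def)
  ultimately obtain S where "is_biproduct C F V2 S" "sumob S = dsum C W2 V1"
    using dist_zero_split[OF n, of "mapping_cone C n W V f"] by auto
  thus ?thesis using W by (auto simp: o_def d_def W2_def)
qed

text \<open>Dual argument: here the term of W to be controlled is the first one, and a cocone from V
  to W splits.\<close>

lemma dist_last_cmp:
  assumes n: "n = Suc 0" and X: "dist X \<delta>" and Y: "dist Y \<rho>" and YX: "obj Y (Suc n) = obj X n"
    and V: "dist V \<sigma>" "obj V (Suc n) = obj X (Suc n)"
    and t: "t \<in> H (obj Y n) (obj V n)" "diff X n \<cdot> diff Y n = diff V n \<cdot> t"
    and t': "t' \<in> H (obj V n) (obj Y n)" "diff V n = diff X n \<cdot> diff Y n \<cdot> t'"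
  shows "\<exists>W \<omega> S. dist W \<omega> \<and> obj W (Suc n) = obj X (Suc n) \<and> obj W n = obj Y n \<and>
    diff W n = diff X n \<cdot> diff Y n \<and>
    is_biproduct C (obj V 0) (obj Y n) S \<and> sumob S = dsum C (obj V n) (obj W 0)"
proof -
  have n0: "n > 0" using n by simp
  define A F V1 V0 where o_def: "A = obj X (Suc n)" "F = obj Y n" "V1 = obj V n" "V0 = obj V 0"
  define w e where d_def: "w = diff X n \<cdot> diff Y n" "e = diff V n"
  note t = t[folded o_def d_def] and t' = t'[folded o_def d_def]
  have "deflation C E n s F (obj X n) (diff Y n)" "deflation C E n s (obj X n) A (diff X n)"
    using X Y YX by (auto simp: last_mor_def conflations_def o_def)
  from EA1_deflation[OF this] obtain W \<omega> where W: "dist W \<omega>" "obj W (Suc n) = A" "obj W n = F" "diff W n = w"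
    by (auto simp: last_mor_def conflations_def d_def)
  have w: "w \<in> H F A" and e: "e \<in> H V1 A" using dist_diff[OF W(1), of n] dist_diff[OF V(1), of n] W V by (auto simp: o_def d_def)
  define W0 where "W0 = obj W 0"
  have o: "A \<in> Ob C" "F \<in> Ob C" "W0 \<in> Ob C" "V0 \<in> Ob C"
    using dist_obj[OF W(1)] dist_obj[OF V(1)] w Hom_dom Hom_cod by (auto simp: o_def W0_def)
  have \<omega>: "\<omega> \<in> \<E> A W0" and \<sigma>: "\<sigma> \<in> \<E> A V0" using dist_ext[OF W(1)] dist_ext[OF V(1)] W V by (auto simp: o_def W0_def)
  have "pull E e \<omega> = \<o>\<^bsub>V1,W0\<^esub>"
    using t'(2) pull_pull[OF w t'(1) o(3) \<omega>] dist_pull[OF W(1)] W pull_one[OF t'(1) o(3)] by (simp add: W0_def)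
  then obtain c where c: "c \<in> H V0 W0" "\<omega> = push E c \<sigma>"
    using dist_push_onto[OF n0 V(1) o(3), of \<omega>] \<omega> V by (auto simp: o_def d_def)
  have "pull E w \<sigma> = \<o>\<^bsub>F,V0\<^esub>"
    using t(2) pull_pull[OF e t(1) o(4) \<sigma>] dist_pull[OF V(1)] V pull_one[OF t(1) o(4)] by (simp add: o_def d_def)
  then obtain f where "dist (mapping_cocone C n V W f) \<o>\<^bsub>F,V0\<^esub>"
    using EA2_op[OF V(1), of c W] c W V by (auto simp: o_def W0_def Hom_arr)
  moreover have "obj (mapping_cocone C n V W f) (Suc n) = F" "obj (mapping_cocone C n V W f) (Suc 0) = dsum C V1 W0"
    "obj (mapping_cocone C n V W f) 0 = V0"
    using n W by (auto simp: mapping_cocone_def o_def W0_def)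
  ultimately obtain S where "is_biproduct C V0 F S" "sumob S = dsum C V1 W0"
    using dist_zero_split[OF n, of "mapping_cocone C n V W f"] by auto
  thus ?thesis using W by (auto simp: o_def d_def W0_def)
qed

end

section \<open>The subcategory \<open>\<A>\<close>\<close>

lemma full_sub_simps [simp]: "Ob (full_sub C S) = S" "Mor (full_sub C S) = Mor C" "idt (full_sub C S) = idt C"
    "cmp (full_sub C S) = cmp C"
  by (simp_all add: full_sub_def)

lemma Hom_full_sub: "S \<subseteq> Ob C \<Longrightarrow> f \<in> Hom (full_sub C S) A B \<longleftrightarrow> A \<in> S \<and> B \<in> S \<and> f \<in> Hom C A B"
  by (auto simp: Hom_def)

lemma complex_full_sub: "S \<subseteq> Ob C \<Longrightarrow>
    complex_on (full_sub C S) a b X \<longleftrightarrow> complex_on C a b X \<and> (\<forall>i\<in>{a..b}. obj X i \<in> S)"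
  by (auto simp: complex_on_def)

lemma chain_map_full_sub [simp]: "chain_map_on (full_sub C S) = chain_map_on C"
  by (simp add: chain_map_on_def fun_eq_iff)

lemma hequiv_full_sub [simp]: "hequiv (full_sub C S) n X Y = hequiv C n X Y"
  by (simp add: hequiv_def end_fixing_map_def homotopic_def)

lemma (in preadditive_category) full_sub_preadditive:
  assumes S: "S \<subseteq> Ob C" shows "preadditive_category (full_sub C S)"
proof (rule preadditive_category.intro)
  fix A B D f g assume "A \<in> Ob (full_sub C S)" "B \<in> Ob (full_sub C S)" "D \<in> Ob (full_sub C S)"
    "f \<in> arr (full_sub C S) A B" "g \<in> arr (full_sub C S) B D"
  thus "g \<bullet>\<^bsub>full_sub C S\<^esub> f \<in> arr (full_sub C S) A D" using cmp_arr[of A B D f g] S by auto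
next
  fix A B D F f g h assume "A \<in> Ob (full_sub C S)" "B \<in> Ob (full_sub C S)" "D \<in> Ob (full_sub C S)"
    "F \<in> Ob (full_sub C S)" "f \<in> arr (full_sub C S) A B" "g \<in> arr (full_sub C S) B D" "h \<in> arr (full_sub C S) D F"
  thus "h \<bullet>\<^bsub>full_sub C S\<^esub> g \<bullet>\<^bsub>full_sub C S\<^esub> f = h \<bullet>\<^bsub>full_sub C S\<^esub> (g \<bullet>\<^bsub>full_sub C S\<^esub> f)"
    using cmp_assoc[of A B D F f g h] S by auto
next
  fix A B f assume "A \<in> Ob (full_sub C S)" "B \<in> Ob (full_sub C S)" "f \<in> arr (full_sub C S) A B"
  thus "idt (full_sub C S) B \<bullet>\<^bsub>full_sub C S\<^esub> f = f" "f \<bullet>\<^bsub>full_sub C S\<^esub> idt (full_sub C S) A = f"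
    using id_left[of A B f] id_right[of A B f] S by auto
qed (use S in \<open>auto simp: id_arr Mor_group cmp_add_left cmp_add_right subset_iff\<close>)

lemma (in additive_bifunctor) full_sub_bifunctor:
  assumes S: "S \<subseteq> Ob C" shows "additive_bifunctor (full_sub C S) E"
proof -
  have "A \<in> Ob C" if "A \<in> S" for A using S that by blast
  note * = push_id[OF this this] pull_id[OF this this] push_cmp[OF this this this this]
    pull_cmp[OF this this this this] push_pull[OF this this this this]
  show ?thesis
    by (rule additive_bifunctor.intro)
      (use S * in \<open>auto simp: Ext_group push_hom pull_hom push_add pull_add subset_iff\<close>)
qed

locale vanishing_subcategory = n_exangulated_category C E n s
  for C :: "('o, 'm) cat" and E :: "('o, 'm, 'e) bifunctor" and n :: nat
    and s :: "('o, 'm, 'e) realization" +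
  fixes S :: "'o set"
  assumes n0: "n > 0"
    and projs: "enough_projectives C E n s"
    and injs: "enough_injectives C E n s"
    and sub: "subcategory C S"
    and closed: "n_extension_closed C E n s S"
    and Sigma_vanish: "\<And>K A. \<lbrakk>K \<in> Sigma_class C E n s S; A \<in> S\<rbrakk> \<Longrightarrow> arr C K A = {zerom C K A}"
    and Omega_vanish: "\<And>A T. \<lbrakk>A \<in> S; T \<in> Omega C E n s S\<rbrakk> \<Longrightarrow> arr C A T = {zerom C A T}"
begin

abbreviation F :: "('o, 'm) cat" where "F \<equiv> full_sub C S"

text \<open>Working predicate for the \<open>\<t>\<close>-conflations. It avoids the choice and the
  second kind of homotopy class in \<open>sub_realization\<close>; \<open>sub_conflations_eq\<close>
  justifies the replacement.\<close>

definition distS :: "('o, 'm) cpx \<Rightarrow> 'e \<Rightarrow> bool" where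
  "distS X \<delta> \<longleftrightarrow> dist X \<delta> \<and> (\<forall>i\<le>Suc n. obj X i \<in> S)"

lemma distSD: "distS X \<delta> \<Longrightarrow> dist X \<delta>" "\<lbrakk>distS X \<delta>; i \<le> Suc n\<rbrakk> \<Longrightarrow> obj X i \<in> S"
  by (simp_all add: distS_def)

lemma SOb: "S \<subseteq> Ob C" and S_zero: "zero_object C Z \<Longrightarrow> Z \<in> S"
  and S_biproduct: "\<lbrakk>A \<in> S; B \<in> S; is_biproduct C A B D\<rbrakk> \<Longrightarrow> sumob D \<in> S"
  and S_summand: "\<lbrakk>A \<in> Ob C; B \<in> Ob C; is_biproduct C A B D; sumob D \<in> S\<rbrakk> \<Longrightarrow> A \<in> S \<and> B \<in> S"
  using sub unfolding subcategory_def by blast+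

lemma S_Ob: "A \<in> S \<Longrightarrow> A \<in> Ob C" using SOb by blast

lemma dsum_S: "\<lbrakk>A \<in> S; B \<in> S\<rbrakk> \<Longrightarrow> dsum C A B \<in> S"
  using S_biproduct[OF _ _ bip] S_Ob by (simp add: dsum_def)

lemma dsum_S_iff: "\<lbrakk>A \<in> Ob C; B \<in> Ob C; dsum C A B \<in> S\<rbrakk> \<Longrightarrow> A \<in> S \<and> B \<in> S"
  using S_summand[OF _ _ bip] by (simp add: dsum_def)

lemma biproduct_F: "\<lbrakk>A \<in> S; B \<in> S\<rbrakk> \<Longrightarrow> is_biproduct F A B D \<longleftrightarrow> is_biproduct C A B D"
  using S_biproduct[of A B D] S_Ob by (auto simp: is_biproduct_def)

text \<open>The predicates under \<open>SOME\<close> coincide, because direct sums of objects of S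
  lie in S. So even the chosen sums agree, and mapping cones formed in the subcategory are the very
  same complexes.\<close>

lemma bip_F: "\<lbrakk>A \<in> S; B \<in> S\<rbrakk> \<Longrightarrow> bip F A B = bip C A B"
  by (simp add: bip_def biproduct_F)

lemma F_additive: "additive_category F"
proof (intro additive_category.intro additive_category_axioms.intro)
  show "preadditive_category F" by (rule full_sub_preadditive[OF SOb])
  obtain Z where "zero_object C Z" using ex_zero_object by blast
  hence "zero_object F Z" using S_zero[of Z] S_Ob by (simp add: zero_object_def)
  thus "\<exists>Z. zero_object F Z" by blast
  fix A B assume "A \<in> Ob F" "B \<in> Ob F"
  thus "\<exists>D. is_biproduct F A B D" using bip S_Ob biproduct_F by auto
qed

text \<open>Factorization in the inner degrees is inherited from C by fullness; the vanishing
  condition is what gives cancellation at the last term.\<close>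

lemma distS_con_exact: assumes X: "distS X \<delta>" shows "con_exact F n X"
  unfolding con_exact_def
proof (intro conjI ballI allI impI)
  show "complex_on F 0 (Suc n) X" using dist_complex distSD[OF X] by (simp add: complex_full_sub[OF SOb])
next
  fix T g assume T: "T \<in> Ob F" and g: "g \<in> Hom F (obj X (Suc n)) T" "g \<bullet>\<^bsub>F\<^esub> diff X n = zerom F (obj X n) T"
  \<comment> \<open>J starts at an object of S, so its last term belongs to
    \<open>Sigma_class\<close> and has no nonzero map to T.\<close>
  obtain J \<theta> where J: "dist J \<theta>" "obj J 0 = obj X 0" "\<forall>i\<in>{1..n}. obj J i \<in> injectives C E n s"
    using injs S_Ob[OF distSD(2)[OF X le0]] unfolding enough_injectives_def by blast
  hence "obj J (Suc n) \<in> Sigma_class C E n s S"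
    using distSD(2)[OF X, of 0] unfolding Sigma_class_def by auto
  hence "arr C (obj J (Suc n)) T = {\<zero>\<^bsub>obj J (Suc n),T\<^esub>}" using Sigma_vanish T by simp
  thus "g = zerom F (obj X (Suc n)) T"
    using dist_epi[OF n0 distSD(1)[OF X] J(1,2), of T g] J(3) n0 g by (simp add: Hom_full_sub[OF SOb])
next
  fix T i g assume "T \<in> Ob F" and i: "i < n" and g: "g \<in> Hom F (obj X (Suc i)) T"
    "g \<bullet>\<^bsub>F\<^esub> diff X i = zerom F (obj X i) T"
  thus "\<exists>k\<in>Hom F (obj X (Suc (Suc i))) T. g = k \<bullet>\<^bsub>F\<^esub> diff X (Suc i)"
    using dist_con[OF distSD(1)[OF X] i, of g T] distSD(2)[OF X, of "Suc (Suc i)"] by (auto simp: Hom_full_sub[OF SOb])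
qed

lemma distS_cov_exact: assumes X: "distS X \<delta>" shows "cov_exact F n X"
  unfolding cov_exact_def
proof (intro conjI ballI allI impI)
  show "complex_on F 0 (Suc n) X" using dist_complex distSD[OF X] by (simp add: complex_full_sub[OF SOb])
next
  fix T g assume T: "T \<in> Ob F" and g: "g \<in> Hom F T (obj X 0)" "diff X 0 \<bullet>\<^bsub>F\<^esub> g = zerom F T (obj X 1)"
  obtain P \<theta> where P: "dist P \<theta>" "obj P (Suc n) = obj X (Suc n)" "\<forall>i\<in>{1..n}. obj P i \<in> projectives C E n s"
    using projs S_Ob[OF distSD(2)[OF X order_refl]] unfolding enough_projectives_def by blast
  hence "obj P 0 \<in> Omega C E n s S"
    using distSD(2)[OF X, of "Suc n"] unfolding Omega_def by auto
  hence "arr C T (obj P 0) = {\<zero>\<^bsub>T,obj P 0\<^esub>}" using Omega_vanish T by simp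
  thus "g = zerom F T (obj X 0)"
    using dist_mono[OF n0 distSD(1)[OF X] P(1,2), of T g] P(3) n0 g by (simp add: Hom_full_sub[OF SOb])
next
  fix T i g assume "T \<in> Ob F" and i: "i < n" and g: "g \<in> Hom F T (obj X (Suc i))"
    "diff X (Suc i) \<bullet>\<^bsub>F\<^esub> g = zerom F T (obj X (Suc (Suc i)))"
  thus "\<exists>k\<in>Hom F T (obj X i). g = diff X i \<bullet>\<^bsub>F\<^esub> k"
    using dist_cov[OF distSD(1)[OF X] i, of g T] distSD(2)[OF X, of i] by (auto simp: Hom_full_sub[OF SOb])
qed

lemma distS_hequiv: assumes X: "distS X \<delta>" and Y: "complex_on F 0 (Suc n) Y" and XY: "hequiv F n X Y"
  shows "distS Y \<delta>"
proof -
  have cY: "complex_on C 0 (Suc n) Y" and YS: "\<forall>i\<le>Suc n. obj Y i \<in> S"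
    using Y by (auto simp: complex_full_sub[OF SOb])
  have e: "obj Y 0 = obj X 0" "obj Y (Suc n) = obj X (Suc n)"
    using XY by (auto simp: hequiv_def end_fixing_map_def)
  have "hclass C n X = hclass C n Y"
    by (rule hclass_eq[OF dist_complex[OF distSD(1)[OF X]] cY]) (use XY in simp)
  thus ?thesis using distSD(1)[OF X] cY YS e by (simp add: distS_def distinguished_def)
qed

lemma distS_ex:
  assumes "K \<in> S" "A \<in> S" "\<delta> \<in> carrier (Ext E K A)"
  shows "\<exists>X. distS X \<delta> \<and> obj X 0 = A \<and> obj X (Suc n) = K"
proof -
  obtain X where X: "dist X \<delta>" "obj X 0 = A" "obj X (Suc n) = K" "\<forall>i\<in>{1..n}. obj X i \<in> S"
    using closed assms unfolding n_extension_closed_def by blast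
  have "obj X i \<in> S" if "i \<le> Suc n" for i
    using that X assms by (cases "i = 0 \<or> i = Suc n") auto
  thus ?thesis using X by (auto simp: distS_def)
qed

text \<open>The test objects and the maps produced lie between objects of S, so most assumptions are
  inherited from C. The exceptions are exactness at the ends and, for n = 1, the composition of
  inflations and of deflations.\<close>

lemma F_calculus: "extension_calculus F E n distS"
proof (intro extension_calculus.intro extension_category.intro extension_calculus_axioms.intro)
  show "additive_category F" by (rule F_additive)
  show "additive_bifunctor F E" by (rule full_sub_bifunctor[OF SOb])
  show "n > 0" by (rule n0)
next
  fix X \<delta> assume "distS X \<delta>" thus "con_exact F n X" by (rule distS_con_exact)
next
  fix X \<delta> assume "distS X \<delta>" thus "cov_exact F n X" by (rule distS_cov_exact)
next
  fix X \<delta> assume "distS X \<delta>" thus "\<delta> \<in> \<E> (obj X (Suc n)) (obj X 0)" by (intro dist_ext distSD)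
next
  fix X \<delta> assume "distS X \<delta>"
  thus "push E (diff X 0) \<delta> = \<o>\<^bsub>obj X (Suc n),obj X (Suc 0)\<^esub>" by (intro dist_push distSD)
next
  fix X \<delta> assume "distS X \<delta>"
  thus "pull E (diff X n) \<delta> = \<o>\<^bsub>obj X n,obj X 0\<^esub>" by (intro dist_pull distSD)
next
  fix X \<delta> g T assume X: "distS X \<delta>" and "g \<in> Hom F (obj X 0) T" "push E g \<delta> = \<o>\<^bsub>obj X (Suc n),T\<^esub>"
  thus "\<exists>k\<in>Hom F (obj X (Suc 0)) T. g = k \<bullet>\<^bsub>F\<^esub> diff X 0"
    using dist_push_iff[OF distSD(1)[OF X], of g T] distSD(2)[OF X, of "Suc 0"] by (auto simp: Hom_full_sub[OF SOb])
next
  fix X \<delta> g T assume X: "distS X \<delta>" and "g \<in> Hom F T (obj X (Suc n))" "pull E g \<delta> = \<o>\<^bsub>T,obj X 0\<^esub>"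
  thus "\<exists>k\<in>Hom F T (obj X n). g = diff X n \<bullet>\<^bsub>F\<^esub> k"
    using dist_pull_iff[OF distSD(1)[OF X], of g T] distSD(2)[OF X, of n] by (auto simp: Hom_full_sub[OF SOb])
next
  fix X \<delta> T \<eta> assume X: "distS X \<delta>" and "T \<in> Ob F" "\<eta> \<in> \<E> (obj X (Suc n)) T"
    "pull E (diff X n) \<eta> = \<o>\<^bsub>obj X n,T\<^esub>"
  thus "\<exists>g\<in>Hom F (obj X 0) T. \<eta> = push E g \<delta>"
    using dist_push_onto[OF n0 distSD(1)[OF X], of T \<eta>] distSD(2)[OF X, of 0] S_Ob by (auto simp: Hom_full_sub[OF SOb])
next
  fix X \<delta> T \<eta> assume X: "distS X \<delta>" and "T \<in> Ob F" "\<eta> \<in> \<E> T (obj X 0)"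
    "push E (diff X 0) \<eta> = \<o>\<^bsub>T,obj X (Suc 0)\<^esub>"
  thus "\<exists>g\<in>Hom F T (obj X (Suc n)). \<eta> = pull E g \<delta>"
    using dist_pull_onto[OF n0 distSD(1)[OF X], of T \<eta>] distSD(2)[OF X, of "Suc n"] S_Ob by (auto simp: Hom_full_sub[OF SOb])
next
  fix X \<delta> T \<eta> assume X: "distS X \<delta>" and "T \<in> Ob F" "\<eta> \<in> \<E> T (obj X (Suc 0))"
    "push E (diff X (Suc 0)) \<eta> = \<o>\<^bsub>T,obj X (Suc (Suc 0))\<^esub>"
  thus "\<exists>\<epsilon>\<in>\<E> T (obj X 0). \<eta> = push E (diff X 0) \<epsilon>"
    using dist_push_mid[OF n0 distSD(1)[OF X], of T \<eta>] S_Ob by simp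
next
  fix X \<delta> T \<eta> assume X: "distS X \<delta>" and "T \<in> Ob F" "\<eta> \<in> \<E> (obj X n) T"
    "pull E (diff X (n - Suc 0)) \<eta> = \<o>\<^bsub>obj X (n - Suc 0),T\<^esub>"
  thus "\<exists>\<epsilon>\<in>\<E> (obj X (Suc n)) T. \<eta> = pull E (diff X n) \<epsilon>"
    using dist_pull_mid[OF n0 distSD(1)[OF X], of T \<eta>] S_Ob by simp
next
  fix K A \<delta> assume "K \<in> Ob F" "A \<in> Ob F" "\<delta> \<in> \<E> K A"
  thus "\<exists>X. distS X \<delta> \<and> obj X 0 = A \<and> obj X (Suc n) = K" using distS_ex by simp
next
  fix X \<delta> Y \<rho> a c assume X: "distS X \<delta>" and Y: "distS Y \<rho>" and "a \<in> Hom F (obj X 0) (obj Y 0)"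
    "c \<in> Hom F (obj X (Suc n)) (obj Y (Suc n))" "push E a \<delta> = pull E c \<rho>"
  thus "\<exists>f. chain_map_on F 0 (Suc n) X Y f \<and> f 0 = a \<and> f (Suc n) = c"
    using R0[OF distSD(1)[OF X] distSD(1)[OF Y], of a c] by (simp add: Hom_def)
next
  fix X \<delta> Y assume "distS X \<delta>" "complex_on F 0 (Suc n) Y" "hequiv F n X Y"
  thus "distS Y \<delta>" by (rule distS_hequiv)
next
  fix X \<delta> Y \<rho> V \<sigma> t t'
  assume n: "n = Suc 0" and X: "distS X \<delta>" and Y: "distS Y \<rho>" and YX: "obj Y 0 = obj X (Suc 0)"
    and V: "distS V \<sigma>" "obj V 0 = obj X 0"
    and t: "t \<in> Hom F (obj V (Suc 0)) (obj Y (Suc 0))" "diff Y 0 \<bullet>\<^bsub>F\<^esub> diff X 0 = t \<bullet>\<^bsub>F\<^esub> diff V 0"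
    and t': "t' \<in> Hom F (obj Y (Suc 0)) (obj V (Suc 0))" "diff V 0 = t' \<bullet>\<^bsub>F\<^esub> (diff Y 0 \<bullet>\<^bsub>F\<^esub> diff X 0)"
  have "t \<in> H (obj V (Suc 0)) (obj Y (Suc 0))" "t' \<in> H (obj Y (Suc 0)) (obj V (Suc 0))"
    using t(1) t'(1) by (auto simp: Hom_full_sub[OF SOb])
  from dist_first_cmp[OF n distSD(1)[OF X] distSD(1)[OF Y] YX distSD(1)[OF V(1)] V(2)
      this(1) t(2)[unfolded full_sub_simps] this(2) t'(2)[unfolded full_sub_simps]]
  obtain W \<omega> D where W: "dist W \<omega>" "obj W 0 = obj X 0" "obj W (Suc 0) = obj Y (Suc 0)" "diff W 0 = diff Y 0 \<cdot> diff X 0"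
    and D: "is_biproduct C (obj Y (Suc 0)) (obj V (Suc n)) D" "sumob D = dsum C (obj W (Suc n)) (obj V (Suc 0))" by blast
  \<comment> \<open>The last term of W is the only one not yet known to lie in S; the splitting
    makes it a summand of a direct sum of two objects of S.\<close>
  have "dsum C (obj W (Suc n)) (obj V (Suc 0)) \<in> S"
    using S_biproduct[OF distSD(2)[OF Y] distSD(2)[OF V(1)] D(1)] D(2) by simp
  hence "obj W (Suc n) \<in> S"
    using dsum_S_iff[OF dist_obj[OF W(1), of "Suc n"] dist_obj[OF distSD(1)[OF V(1)], of "Suc 0"]] by simp
  hence "\<forall>i\<le>Suc n. obj W i \<in> S"
    using n W distSD(2)[OF X] distSD(2)[OF Y] by (auto simp: le_Suc_eq)
  thus "\<exists>W \<omega>. distS W \<omega> \<and> obj W 0 = obj X 0 \<and> obj W (Suc 0) = obj Y (Suc 0) \<and> diff W 0 = diff Y 0 \<bullet>\<^bsub>F\<^esub> diff X 0"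
    using W unfolding distS_def full_sub_simps by blast
next
  fix X \<delta> Y \<rho> V \<sigma> t t'
  assume n: "n = Suc 0" and X: "distS X \<delta>" and Y: "distS Y \<rho>" and YX: "obj Y (Suc n) = obj X n"
    and V: "distS V \<sigma>" "obj V (Suc n) = obj X (Suc n)"
    and t: "t \<in> Hom F (obj Y n) (obj V n)" "diff X n \<bullet>\<^bsub>F\<^esub> diff Y n = diff V n \<bullet>\<^bsub>F\<^esub> t"
    and t': "t' \<in> Hom F (obj V n) (obj Y n)" "diff V n = diff X n \<bullet>\<^bsub>F\<^esub> diff Y n \<bullet>\<^bsub>F\<^esub> t'"
  have "t \<in> H (obj Y n) (obj V n)" "t' \<in> H (obj V n) (obj Y n)"
    using t(1) t'(1) by (auto simp: Hom_full_sub[OF SOb])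
  from dist_last_cmp[OF n distSD(1)[OF X] distSD(1)[OF Y] YX distSD(1)[OF V(1)] V(2)
      this(1) t(2)[unfolded full_sub_simps] this(2) t'(2)[unfolded full_sub_simps]]
  obtain W \<omega> D where W: "dist W \<omega>" "obj W (Suc n) = obj X (Suc n)" "obj W n = obj Y n" "diff W n = diff X n \<cdot> diff Y n"
    and D: "is_biproduct C (obj V 0) (obj Y n) D" "sumob D = dsum C (obj V n) (obj W 0)" by blast
  have "dsum C (obj V n) (obj W 0) \<in> S"
    using S_biproduct[OF distSD(2)[OF V(1)] distSD(2)[OF Y] D(1)] D(2) by simp
  hence "obj W 0 \<in> S"
    using dsum_S_iff[OF dist_obj[OF distSD(1)[OF V(1)], of n] dist_obj[OF W(1), of 0]] by simp
  hence "\<forall>i\<le>Suc n. obj W i \<in> S"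
    using n W distSD(2)[OF X] distSD(2)[OF Y] by (auto simp: le_Suc_eq)
  thus "\<exists>W \<omega>. distS W \<omega> \<and> obj W (Suc n) = obj X (Suc n) \<and> obj W n = obj Y n \<and> diff W n = diff X n \<bullet>\<^bsub>F\<^esub> diff Y n"
    using W unfolding distS_def full_sub_simps by blast
qed

text \<open>By fullness, homotopy equivalence in the subcategory is that of C. So the class of the
  realization picked by \<open>SOME\<close> is the part of the class in C with all terms in S,
  whatever the choice.\<close>

lemma sub_conflations_eq: "sub_conflations C E n s S = {X. \<exists>\<delta>. distS X \<delta>}"
proof -
  interpret F: additive_category F by (rule F_additive)
  define Q where "Q A K \<delta> X \<longleftrightarrow> dist X \<delta> \<and> obj X 0 = A \<and> obj X (Suc n) = K \<and> (\<forall>i\<in>{1..n}. obj X i \<in> S)" for A K \<delta> X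
  have real: "sub_realization C E n s S K A \<delta> = hclass F n (SOME X. Q A K \<delta> X)" for A K \<delta>
    by (simp add: sub_realization_def Q_def)
  have Q: "distS (SOME X. Q A K \<delta> X) \<delta> \<and> obj (SOME X. Q A K \<delta> X) 0 = A \<and> obj (SOME X. Q A K \<delta> X) (Suc n) = K"
    if "A \<in> S" "K \<in> S" "\<delta> \<in> carrier (Ext E K A)" for A K \<delta>
  proof -
    have "\<exists>X. Q A K \<delta> X" using closed that unfolding n_extension_closed_def Q_def by blast
    hence q: "Q A K \<delta> (SOME X. Q A K \<delta> X)" by (rule someI_ex)
    have "obj (SOME X. Q A K \<delta> X) i \<in> S" if "i \<le> Suc n" for i
      using that q \<open>A \<in> S\<close> \<open>K \<in> S\<close> by (cases "i = 0 \<or> i = Suc n") (auto simp: Q_def)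
    thus ?thesis using q by (simp add: Q_def distS_def)
  qed
  have "distinguished F E n (sub_realization C E n s S) X \<delta> \<longleftrightarrow> distS X \<delta>" for X \<delta>
  proof
    assume d: "distinguished F E n (sub_realization C E n s S) X \<delta>"
    hence X: "complex_on F 0 (Suc n) X" and \<delta>: "\<delta> \<in> carrier (Ext E (obj X (Suc n)) (obj X 0))"
      and r: "hclass F n (SOME Y. Q (obj X 0) (obj X (Suc n)) \<delta> Y) = hclass F n X"
      by (simp_all add: distinguished_def real)
    have "obj X 0 \<in> S" "obj X (Suc n) \<in> S" using F.complex_obj[OF X] by auto
    note q = Q[OF this \<delta>]
    have "X \<in> hclass F n X" using F.hequiv_refl[OF X] X by (simp add: hclass_def)
    thus "distS X \<delta>" using distS_hequiv[OF _ X] q r by (auto simp: hclass_def)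
  next
    assume X: "distS X \<delta>"
    note \<delta> = dist_ext[OF distSD(1)[OF X]]
    define Y where "Y = (SOME Y. Q (obj X 0) (obj X (Suc n)) \<delta> Y)"
    have "obj X 0 \<in> S" "obj X (Suc n) \<in> S" using distSD(2)[OF X] by auto
    note q = Q[OF this \<delta>, folded Y_def]
    have cX: "complex_on F 0 (Suc n) X" by (rule F.con_exact_complex[OF distS_con_exact[OF X]])
    have cY: "complex_on F 0 (Suc n) Y" by (rule F.con_exact_complex[OF distS_con_exact]) (use q in blast)
    have "hclass C n X = hclass C n Y" using q distSD(1)[OF X] by (auto simp: distS_def distinguished_def)
    moreover have "X \<in> hclass C n X"
      using hequiv_refl dist_complex[OF distSD(1)[OF X]] by (simp add: hclass_def)
    ultimately have "hequiv F n Y X" by (simp add: hclass_def)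
    hence "hclass F n Y = hclass F n X" by (rule F.hclass_eq[OF cY cX])
    thus "distinguished F E n (sub_realization C E n s S) X \<delta>"
      using cX \<delta> by (simp add: distinguished_def real Y_def)
  qed
  thus ?thesis by (simp add: sub_conflations_def conflations_def)
qed

section \<open>The axioms of an n-exact category\<close>

lemma mapping_cone_F:
  assumes "\<And>i. i \<le> Suc n \<Longrightarrow> obj X i \<in> S" "\<And>i. i \<le> Suc n \<Longrightarrow> obj Y i \<in> S"
  shows "mapping_cone F n X Y f = mapping_cone C n X Y f"
  using assms n0 by (auto simp: mapping_cone_def fun_eq_iff colm_def rowm_def matm_def dsum_def bip_F)

lemma mapping_cocone_F:
  assumes "\<And>i. i \<le> n \<Longrightarrow> obj X i \<in> S" "\<And>i. i \<le> n \<Longrightarrow> obj Y i \<in> S"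
  shows "mapping_cocone F n X Y f = mapping_cocone C n X Y f"
  using assms n0 by (auto simp: mapping_cocone_def fun_eq_iff colm_def rowm_def matm_def dsum_def bip_F)

text \<open>(R2) concerns zero objects of C, whereas a zero object of the subcategory is only tested
  against objects of S. The link is that its identity is the zero map.\<close>

lemma F_zero_object: assumes Z: "zero_object F Z" shows "zero_object C Z" "idt C Z = \<zero>\<^bsub>Z,Z\<^esub>"
proof -
  have ZS: "Z \<in> S" and "\<exists>!f. f \<in> arr C Z Z" using Z by (auto simp: zero_object_def)
  have o: "Z \<in> Ob C" using S_Ob[OF ZS] .
  show id: "idt C Z = \<zero>\<^bsub>Z,Z\<^esub>"
    using \<open>\<exists>!f. f \<in> arr C Z Z\<close> Hom_arr[OF id_Hom[OF o]] Hom_arr[OF zero_Hom[OF o o]] by blast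
  have "f = \<zero>\<^bsub>X,Z\<^esub>" if "X \<in> Ob C" "f \<in> arr C X Z" for X f
    using idl[OF HomI[OF that(1) o that(2)]] zero_cmp[OF HomI[OF that(1) o that(2)] o] id by simp
  moreover have "f = \<zero>\<^bsub>Z,X\<^esub>" if "X \<in> Ob C" "f \<in> arr C Z X" for X f
    using idr[OF HomI[OF o that]] cmp_zero[OF HomI[OF o that] o] id by simp
  ultimately show "zero_object C Z"
    unfolding zero_object_def using o Hom_arr[OF zero_Hom[OF o]] Hom_arr[OF zero_Hom[OF _ o]] by blast
qed

text \<open>The cocone from (EA2op) is itself a conflation, and its terms are direct sums of objects
  of S. So it is a conflation of the subcategory, and the exactness already proved for those,
  including cancellation at the end, is the pushout property.\<close>

lemma F_pushout:
  assumes X: "distS X \<delta>" and B: "B \<in> S" and a: "a \<in> arr C (obj X 0) B"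
  shows "\<exists>Y f. obj Y 0 = B \<and> f 0 = a \<and> n_pushout F n X Y f \<and> (\<exists>\<rho>. distS Y \<rho>)"
proof -
  interpret F: additive_category F by (rule F_additive)
  note o = S_Ob[OF distSD(2)[OF X]]
  have aH: "a \<in> H (obj X 0) B" using a o[of 0] S_Ob[OF B] by (simp add: Hom_def)
  have "push E a \<delta> \<in> \<E> (obj X (Suc n)) B"
    by (rule push_mem[OF aH o dist_ext[OF distSD(1)[OF X]]]) simp
  then obtain Y where Y: "distS Y (push E a \<delta>)" "obj Y 0 = B" "obj Y (Suc n) = obj X (Suc n)"
    using distS_ex[OF distSD(2)[OF X] B] by blast
  obtain f where f: "chain_map_on C 0 (Suc n) X Y f" "f 0 = a"
    and N: "dist (mapping_cocone C n X Y f) (pull E (diff Y n) \<delta>)"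
    using EA2_op[OF distSD(1)[OF X], of a Y] a Y distSD(1)[OF Y(1)] by auto
  have "obj (mapping_cocone C n X Y f) i \<in> S" for i
    using distSD(2)[OF X] distSD(2)[OF Y(1)] dsum_S by (simp add: mapping_cocone_def)
  hence "con_exact F n (mapping_cocone C n X Y f)" using N distS_con_exact by (simp add: distS_def)
  hence "con_left_exact F n (mapping_cocone F n X Y f)"
    using F.con_exact_iff mapping_cocone_F[of X Y f] distSD(2)[OF X] distSD(2)[OF Y(1)] by simp
  moreover have "complex_on F 0 n Y"
    using F.con_exact_complex[OF distS_con_exact[OF Y(1)]] by (simp add: complex_on_def)
  moreover have "chain_map_on F 0 n X Y f" using f(1) by (simp add: chain_map_on_def)
  ultimately show ?thesis using Y f unfolding n_pushout_def by blast
qed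

lemma F_pullback:
  assumes Y: "distS Y \<rho>" and K: "K \<in> S" and c: "c \<in> arr C K (obj Y (Suc n))"
  shows "\<exists>X f. obj X (Suc n) = K \<and> f (Suc n) = c \<and> n_pullback F n X Y f \<and> (\<exists>\<delta>. distS X \<delta>)"
proof -
  interpret F: additive_category F by (rule F_additive)
  note o = S_Ob[OF distSD(2)[OF Y]]
  have cH: "c \<in> H K (obj Y (Suc n))" using c o[of "Suc n"] S_Ob[OF K] by (simp add: Hom_def)
  have "pull E c \<rho> \<in> \<E> K (obj Y 0)"
    by (rule pull_mem[OF cH o dist_ext[OF distSD(1)[OF Y]]]) simp
  then obtain X where X: "distS X (pull E c \<rho>)" "obj X 0 = obj Y 0" "obj X (Suc n) = K"
    using distS_ex[OF K distSD(2)[OF Y]] by blast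
  obtain f where f: "chain_map_on C 0 (Suc n) X Y f" "f (Suc n) = c"
    and M: "dist (mapping_cone C n X Y f) (push E (diff X 0) \<rho>)"
    using EA2[OF distSD(1)[OF Y], of c X] c X distSD(1)[OF X(1)] by auto
  have "obj (mapping_cone C n X Y f) i \<in> S" for i
    using distSD(2)[OF X(1)] distSD(2)[OF Y] dsum_S by (simp add: mapping_cone_def)
  hence "cov_exact F n (mapping_cone C n X Y f)" using M distS_cov_exact by (simp add: distS_def)
  hence "cov_left_exact F n (mapping_cone F n X Y f)"
    using F.cov_exact_iff mapping_cone_F[of X Y f] distSD(2)[OF X(1)] distSD(2)[OF Y] by simp
  moreover have "complex_on F 1 (Suc n) X"
    using F.con_exact_complex[OF distS_con_exact[OF X(1)]] by (simp add: complex_on_def)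
  moreover have "chain_map_on F 1 (Suc n) X Y f" using f(1) by (simp add: chain_map_on_def)
  ultimately show ?thesis using X f unfolding n_pullback_def by blast
qed

lemma F_n_exact: "n_exact_category F n {X. \<exists>\<delta>. distS X \<delta>}"
proof -
  interpret L: extension_calculus F E n distS by (rule F_calculus)
  show ?thesis
  proof (intro n_exact_category.intro n_exact_category_axioms.intro)
    show "additive_category F" by (rule F_additive)
  next
    fix X :: "('o, 'm) cpx" assume "X \<in> {X. \<exists>\<delta>. distS X \<delta>}"
    thus "n_exact_sequence F n X" using L.D_con L.D_cov by (auto simp: L.n_exact_sequence_iff)
  next
    fix X Y :: "('o, 'm) cpx" and f
    assume "n_exact_sequence F n X" "n_exact_sequence F n Y" and f: "weak_isomorphism F n X Y f"
    hence X: "con_exact F n X" "cov_exact F n X" and Y: "con_exact F n Y" "cov_exact F n Y"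
      by (auto simp: L.n_exact_sequence_iff)
    obtain k where ch: "chain_map_on F 0 (Suc n) X Y f" and k: "k \<le> Suc n"
      and iso: "is_iso F (obj X k) (obj Y k) (f k)"
        "is_iso F (obj X (if k = Suc n then 0 else Suc k)) (obj Y (if k = Suc n then 0 else Suc k))
          (f (if k = Suc n then 0 else Suc k))"
      using f unfolding weak_isomorphism_def Let_def by blast
    have "(\<exists>\<delta>. distS X \<delta>) \<longleftrightarrow> (\<exists>\<delta>. distS Y \<delta>)"
    \<comment> \<open>For k = n + 1 the invertible components sit in degrees n + 1 and 0, at the two
      ends, and each implication rests on one of them.\<close>
    proof (cases "k = Suc n")
      case True
      thus ?thesis using L.weak_iso_first[OF X(1) _ ch] L.weak_iso_last[OF Y(2) _ ch] iso by auto
    next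
      case False
      thus ?thesis using L.weak_iso_inner[OF X Y ch, of k] iso k by auto
    qed
    thus "X \<in> {X. \<exists>\<delta>. distS X \<delta>} \<longleftrightarrow> Y \<in> {X. \<exists>\<delta>. distS X \<delta>}" by simp
  next
    fix Z assume Z: "zero_object F Z"
    note z = F_zero_object[OF Z]
    have ZS: "Z \<in> S" using Z by (simp add: zero_object_def)
    \<comment> \<open>(E0) is an instance of (R2): the identity of a zero object is the zero map,
      which turns the complex of (R2) into the zero complex.\<close>
    have "left_id_cpx C Z Z = zero_cpx F Z" by (auto simp: left_id_cpx_def zero_cpx_def z(2) fun_eq_iff)
    hence "dist (zero_cpx F Z) \<one>\<^bsub>Ext E Z Z\<^esub>" using R2_left[OF z(1) S_Ob[OF ZS]] by simp
    thus "zero_cpx F Z \<in> {X. \<exists>\<delta>. distS X \<delta>}" using ZS by (auto simp: distS_def zero_cpx_def)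
  next
    fix A B D u v assume "first_mor {X. \<exists>\<delta>. distS X \<delta>} A B u" "first_mor {X. \<exists>\<delta>. distS X \<delta>} B D v"
    thus "first_mor {X. \<exists>\<delta>. distS X \<delta>} A D (v \<bullet>\<^bsub>F\<^esub> u)" by (rule L.first_mor_cmp)
  next
    fix A B D u v assume "last_mor n {X. \<exists>\<delta>. distS X \<delta>} A B u" "last_mor n {X. \<exists>\<delta>. distS X \<delta>} B D v"
    thus "last_mor n {X. \<exists>\<delta>. distS X \<delta>} A D (v \<bullet>\<^bsub>F\<^esub> u)" by (rule L.last_mor_cmp)
  next
    fix X :: "('o, 'm) cpx" and B a assume "X \<in> {X. \<exists>\<delta>. distS X \<delta>}" "B \<in> Ob F" "a \<in> arr F (obj X 0) B"
    then obtain Y f where "obj Y 0 = B" "f 0 = a" "n_pushout F n X Y f" "\<exists>\<rho>. distS Y \<rho>"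
      using F_pushout by fastforce
    thus "\<exists>Y f. obj Y 0 = B \<and> f 0 = a \<and> n_pushout F n X Y f \<and>
        first_mor {X. \<exists>\<delta>. distS X \<delta>} (obj Y 0) (obj Y 1) (diff Y 0)"
      by (auto simp: first_mor_def)
  next
    fix Y :: "('o, 'm) cpx" and K c assume "Y \<in> {X. \<exists>\<delta>. distS X \<delta>}" "K \<in> Ob F" "c \<in> arr F K (obj Y (Suc n))"
    then obtain X f where "obj X (Suc n) = K" "f (Suc n) = c" "n_pullback F n X Y f" "\<exists>\<rho>. distS X \<rho>"
      using F_pullback by fastforce
    thus "\<exists>X f. obj X (Suc n) = K \<and> f (Suc n) = c \<and> n_pullback F n X Y f \<and>
        last_mor n {X. \<exists>\<delta>. distS X \<delta>} (obj X n) (obj X (Suc n)) (diff X n)"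
      by (auto simp: last_mor_def)
  qed
qed

end

theorem theorem1p2:
  fixes C :: "('o, 'm) cat" and E :: "('o, 'm, 'e) bifunctor"
    and s :: "('o, 'm, 'e) realization" and n :: nat and \<A> :: "'o set"
  assumes "n > 0"
    and "n_exangulated_category C E n s"
    and "krull_schmidt C"
    and "enough_projectives C E n s"
    and "enough_injectives C E n s"
    and "subcategory C \<A>"
    and "n_extension_closed C E n s \<A>"
    and "\<forall>S\<in>Sigma_class C E n s \<A>. \<forall>A\<in>\<A>. arr C S A = {zerom C S A}"
    and "\<forall>A\<in>\<A>. \<forall>T\<in>Omega C E n s \<A>. arr C A T = {zerom C A T}"
  shows "n_exact_category (full_sub C \<A>) n (sub_conflations C E n s \<A>)"
proof -
  interpret vanishing_subcategory C E n s \<A>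
    by (intro vanishing_subcategory.intro vanishing_subcategory_axioms.intro) (use assms in auto)
  show ?thesis using F_n_exact by (simp only: sub_conflations_eq)
qed

end
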